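(* Let $T:I\to I$ be an interval exchange map of Roth type, with alphabet $\mathcal A$, combinatorial data $(\pi_0,\pi_1)$ and length data $\lambda$. Let $\Phi:I\to\mathbb R$ be a function such that, for every $\alpha\in\mathcal A$, the restriction of $\Phi$ to the interval $j_0(I_\alpha)$ is absolutely continuous and its derivative $\Phi'$ is of bounded variation on $j_0(I_\alpha)$, and such that $\int_I \Phi'(x)\,dx=0$. Then there exist a function $\chi:I\to\mathbb R$ which is constant on each interval $j_0(I_\alpha)$, $\alpha\in\mathcal A$, and a bounded function $\Psi:I\to\mathbb R$ such that $$\Psi-\Psi\circ T=\Phi-\chi .$$
   Context: Interval exchange maps. Let $\mathcal A$ be a finite alphabet with $d\ge2$ elements. Combinatorial data are two bijections $\pi_0,\pi_1:\mathcal A\to\{1,\dots,d\}$, assumed admissible: for every $k\in\{1,\dots,d-1\}$, $\pi_0^{-1}(\{1,\dots,k\})\neq\pi_1^{-1}(\{1,\dots,k\})$. Length data are $\lambda=(\lambda_\alpha)_{\alpha\in\mathcal A}\in(0,\infty)^{\mathcal A}$. Put $\lambda^*=\sum_\alpha\lambda_\alpha$, $I=[0,\lambda^* )$, $I_\alpha=[0,\lambda_\alpha)\times\{\alpha\}$, and for $\varepsilon\in\{0,1\}$ let $j_\varepsilon:\bigsqcup_\alpha I_\alpha\to I$, $j_\varepsilon(x,\alpha)=x+\sum_{\pi_\varepsilon(\beta)<\pi_\varepsilon(\alpha)}\lambda_\beta$. The interval exchange map (i.e.m.) is $T=j_1\circ j_0^{-1}$; it is a translation on each $j_0(I_\alpha)$.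 $T$ has the Keane property if there is no triple $(\alpha,\beta,m)$ with $\alpha,\beta\in\mathcal A$, $\pi_0(\beta)>1$, $m\ge1$ an integer, and $T^m(j_0(0,\alpha))=j_0(0,\beta)$. Rauzy–Veech step. Let $\alpha_0,\alpha_1$ be defined by $\pi_0(\alpha_0)=\pi_1(\alpha_1)=d$. If $\lambda_{\alpha_0}\ne\lambda_{\alpha_1}$ (always true under the Keane property), let $\varepsilon\in\{0,1\}$ with $\lambda_{\alpha_\varepsilon}>\lambda_{\alpha_{1-\varepsilon}}$. The first return map of $T$ to $[0,\lambda^*-\lambda_{\alpha_{1-\varepsilon}})$ is the i.e.m. $\hat T$ on the same alphabet with lengths $\hat\lambda_\alpha=\lambda_\alpha$ ($\alpha\ne\alpha_\varepsilon$), $\hat\lambda_{\alpha_\varepsilon}=\lambda_{\alpha_\varepsilon}-\lambda_{\alpha_{1-\varepsilon}}$, and combinatorial data $\hat\pi_\varepsilon=\pi_\varepsilon$, $\hat\pi_{1-\varepsilon}(\alpha)=\pi_{1-\varepsilon}(\alpha)$ if $\pi_{1-\varepsilon}(\alpha)\le\pi_{1-\varepsilon}(\alpha_\varepsilon)$, $\hat\pi_{1-\varepsilon}(\alpha)=\pi_{1-\varepsilon}(\alpha)+1$ if $\pi_{1-\varepsilon}(\alpha_\varepsilon)<\pi_{1-\varepsilon}(\alpha)<d$, $\hat\pi_{1-\varepsilon}(\alpha)=\pi_{1-\varepsilon}(\alpha_\varepsilon)+1$ if $\pi_{1-\varepsilon}(\alpha)=d$. The step has type $\varepsilon$, name $\alpha_\varepsilon$,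 secondary name $\alpha_{1-\varepsilon}$, and matrix $V=\mathbf I+E_{\alpha_\varepsilon\alpha_{1-\varepsilon}}$ (so $\lambda=V\hat\lambda$). If $T$ has the Keane property so does $\hat T$, so one gets iterates $T^{[0]}=T,T^{[1]},\dots$ with lengths $\lambda^{[n]}$ and matrices $V^{[n]}$, $\lambda^{[n-1]}=V^{[n]}\lambda^{[n]}$; every letter is the name of infinitely many steps. Accelerated algorithm. Let $n(0)=0$ and let $n(k+1)$ be the largest integer such that the steps of indices $n(k)<n\le n(k+1)$ have at most $d-1$ distinct names. Put $Z(k)=V^{[n(k-1)+1]}\cdots V^{[n(k)]}$ ($k\ge1$), $Q(k,l)=Z(k+1)\cdots Z(l)$ for $0\le k\le l$ (identity if $k=l$), $Q(l)=Q(0,l)$, $T^{(k)}=T^{[n(k)]}$, $\lambda^{(k)}=\lambda^{[n(k)]}$. $\|M\|$ denotes the sum of absolute values of the entries of a matrix $M$. For $0\le k\le l$ let $S(k,l):\mathbb R^{\mathcal A}\to\mathbb R^{\mathcal A}$ be the linear map with matrix ${}^tQ(k,l)$, and $S(l)=S(0,l)$. Roth type. $T$ is of Roth type if it has the Keane property and: (a) for every $\varepsilon>0$ there is $C_\varepsilon>0$ with $\|Z(k+1)\|\le C_\varepsilon\|Q(k)\|^\varepsilon$ for all $k\ge0$; (b) with $\Gamma_*=\{v\in\mathbb R^{\mathcal A}:\sum_\alpha\lambda_\alpha v_\alpha=0\}$, there are $\theta>0$, $C>0$ with $\|S(k)|_{\Gamma_*}\|\le C\|Q(k)\|^{1-\theta}$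 for all $k\ge0$; (c) for $k\ge0$ let $\Gamma^{(k)}_s$ be the linear subspace of those $v\in\mathbb R^{\mathcal A}$ for which there are $\sigma>0,C>0$ with $\|S(k,l)v\|\le C\|S(k,l)\|^{-\sigma}\|v\|$ for all $l\ge k$; $S(k,l)$ maps $\Gamma^{(k)}_s$ onto $\Gamma^{(l)}_s$ and induces an isomorphism $S_\flat(k,l):\mathbb R^{\mathcal A}/\Gamma^{(k)}_s\to\mathbb R^{\mathcal A}/\Gamma^{(l)}_s$; the condition is that for every $\varepsilon>0$ there is $C_\varepsilon>0$ with $\|S_\flat(k,l)^{-1}\|\le C_\varepsilon\|Q(l)\|^\varepsilon$ and $\|S(k,l)|_{\Gamma^{(k)}_s}\|\le C_\varepsilon\|Q(l)\|^\varepsilon$ for all $0\le k\le l$. (Norms on $\mathbb R^{\mathcal A}$ and induced operator/quotient norms are any fixed norms.) *)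

theory Defs
  imports "HOL-Analysis.Analysis"
begin

definition admissible :: "('a::finite \<Rightarrow> nat) \<Rightarrow> ('a \<Rightarrow> nat) \<Rightarrow> bool" where
  "admissible p0 p1 \<longleftrightarrow>
     bij_betw p0 UNIV {1..CARD('a)} \<and> bij_betw p1 UNIV {1..CARD('a)} \<and>
     (\<forall>k\<in>{1..<CARD('a)}. {a. p0 a \<le> k} \<noteq> {a. p1 a \<le> k})"

definition leftpt :: "('a::finite \<Rightarrow> nat) \<Rightarrow> ('a \<Rightarrow> real) \<Rightarrow> 'a \<Rightarrow> real" where
  "leftpt p l a = (\<Sum>b\<in>{b. p b < p a}. l b)"

definition subint :: "('a::finite \<Rightarrow> nat) \<Rightarrow> ('a \<Rightarrow> real) \<Rightarrow> 'a \<Rightarrow> real set" where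
  "subint p0 l a = {leftpt p0 l a ..< leftpt p0 l a + l a}"

definition total_length :: "('a::finite \<Rightarrow> real) \<Rightarrow> real" where
  "total_length l = (\<Sum>a\<in>UNIV. l a)"

text \<open>T = j_1 o j_0^{-1} on I = [0, lambda*); (identity outside I, irrelevant).\<close>
definition iem :: "('a::finite \<Rightarrow> nat) \<Rightarrow> ('a \<Rightarrow> nat) \<Rightarrow> ('a \<Rightarrow> real) \<Rightarrow> real \<Rightarrow> real" where
  "iem p0 p1 l x =
     (if \<exists>a. x \<in> subint p0 l a
      then (let a = (THE a. x \<in> subint p0 l a) in x - leftpt p0 l a + leftpt p1 l a)
      else x)"

definition keane :: "('a::finite \<Rightarrow> nat) \<Rightarrow> ('a \<Rightarrow> nat) \<Rightarrow> ('a \<Rightarrow> real) \<Rightarrow> bool" where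
  "keane p0 p1 l \<longleftrightarrow>
     \<not> (\<exists>a b m. p0 b > 1 \<and> m \<ge> 1 \<and>
          (iem p0 p1 l ^^ m) (leftpt p0 l a) = leftpt p0 l b)"

type_synonym 'a iemdata = "('a \<Rightarrow> nat) \<times> ('a \<Rightarrow> nat) \<times> ('a \<Rightarrow> real)"

definition lastl :: "('a::finite \<Rightarrow> nat) \<Rightarrow> 'a" where
  "lastl p = (THE a. p a = CARD('a))"

definition rv_perm :: "('a::finite \<Rightarrow> nat) \<Rightarrow> 'a \<Rightarrow> 'a \<Rightarrow> nat" where
  "rv_perm p w = (\<lambda>a. if p a \<le> p w then p a
                        else if p a < CARD('a) then p a + 1
                        else p w + 1)"

definition rv_type0 :: "('a::finite) iemdata \<Rightarrow> bool" where
  "rv_type0 s = (case s of (p0, p1, l) \<Rightarrow> l (lastl p0) > l (lastl p1))"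

definition winner :: "('a::finite) iemdata \<Rightarrow> 'a" where
  "winner s = (case s of (p0, p1, l) \<Rightarrow> if rv_type0 s then lastl p0 else lastl p1)"

definition loser :: "('a::finite) iemdata \<Rightarrow> 'a" where
  "loser s = (case s of (p0, p1, l) \<Rightarrow> if rv_type0 s then lastl p1 else lastl p0)"

definition rv_step :: "('a::finite) iemdata \<Rightarrow> 'a iemdata" where
  "rv_step s = (case s of (p0, p1, l) \<Rightarrow>
      if rv_type0 s
      then (p0, rv_perm p1 (lastl p0), l(lastl p0 := l (lastl p0) - l (lastl p1)))
      else (rv_perm p0 (lastl p1), p1, l(lastl p1 := l (lastl p1) - l (lastl p0))))"

definition rv_state :: "('a::finite) iemdata \<Rightarrow> nat \<Rightarrow> 'a iemdata" where
  "rv_state s n = (rv_step ^^ n) s"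

definition step_name :: "('a::finite) iemdata \<Rightarrow> nat \<Rightarrow> 'a" where
  "step_name s n = winner (rv_state s (n - 1))"

definition Vmat :: "('a::finite) iemdata \<Rightarrow> nat \<Rightarrow> real^'a^'a" where
  "Vmat s n = mat 1 + (\<chi> i j. if i = winner (rv_state s (n - 1)) \<and> j = loser (rv_state s (n - 1))
                               then 1 else 0)"

primrec nacc :: "('a::finite) iemdata \<Rightarrow> nat \<Rightarrow> nat" where
  "nacc s 0 = 0"
| "nacc s (Suc k) = (GREATEST N. nacc s k \<le> N \<and>
                       card (step_name s ` {nacc s k <.. N}) \<le> CARD('a) - 1)"

definition mprod :: "(nat \<Rightarrow> real^'a^'a) \<Rightarrow> nat list \<Rightarrow> real^'a^'a" where
  "mprod f xs = foldl (\<lambda>M i. M ** f i) (mat 1) xs"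

definition Zmat :: "('a::finite) iemdata \<Rightarrow> nat \<Rightarrow> real^'a^'a" where
  "Zmat s k = mprod (Vmat s) [nacc s (k - 1) + 1 ..< nacc s k + 1]"

definition Qmat :: "('a::finite) iemdata \<Rightarrow> nat \<Rightarrow> nat \<Rightarrow> real^'a^'a" where
  "Qmat s k l = mprod (Zmat s) [k + 1 ..< l + 1]"

definition mnorm :: "real^'a^'a \<Rightarrow> real" where
  "mnorm M = (\<Sum>i\<in>UNIV. \<Sum>j\<in>UNIV. \<bar>M $ i $ j\<bar>)"

definition Smap :: "('a::finite) iemdata \<Rightarrow> nat \<Rightarrow> nat \<Rightarrow> real^'a \<Rightarrow> real^'a" where
  "Smap s k l v = transpose (Qmat s k l) *v v"

definition Gamma_s :: "('a::finite) iemdata \<Rightarrow> nat \<Rightarrow> (real^'a) set" where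
  "Gamma_s s k = {v. \<exists>\<sigma>>0. \<exists>C>0. \<forall>l\<ge>k.
       norm (Smap s k l v) \<le> C * (onorm (Smap s k l)) powr (-\<sigma>) * norm v}"

text \<open>Condition (b) unfolds the restricted operator norm; condition (c) unfolds
  the quotient norms: the quotient norm of the class of v is infdist v Gamma, and the
  class of S(k,l) v is mapped by the inverse of the induced map to the class of v.\<close>
definition roth_type :: "('a::finite \<Rightarrow> nat) \<Rightarrow> ('a \<Rightarrow> nat) \<Rightarrow> ('a \<Rightarrow> real) \<Rightarrow> bool" where
  "roth_type p0 p1 l \<longleftrightarrow>
     (let s = (p0, p1, l) in
       keane p0 p1 l \<and>
       (\<forall>e>0. \<exists>C>0. \<forall>k. mnorm (Zmat s (k + 1)) \<le> C * mnorm (Qmat s 0 k) powr e) \<and>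
       (\<exists>\<theta>>0. \<exists>C>0. \<forall>k. \<forall>v::real^'a. (\<Sum>a\<in>UNIV. l a * v $ a) = 0 \<longrightarrow>
            norm (Smap s 0 k v) \<le> C * mnorm (Qmat s 0 k) powr (1 - \<theta>) * norm v) \<and>
       (\<forall>e>0. \<exists>C>0. \<forall>k m. k \<le> m \<longrightarrow>
            (\<forall>v. infdist v (Gamma_s s k)
                   \<le> C * mnorm (Qmat s 0 m) powr e * infdist (Smap s k m v) (Gamma_s s m)) \<and>
            (\<forall>v\<in>Gamma_s s k. norm (Smap s k m v) \<le> C * mnorm (Qmat s 0 m) powr e * norm v)))"

definition abs_continuous_on :: "real set \<Rightarrow> (real \<Rightarrow> real) \<Rightarrow> bool" where
  "abs_continuous_on S f \<longleftrightarrow>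
     (\<forall>e>0. \<exists>d>0. \<forall>D::(real \<times> real) set.
        finite D \<and> (\<forall>(a,b)\<in>D. a \<le> b \<and> {a..b} \<subseteq> S) \<and>
        (\<forall>p\<in>D. \<forall>q\<in>D. p \<noteq> q \<longrightarrow> {fst p<..<snd p} \<inter> {fst q<..<snd q} = {}) \<and>
        (\<Sum>(a,b)\<in>D. b - a) < d
        \<longrightarrow> (\<Sum>(a,b)\<in>D. \<bar>f b - f a\<bar>) < e)"

definition bounded_variation_on :: "real set \<Rightarrow> (real \<Rightarrow> real) \<Rightarrow> bool" where
  "bounded_variation_on S g \<longleftrightarrow>
     (\<exists>M. \<forall>xs. sorted xs \<and> set xs \<subseteq> S \<longrightarrow>
        (\<Sum>i<length xs - 1. \<bar>g (xs ! Suc i) - g (xs ! i)\<bar>) \<le> M)"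

end

theory Submission
  imports Defs
begin

text \<open>Let \<open>S(k)\<Phi>\<close> be the special Birkhoff sums of \<open>\<Phi>\<close> at the k-th level of the accelerated algorithm.
  Variation does not grow under this operation, so \<open>S(k)\<Phi>'\<close> stays within a bounded distance of its
  averages on the exchanged intervals. These averages follow the cocycle up to errors of the size of
  one block and have zero mean, so (a), (b) and interpolation between the trivial and the zero-mean
  bound give \<open>|S(k)\<Phi>'| \<le> C |Q(k)|^(1 - \<delta>)\<close>. The intervals of level k have length about \<open>1 / |Q(k)|\<close>;
  hence \<open>S(k)\<Phi>\<close> is constant on each of them up to a negative power of \<open>|Q(k)|\<close>. By (c) these
  constants can be corrected by the orbit of a single vector: in the quotient by the stable space the
  inverse cocycle makes the corrections converge, and in the stable space the errors contract. Then
  \<open>S(k)(\<Phi> - \<chi>)\<close> decays like a power of \<open>|Q(k)|\<close>, every Birkhoff sum of \<open>\<Phi> - \<chi>\<close> splits into few special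
  ones and is bounded, and \<open>\<Psi>\<close> is the upper limit of the Birkhoff sums.\<close>

section \<open>Interval exchange data and one induction step\<close>

text \<open>Condition (b) and the decay in the stable space are uniform only for vectors started at
  level 0, whereas errors arise at every level j. Pulling such an error back to level 0 costs about
  \<open>q j ^ CARD('a)\<close>, by Cramer's rule, and this alone would spoil the sum over j. The
  direct estimate from level j to level k has no such cost, but no gain in \<open>q k\<close>. A
  geometric mean of the two, with a small weight on the bound through level 0, keeps a negative
  power of \<open>q j\<close> and still gains in \<open>q k\<close>. The sum over j converges
  because q at least doubles every \<open>4 * CARD('a)\<close> blocks, a number of blocks over which
  all entries of the cocycle matrix become at least 1. The same positivity, with (a), makes all
  return times of one level comparable up to small powers. This gives the lengths of the intervals,
  and \<open>mnorm (Qmat s j k)\<close> is about \<open>q k / q j\<close>. The pull-backs of the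
  errors to level 0 need not be summable. Condition (c) controls only their distance to the stable
  space, so the correction is found in the quotient first and the stable remainder is estimated
  separately.\<close>

abbreviation rowt :: "'a::finite iemdata \<Rightarrow> 'a \<Rightarrow> nat" where "rowt s \<equiv> fst s"
abbreviation rowb :: "'a::finite iemdata \<Rightarrow> 'a \<Rightarrow> nat" where "rowb s \<equiv> fst (snd s)"
abbreviation lens :: "'a::finite iemdata \<Rightarrow> 'a \<Rightarrow> real" where "lens s \<equiv> snd (snd s)"

abbreviation is_order :: "('a::finite \<Rightarrow> nat) \<Rightarrow> bool" where
  "is_order p \<equiv> bij_betw p UNIV {1..CARD('a)}"

lemma is_orderD:
  fixes p :: "'a::finite \<Rightarrow> nat"
  assumes "is_order p"
  shows "inj p" "1 \<le> p a" "p a \<le> CARD('a)"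
  using assms by (auto simp: bij_betw_def)

lemma is_order_surj:
  fixes p :: "'a::finite \<Rightarrow> nat"
  assumes "is_order p" "1 \<le> k" "k \<le> CARD('a)"
  obtains a where "p a = k"
proof -
  have "k \<in> p ` UNIV" using assms unfolding bij_betw_def by auto
  then show thesis using that by auto
qed

lemma lastl_eq_iff:
  fixes p :: "'a::finite \<Rightarrow> nat"
  assumes "is_order p"
  shows "p a = CARD('a) \<longleftrightarrow> a = lastl p"
proof -
  obtain b where b: "p b = CARD('a)"
    using is_order_surj[OF assms, of "CARD('a)"] by (auto simp: Suc_leI)
  have "lastl p = b"
    unfolding lastl_def using b is_orderD(1)[OF assms] by (intro the_equality; metis injD)
  then show ?thesis using b is_orderD(1)[OF assms] by (metis injD)
qed

lemma lastl_pos [simp]: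
  fixes p :: "'a::finite \<Rightarrow> nat"
  assumes "is_order p"
  shows "p (lastl p) = CARD('a)"
  using lastl_eq_iff[OF assms] by blast

lemma less_lastl:
  fixes p :: "'a::finite \<Rightarrow> nat"
  assumes "is_order p" "a \<noteq> lastl p"
  shows "p a < CARD('a)"
  using lastl_eq_iff[OF assms(1), of a] is_orderD(3)[OF assms(1), of a] assms(2) by auto

lemma leftpt_add_le:
  fixes p :: "'a::finite \<Rightarrow> nat"
  assumes "\<forall>a. l a > 0" "p a < p b"
  shows "leftpt p l a + l a \<le> leftpt p l b"
proof -
  have "leftpt p l a + l a = sum l (insert a {b. p b < p a})"
    unfolding leftpt_def by simp
  also have "\<dots> \<le> leftpt p l b"
    unfolding leftpt_def by (rule sum_mono2) (use assms in \<open>auto intro: less_imp_le\<close>)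
  finally show ?thesis .
qed

lemma leftpt_nonneg:
  fixes p :: "'a::finite \<Rightarrow> nat"
  assumes "\<forall>a. l a > 0"
  shows "0 \<le> leftpt p l a"
  unfolding leftpt_def by (rule sum_nonneg) (use assms in \<open>auto intro: less_imp_le\<close>)

lemma leftpt_add_le_total:
  fixes p :: "'a::finite \<Rightarrow> nat"
  assumes "\<forall>a. l a > 0"
  shows "leftpt p l a + l a \<le> total_length l"
proof -
  have "leftpt p l a + l a = sum l (insert a {b. p b < p a})"
    unfolding leftpt_def by simp
  also have "\<dots> \<le> total_length l"
    unfolding total_length_def by (rule sum_mono2) (use assms in \<open>auto intro: less_imp_le\<close>)
  finally show ?thesis .
qed

lemma leftpt_lastl:
  fixes p :: "'a::finite \<Rightarrow> nat"
  assumes "is_order p"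
  shows "leftpt p l (lastl p) = total_length l - l (lastl p)"
proof -
  have "{b. p b < p (lastl p)} = UNIV - {lastl p}"
    using less_lastl[OF assms] assms by auto
  then show ?thesis
    unfolding leftpt_def total_length_def by (simp add: sum_diff1)
qed

text \<open>Among the letters whose interval starts at or before x, take the one in the largest
  position: its successor starts beyond x, and if it has none, its interval ends at the total
  length.\<close>

lemma exists_coord:
  fixes p :: "'a::finite \<Rightarrow> nat"
  assumes p: "is_order p" and "0 \<le> x" "x < total_length l"
  obtains a t where "0 \<le> t" "t < l a" "x = leftpt p l a + t"
proof -
  let ?S = "{a. leftpt p l a \<le> x}"
  obtain a1 where a1: "p a1 = 1"
    using is_order_surj[OF p, of 1] by (auto simp: Suc_leI)
  have "leftpt p l a1 = 0"
    unfolding leftpt_def using a1 is_orderD(2)[OF p]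
    by (intro sum.neutral) (metis less_one mem_Collect_eq not_one_le_zero)
  then have "a1 \<in> ?S" using assms by simp
  then have ne: "p ` ?S \<noteq> {}" by blast
  then have "Max (p ` ?S) \<in> p ` ?S" by (intro Max_in) auto
  then obtain a where a: "a \<in> ?S" "p a = Max (p ` ?S)" by auto
  have mx: "b \<in> ?S \<Longrightarrow> p b \<le> p a" for b using a(2) by simp
  have "x < leftpt p l a + l a"
  proof (cases "a = lastl p")
    case True
    then show ?thesis using leftpt_lastl[OF p, of l] assms by simp
  next
    case False
    then have "p a < CARD('a)" using less_lastl p by auto
    then obtain b where b: "p b = p a + 1"
      using is_order_surj[OF p, of "p a + 1"] by auto
    have "{c. p c < p b} = insert a {c. p c < p a}"
      using b is_orderD(1)[OF p] by (auto simp: less_Suc_eq dest: injD)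
    then have "leftpt p l b = leftpt p l a + l a" unfolding leftpt_def by simp
    moreover have "\<not> leftpt p l b \<le> x" using mx[of b] b by auto
    ultimately show ?thesis by simp
  qed
  then show thesis using that[of "x - leftpt p l a" a] a(1) by auto
qed

lemma subint_unique:
  fixes p :: "'a::finite \<Rightarrow> nat"
  assumes p: "is_order p" and pos: "\<forall>a. l a > 0" and "0 \<le> t" "t < l a"
  shows "leftpt p l a + t \<in> subint p l b \<longleftrightarrow> b = a"
proof
  assume b: "leftpt p l a + t \<in> subint p l b"
  show "b = a"
  proof (rule ccontr)
    assume "b \<noteq> a"
    then have "p a < p b \<or> p b < p a"
      using is_orderD(1)[OF p] by (metis injD nat_neq_iff)
    then show False
      using leftpt_add_le[OF pos, of p a b] leftpt_add_le[OF pos, of p b a] b assms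
      by (auto simp: subint_def)
  qed
qed (use assms in \<open>auto simp: subint_def\<close>)

lemma iem_coord:
  fixes p0 :: "'a::finite \<Rightarrow> nat"
  assumes p: "is_order p0" and pos: "\<forall>a. l a > 0" and "0 \<le> t" "t < l a"
  shows "iem p0 p1 l (leftpt p0 l a + t) = leftpt p1 l a + t"
proof -
  have "(THE b. leftpt p0 l a + t \<in> subint p0 l b) = a"
    using subint_unique[OF assms] by simp
  then show ?thesis
    unfolding iem_def using subint_unique[OF assms] by (auto simp: Let_def)
qed

text \<open>Passes from functions in interval coordinates to a function on I. Outside the union of
  the intervals the letter is unspecified, so only values inside the range carry meaning.\<close>

definition glue :: "('a::finite \<Rightarrow> nat) \<Rightarrow> ('a \<Rightarrow> real) \<Rightarrow> ('a \<Rightarrow> real \<Rightarrow> real) \<Rightarrow> real \<Rightarrow> real" where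
  "glue p l F x = (let a = (THE a. x \<in> subint p l a) in F a (x - leftpt p l a))"

lemma glue_coord:
  fixes p :: "'a::finite \<Rightarrow> nat"
  assumes p: "is_order p" and pos: "\<forall>a. l a > 0" and "0 \<le> t" "t < l a"
  shows "glue p l F (leftpt p l a + t) = F a t"
proof -
  have "(THE b. leftpt p l a + t \<in> subint p l b) = a"
    using subint_unique[OF assms] by simp
  then show ?thesis unfolding glue_def by simp
qed

lemma iem_in_range:
  fixes p0 :: "'a::finite \<Rightarrow> nat"
  assumes p: "is_order p0" and pos: "\<forall>a. l a > 0"
    and x: "x \<in> {0..<total_length l}"
  shows "iem p0 p1 l x \<in> {0..<total_length l}"
proof -
  obtain a t where "0 \<le> t" "t < l a" "x = leftpt p0 l a + t"
    using exists_coord[OF p, of x l] x by (metis atLeastLessThan_iff)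
  then show ?thesis
    using iem_coord[OF p pos] leftpt_nonneg[OF pos, of p1 a] leftpt_add_le_total[OF pos, of p1 a]
    by auto
qed

lemma lastl_rows_distinct:
  fixes p0 :: "'a::finite \<Rightarrow> nat"
  assumes adm: "admissible p0 p1" and card: "CARD('a) \<ge> 2"
  shows "lastl p0 \<noteq> lastl p1"
proof
  assume eq: "lastl p0 = lastl p1"
  have o: "is_order p0" "is_order p1" using adm by (auto simp: admissible_def)
  have *: "{a. p a \<le> CARD('a) - 1} = - {lastl p}" if "is_order p" for p :: "'a \<Rightarrow> nat"
  proof -
    have "p a \<le> CARD('a) - 1 \<longleftrightarrow> a \<noteq> lastl p" for a
      using lastl_eq_iff[OF that, of a] is_orderD(3)[OF that, of a] card by linarith
    then show ?thesis by auto
  qed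
  have "CARD('a) - 1 \<in> {1..<CARD('a)}" using card by auto
  then show False using adm *[OF o(1)] *[OF o(2)] eq unfolding admissible_def by metis
qed

lemma rv_perm_is_order:
  fixes p :: "'a::finite \<Rightarrow> nat"
  assumes p: "is_order p" and w: "p w < CARD('a)"
  shows "is_order (rv_perm p w)"
proof -
  have inj: "inj (rv_perm p w)"
  proof (rule injI)
    fix a b assume "rv_perm p w a = rv_perm p w b"
    then have "p a = p b"
      using is_orderD(3)[OF p, of a] is_orderD(3)[OF p, of b] w
      by (auto simp: rv_perm_def split: if_splits)
    then show "a = b" using is_orderD(1)[OF p] by (auto dest: injD)
  qed
  have "rv_perm p w ` UNIV \<subseteq> {1..CARD('a)}"
    using is_orderD(2,3)[OF p] w by (auto simp: rv_perm_def Suc_le_eq)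
  moreover have "card (rv_perm p w ` UNIV) = card {1..CARD('a)}"
    using card_image[OF inj] by simp
  ultimately have "rv_perm p w ` UNIV = {1..CARD('a)}"
    by (intro card_subset_eq) auto
  then show ?thesis using inj by (simp add: bij_betw_def)
qed

text \<open>The winner w is last in the unchanged row p, so an initial segment common to both rows
  omits w. In the changed row it then lies to the left of w, where nothing has moved, and so it was
  common before the step.\<close>

lemma rv_perm_admissible:
  fixes p :: "'a::finite \<Rightarrow> nat"
  assumes p: "is_order p" and q: "is_order q" and w: "p w = CARD('a)" "q w < CARD('a)"
    and adm: "\<And>k. k \<in> {1..<CARD('a)} \<Longrightarrow> {a. p a \<le> k} \<noteq> {a. q a \<le> k}"
    and k: "k \<in> {1..<CARD('a)}"
  shows "{a. p a \<le> k} \<noteq> {a. rv_perm q w a \<le> k}"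
proof
  assume eq: "{a. p a \<le> k} = {a. rv_perm q w a \<le> k}"
  have "w \<notin> {a. p a \<le> k}" using w k by auto
  then have "q w > k" using eq by (auto simp: rv_perm_def)
  then have "{a. rv_perm q w a \<le> k} = {a. q a \<le> k}"
    using w by (auto simp: rv_perm_def split: if_splits)
  then show False using adm[OF k] eq by simp
qed

lemma leftpt_shrink:
  fixes p :: "'a::finite \<Rightarrow> nat"
  assumes p: "is_order p" and w: "p w = CARD('a)"
  shows "leftpt p (l(w := c)) a = leftpt p l a"
  unfolding leftpt_def using is_orderD(3)[OF p, of a] w by (intro sum.cong) auto

text \<open>The loser u is inserted directly behind the winner w, which gives up exactly the length
  of u. The letters further right therefore keep their left ends, and only u moves.\<close>

lemma leftpt_rv_perm:
  fixes q :: "'a::finite \<Rightarrow> nat"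
  assumes q: "is_order q" and u: "q u = CARD('a)" and w: "q w < CARD('a)"
  shows "leftpt (rv_perm q w) (l(w := l w - l u)) a
           = (if a = u then leftpt q l w + (l w - l u) else leftpt q l a)"
proof -
  define l' where "l' = l(w := l w - l u)"
  note inj = is_orderD(1)[OF q]
  note le = is_orderD(3)[OF q]
  have last: "q b = CARD('a) \<longleftrightarrow> b = u" for b using u inj by (metis injD)
  have wu: "w \<noteq> u" using w u by auto
  have l'w: "l' w = l w - l u" and l': "b \<noteq> w \<Longrightarrow> l' b = l b" for b
    by (auto simp: l'_def)
  have "leftpt (rv_perm q w) l' a
           = (if a = u then leftpt q l w + (l w - l u) else leftpt q l a)"
  proof -
  consider "a = u" | "a \<noteq> u" "q a \<le> q w" | "a \<noteq> u" "q a > q w" by force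
  then show ?thesis
  proof cases
    case 1
    have "rv_perm q w b < rv_perm q w u \<longleftrightarrow> q b \<le> q w" for b
      using u w by (auto simp: rv_perm_def)
    moreover have "{b. q b \<le> q w} = insert w {b. q b < q w}"
      using inj by (auto simp: le_less dest: injD)
    ultimately have "leftpt (rv_perm q w) l' u = l' w + sum l' {b. q b < q w}"
      unfolding leftpt_def by simp
    also have "sum l' {b. q b < q w} = leftpt q l w"
      unfolding leftpt_def by (intro sum.cong) (auto intro: l')
    finally show ?thesis using 1 l'w by simp
  next
    case 2
    have "rv_perm q w b < rv_perm q w a \<longleftrightarrow> q b < q a" for b
      using 2 by (auto simp: rv_perm_def)
    then have "leftpt (rv_perm q w) l' a = sum l' {b. q b < q a}"
      unfolding leftpt_def by simp
    also have "\<dots> = leftpt q l a"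
      unfolding leftpt_def using 2 by (intro sum.cong) (auto intro: l')
    finally show ?thesis using 2 by simp
  next
    case 3
    have lt: "q a < CARD('a)" using 3 last le[of a] by (auto simp: le_less)
    have *: "rv_perm q w b < rv_perm q w a \<longleftrightarrow> q b < q a \<or> b = u" for b
      using 3 lt last[of b] le[of b] by (auto simp: rv_perm_def)
    define S where "S = {b. q b < q a} - {w}"
    have "{b. rv_perm q w b < rv_perm q w a} = insert u (insert w S)"
      using 3 * by (auto simp: S_def)
    moreover have "u \<notin> S" "w \<notin> S" using u lt by (auto simp: S_def)
    ultimately have "leftpt (rv_perm q w) l' a = l' u + (l' w + sum l' S)"
      unfolding leftpt_def using wu by simp
    then have "leftpt (rv_perm q w) l' a = l' u + (l' w + sum l' ({b. q b < q a} - {w}))"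
      by (simp add: S_def)
    also have "sum l' ({b. q b < q a} - {w}) = sum l ({b. q b < q a} - {w})"
      by (intro sum.cong) (auto intro: l')
    also have "l' u + (l' w + sum l ({b. q b < q a} - {w})) = leftpt q l a"
      unfolding leftpt_def using wu 3 l'w l'[of u] by (subst sum.remove[of "{b. q b < q a}" w]) auto
    finally show ?thesis using 3 by simp
  qed
  qed
  then show ?thesis by (simp add: l'_def)
qed


section \<open>Induction steps under the Keane property\<close>

abbreviation T_of :: "'a::finite iemdata \<Rightarrow> real \<Rightarrow> real" where
  "T_of s \<equiv> iem (rowt s) (rowb s) (lens s)"

abbreviation ltop :: "'a::finite iemdata \<Rightarrow> 'a \<Rightarrow> real" where
  "ltop s \<equiv> leftpt (rowt s) (lens s)"

abbreviation lbot :: "'a::finite iemdata \<Rightarrow> 'a \<Rightarrow> real" where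
  "lbot s \<equiv> leftpt (rowb s) (lens s)"

abbreviation range_of :: "'a::finite iemdata \<Rightarrow> real set" where
  "range_of s \<equiv> {0..<total_length (lens s)}"

definition keane_iem :: "'a::finite iemdata \<Rightarrow> bool" where
  "keane_iem s \<longleftrightarrow> CARD('a) \<ge> 2 \<and> admissible (rowt s) (rowb s) \<and> (\<forall>a. lens s a > 0) \<and>
     keane (rowt s) (rowb s) (lens s)"

lemma keane_iemD:
  fixes s :: "'a::finite iemdata"
  assumes "keane_iem s"
  shows "CARD('a) \<ge> 2" "admissible (rowt s) (rowb s)" "\<forall>a. lens s a > 0"
    "is_order (rowt s)" "is_order (rowb s)" "keane (rowt s) (rowb s) (lens s)"
  using assms by (auto simp: keane_iem_def admissible_def)

text \<open>Equal lengths would make T send the left end of the last bottom letter to that of the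
  last top letter, a connection with m = 1.\<close>

lemma keane_lastl_lens:
  assumes "keane_iem s"
  shows "lens s (lastl (rowt s)) \<noteq> lens s (lastl (rowb s))"
proof
  note k = keane_iemD[OF assms]
  assume eq: "lens s (lastl (rowt s)) = lens s (lastl (rowb s))"
  have "T_of s (ltop s (lastl (rowb s))) = lbot s (lastl (rowb s))"
    using iem_coord[OF k(4) k(3), of 0 "lastl (rowb s)" "rowb s"] k(3) by simp
  also have "\<dots> = ltop s (lastl (rowt s))"
    using k eq by (simp add: leftpt_lastl)
  finally have "(T_of s ^^ 1) (ltop s (lastl (rowb s)))
      = ltop s (lastl (rowt s))" by simp
  moreover have "rowt s (lastl (rowt s)) > 1" using k by simp
  ultimately show False using k(6) unfolding keane_def by blast
qed

lemma winner_loser: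
  assumes "keane_iem s"
  shows "winner s \<noteq> loser s" "lens s (loser s) < lens s (winner s)"
    "lens (rv_step s) = (lens s)(winner s := lens s (winner s) - lens s (loser s))"
    "{winner s, loser s} = {lastl (rowt s), lastl (rowb s)}"
proof -
  note k = keane_iemD[OF assms]
  obtain p0 p1 l where s: "s = (p0, p1, l)" by (cases s)
  show "winner s \<noteq> loser s" "lens s (loser s) < lens s (winner s)"
    "lens (rv_step s) = (lens s)(winner s := lens s (winner s) - lens s (loser s))"
    "{winner s, loser s} = {lastl (rowt s), lastl (rowb s)}"
    using lastl_rows_distinct[OF k(2,1)] keane_lastl_lens[OF assms]
    by (auto simp: winner_def loser_def rv_step_def rv_type0_def s)
qed

lemma rv_step_cases [consumes 1, case_names top bot]:
  fixes s :: "'a::finite iemdata"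
  assumes "keane_iem s"
  obtains "rowt s (winner s) = CARD('a)" "rowb s (loser s) = CARD('a)" "rowb s (winner s) < CARD('a)"
      "rowt (rv_step s) = rowt s" "rowb (rv_step s) = rv_perm (rowb s) (winner s)"
  | "rowb s (winner s) = CARD('a)" "rowt s (loser s) = CARD('a)" "rowt s (winner s) < CARD('a)"
      "rowb (rv_step s) = rowb s" "rowt (rv_step s) = rv_perm (rowt s) (winner s)"
proof (cases "rv_type0 s")
  case True
  obtain p0 p1 l where s: "s = (p0, p1, l)" by (cases s)
  note k = keane_iemD[OF assms]
  show thesis
    using that(1) True lastl_rows_distinct[OF k(2,1)] k(4,5) less_lastl[OF k(5)]
    by (auto simp: winner_def loser_def rv_step_def s)
next
  case False
  obtain p0 p1 l where s: "s = (p0, p1, l)" by (cases s)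
  note k = keane_iemD[OF assms]
  show thesis
    using that(2) False lastl_rows_distinct[OF k(2,1)] k(4,5) less_lastl[OF k(4)]
    by (auto simp: winner_def loser_def rv_step_def s)
qed

lemma rv_step_total:
  assumes "keane_iem s"
  shows "total_length (lens (rv_step s)) = total_length (lens s) - lens s (loser s)"
proof -
  have "total_length (lens (rv_step s)) = sum (lens (rv_step s)) (insert (winner s) (UNIV - {winner s}))"
    unfolding total_length_def by (simp add: insert_absorb)
  also have "\<dots> = lens s (winner s) - lens s (loser s) + sum (lens s) (UNIV - {winner s})"
    by (subst sum.insert) (auto simp: winner_loser[OF assms] intro!: sum.cong)
  also have "sum (lens s) (UNIV - {winner s}) = total_length (lens s) - lens s (winner s)"
    unfolding total_length_def by (simp add: sum_diff1)
  finally show ?thesis by simp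
qed

lemma rv_step_admissible:
  fixes s :: "'a::finite iemdata"
  assumes "keane_iem s"
  shows "admissible (rowt (rv_step s)) (rowb (rv_step s))"
  using assms
proof (cases rule: rv_step_cases)
  case top
  note k = keane_iemD[OF assms]
  have "{a. rowt s a \<le> k} \<noteq> {a. rv_perm (rowb s) (winner s) a \<le> k}" if "k \<in> {1..<CARD('a)}" for k
    using rv_perm_admissible[OF k(4,5) top(1,3) _ that] k(2) unfolding admissible_def by blast
  then show ?thesis
    using k rv_perm_is_order[OF k(5) top(3)] top by (auto simp: admissible_def)
next
  case bot
  note k = keane_iemD[OF assms]
  have "{a. rowb s a \<le> k} \<noteq> {a. rv_perm (rowt s) (winner s) a \<le> k}" if "k \<in> {1..<CARD('a)}" for k
    using rv_perm_admissible[OF k(5,4) bot(1,3) _ that] k(2) unfolding admissible_def by metis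
  then show ?thesis
    using k rv_perm_is_order[OF k(4) bot(3)] bot unfolding admissible_def by metis
qed

lemma rv_step_lens_pos:
  assumes "keane_iem s"
  shows "\<forall>a. lens (rv_step s) a > 0"
  using winner_loser[OF assms] keane_iemD[OF assms] by auto

lemma rv_step_leftpt:
  assumes "keane_iem s" "a \<noteq> loser s"
  shows "ltop (rv_step s) a = ltop s a"
    "lbot (rv_step s) a = lbot s a"
  using assms
proof (atomize (full), cases rule: rv_step_cases)
  case top
  note k = keane_iemD[OF assms(1)]
  show "ltop (rv_step s) a = ltop s a \<and>
    lbot (rv_step s) a = lbot s a"
    using leftpt_shrink[OF k(4) top(1)] leftpt_rv_perm[OF k(5) top(2,3)] assms(2)
    by (simp add: top winner_loser[OF assms(1)] del: fun_upd_apply)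
next
  case bot
  note k = keane_iemD[OF assms(1)]
  show "ltop (rv_step s) a = ltop s a \<and>
    lbot (rv_step s) a = lbot s a"
    using leftpt_shrink[OF k(5) bot(1)] leftpt_rv_perm[OF k(4) bot(2,3)] assms(2)
    by (simp add: bot winner_loser[OF assms(1)] del: fun_upd_apply)
qed

lemma lastl_leftpt_total:
  fixes p :: "'a::finite \<Rightarrow> nat"
  assumes "is_order p" "p u = CARD('a)"
  shows "leftpt p l u = total_length l - l u"
  using leftpt_lastl[OF assms(1), of l] lastl_eq_iff[OF assms(1), of u] assms(2) by simp

text \<open>In both cases the old map sends the loser's new interval onto the part of the total interval
  that is cut off.\<close>
lemma rv_step_loser_cases [consumes 1, case_names top bot]:
  assumes k: "keane_iem s"
  defines "w \<equiv> winner s" and "u \<equiv> loser s"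
  obtains "ltop (rv_step s) u = ltop s u" "lbot s u = ltop s w + (lens s w - lens s u)"
      "lbot (rv_step s) u = lbot s w + (lens s w - lens s u)"
      "lbot s u = total_length (lens s) - lens s u"
  | "ltop (rv_step s) u = ltop s w + (lens s w - lens s u)"
      "lbot s w + (lens s w - lens s u) = ltop s u" "lbot (rv_step s) u = lbot s u"
      "ltop s u = total_length (lens s) - lens s u"
  using k
proof (cases rule: rv_step_cases)
  case top
  note kd = keane_iemD[OF k]
  have "ltop s w = total_length (lens s) - lens s w" "lbot s u = total_length (lens s) - lens s u"
    using lastl_leftpt_total kd top by (auto simp: w_def u_def)
  then show thesis
    using that(1) leftpt_shrink[OF kd(4) top(1)] leftpt_rv_perm[OF kd(5) top(2,3)]
    by (simp add: top winner_loser[OF k] w_def u_def del: fun_upd_apply)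
next
  case bot
  note kd = keane_iemD[OF k]
  have "lbot s w = total_length (lens s) - lens s w" "ltop s u = total_length (lens s) - lens s u"
    using lastl_leftpt_total kd bot by (auto simp: w_def u_def)
  then show thesis
    using that(2) leftpt_shrink[OF kd(5) bot(1)] leftpt_rv_perm[OF kd(4) bot(2,3)]
    by (simp add: bot winner_loser[OF k] w_def u_def del: fun_upd_apply)
qed

section \<open>First return of the induced map\<close>

text \<open>Functions are given on each exchanged interval in the coordinate relative to its left end.
  In these coordinates summing over a first return is the same formula for both types of steps.\<close>
definition up :: "'a::finite iemdata \<Rightarrow> ('a \<Rightarrow> real \<Rightarrow> real) \<Rightarrow> 'a \<Rightarrow> real \<Rightarrow> real" where
  "up s F = (\<lambda>a x. if a = loser s
     then F a x + F (winner s) (x + (lens s (winner s) - lens s (loser s))) else F a x)"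

abbreviation glue_of :: "'a::finite iemdata \<Rightarrow> ('a \<Rightarrow> real \<Rightarrow> real) \<Rightarrow> real \<Rightarrow> real" where
  "glue_of s \<equiv> glue (rowt s) (lens s)"

lemma T_of_coord:
  assumes "keane_iem s" "0 \<le> t" "t < lens s a"
  shows "T_of s (ltop s a + t) = lbot s a + t"
  using iem_coord[OF keane_iemD(4,3)[OF assms(1)] assms(2,3)] .

lemma glue_of_coord:
  assumes "keane_iem s" "0 \<le> t" "t < lens s a"
  shows "glue_of s F (ltop s a + t) = F a t"
  using glue_coord[OF keane_iemD(4,3)[OF assms(1)] assms(2,3)] .

lemma T_of_in_range:
  assumes "keane_iem s" "x \<in> range_of s"
  shows "T_of s x \<in> range_of s"
  using iem_in_range[OF keane_iemD(4,3)[OF assms(1)] assms(2)] .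

lemma rv_step_orders:
  assumes "keane_iem s"
  shows "is_order (rowt (rv_step s))" "is_order (rowb (rv_step s))"
  using rv_step_admissible[OF assms] by (auto simp: admissible_def)

lemma rv_step_range_subset:
  assumes "keane_iem s"
  shows "range_of (rv_step s) \<subseteq> range_of s"
  using rv_step_total[OF assms] keane_iemD(3)[OF assms]
  by (auto intro: less_trans simp: less_diff_eq dest: less_imp_le)

text \<open>Letters other than the loser keep both left ends, so there the old map returns at once;
  points of the loser's new interval make a detour through the cut-off part. F is quantified inside
  each alternative because one itinerary has to serve several functions simultaneously.\<close>

lemma rv_step_first_return:
  assumes k: "keane_iem s" and x: "x \<in> range_of (rv_step s)"
  shows "(T_of s x \<in> range_of (rv_step s) \<and> T_of (rv_step s) x = T_of s x \<and>
      (\<forall>F. glue_of (rv_step s) (up s F) x = glue_of s F x)) \<or>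
    (T_of s x \<notin> range_of (rv_step s) \<and> T_of (rv_step s) x = T_of s (T_of s x) \<and>
      (\<forall>F. glue_of (rv_step s) (up s F) x = glue_of s F x + glue_of s F (T_of s x)))"
proof -
  let ?s = "rv_step s"
  note o = rv_step_orders[OF k] and pos = rv_step_lens_pos[OF k]
  obtain a t where t: "0 \<le> t" "t < lens ?s a" and xt: "x = ltop ?s a + t"
    using exists_coord[OF o(1), of x "lens ?s"] x by (metis atLeastLessThan_iff)
  note w = winner_loser[OF k]
  have pos': "lens s (loser s) > 0" using keane_iemD(3)[OF k] by auto
  have t': "t < lens s a" using t w pos' by (cases "a = winner s") auto
  have T': "T_of ?s x = lbot ?s a + t"
    using iem_coord[OF o(1) pos t] xt by simp
  have g': "glue_of ?s F x = F a t" for F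
    using glue_coord[OF o(1) pos t] xt by simp
  show ?thesis
  proof (cases "a = loser s")
    case False
    have "T_of s x = lbot ?s a + t" "\<And>F. glue_of s F x = F a t"
      using T_of_coord[OF k t(1) t'] glue_of_coord[OF k t(1) t'] rv_step_leftpt[OF k False] xt
      by auto
    moreover have "T_of ?s x \<in> range_of ?s" by (rule iem_in_range[OF o(1) pos x])
    ultimately show ?thesis using T' g' False by (auto simp: up_def)
  next
    \<comment> \<open>The two points of the orbit have coordinate t in the loser's interval and r in
      the winner's. The type of the step only decides which is visited first, and the sum does not
      see the order.\<close>
    case a: True
    define r where "r = lens s (winner s) - lens s (loser s) + t"
    have r: "0 \<le> r" "r < lens s (winner s)" using t(1) t' w a by (auto simp: r_def)
    note c = T_of_coord[OF k t(1) t'] glue_of_coord[OF k t(1) t']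
       T_of_coord[OF k r] glue_of_coord[OF k r]
    have up: "up s F a t = F a t + F (winner s) r" for F
      by (simp add: up_def a r_def algebra_simps)
    show ?thesis
      using k
    proof (cases rule: rv_step_loser_cases)
      case h: top
      have x': "x = ltop s a + t" using h xt a by simp
      have Tx: "T_of s x = ltop s (winner s) + r"
        using c(1) h a by (simp add: x' r_def)
      have "T_of s x \<ge> total_length (lens ?s)"
        using c(1) h a t by (simp add: x' rv_step_total[OF k])
      then have "T_of s x \<notin> range_of ?s" by simp
      moreover have "T_of ?s x = T_of s (T_of s x)" using c(3) T' h a unfolding Tx by (simp add: r_def)
      moreover have "glue_of ?s (up s F) x = glue_of s F x + glue_of s F (T_of s x)" for F
        unfolding g' up Tx c(4) using c(2) x' by simp
      ultimately show ?thesis by blast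
    next
      case h: bot
      have x': "x = ltop s (winner s) + r" using h xt a by (simp add: r_def)
      have Tx: "T_of s x = ltop s a + t"
        using c(3) h a unfolding x' by (simp add: r_def)
      have "T_of s x \<ge> total_length (lens ?s)"
        unfolding Tx using h a t by (simp add: rv_step_total[OF k])
      then have "T_of s x \<notin> range_of ?s" by simp
      moreover have "T_of ?s x = T_of s (T_of s x)" using c(1) T' h a unfolding Tx by simp
      moreover have "glue_of ?s (up s F) x = glue_of s F x + glue_of s F (T_of s x)" for F
        unfolding g' up Tx c(2) using c(4) x' by simp
      ultimately show ?thesis by blast
    qed
  qed
qed

text \<open>For either type the cut-off part is mapped onto the bottom interval of the loser for the
  induced map, so one step leads back.\<close>

lemma rv_step_return_outside:
  assumes k: "keane_iem s" and x: "x \<in> range_of s" "x \<notin> range_of (rv_step s)"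
  shows "T_of s x \<in> range_of (rv_step s)"
proof -
  let ?s = "rv_step s" and ?u = "loser s"
  note o = rv_step_orders[OF k] and pos = rv_step_lens_pos[OF k]
  note w = winner_loser[OF k]
  define t where "t = x - (total_length (lens s) - lens s ?u)"
  have t: "0 \<le> t" "t < lens s ?u" using x by (auto simp: t_def rv_step_total[OF k])
  define r where "r = lens s (winner s) - lens s ?u + t"
  have r: "0 \<le> r" "r < lens s (winner s)" using t w by (auto simp: r_def)
  have xt: "x = total_length (lens s) - lens s ?u + t" by (simp add: t_def)
  have tp: "t < lens ?s ?u" using t w by auto
  have "T_of s x = lbot ?s ?u + t"
    using k
  proof (cases rule: rv_step_loser_cases)
    case h: top
    have "x = ltop s (winner s) + r" using h xt by (simp add: r_def)
    then show ?thesis using T_of_coord[OF k r] h by (simp add: r_def)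
  next
    case bot
    then show ?thesis using T_of_coord[OF k t] xt by simp
  qed
  then show ?thesis
    using leftpt_nonneg[OF pos, of "rowb ?s" ?u] leftpt_add_le_total[OF pos, of "rowb ?s" ?u] t tp
    by auto
qed

text \<open>The bound 2 records that a first induced step with a detour uses up two old steps; the
  transfer of the Keane property has to discard one of them.\<close>

lemma rv_step_iterate:
  assumes k: "keane_iem s" and x: "x \<in> range_of (rv_step s)"
  shows "\<exists>m'\<ge>m. (T_of (rv_step s) ^^ m) x = (T_of s ^^ m') x \<and>
     (m \<ge> 1 \<and> T_of s x \<notin> range_of (rv_step s) \<longrightarrow> m' \<ge> 2)"
  using x
proof (induction m arbitrary: x)
  case 0
  show ?case by (intro exI[of _ 0]) auto
next
  case (Suc m)
  let ?s = "rv_step s"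
  have Tx: "T_of ?s x \<in> range_of ?s"
    using iem_in_range[OF rv_step_orders(1)[OF k] rv_step_lens_pos[OF k] Suc.prems] .
  obtain m' where m': "m' \<ge> m" "(T_of ?s ^^ m) (T_of ?s x) = (T_of s ^^ m') (T_of ?s x)"
    using Suc.IH[OF Tx] by blast
  have *: "(T_of ?s ^^ Suc m) x = (T_of s ^^ m') (T_of ?s x)"
    using m' by (simp add: funpow_Suc_right del: funpow.simps)
  show ?case
    using rv_step_first_return[OF k Suc.prems]
  proof
    assume h: "T_of s x \<in> range_of ?s \<and> T_of ?s x = T_of s x \<and>
      (\<forall>F. glue_of ?s (up s F) x = glue_of s F x)"
    show ?thesis using * m'(1) h
      by (intro exI[of _ "Suc m'"]) (simp add: funpow_Suc_right del: funpow.simps)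
  next
    assume h: "T_of s x \<notin> range_of ?s \<and> T_of ?s x = T_of s (T_of s x) \<and>
      (\<forall>F. glue_of ?s (up s F) x = glue_of s F x + glue_of s F (T_of s x))"
    show ?thesis using * m'(1) h
      by (intro exI[of _ "Suc (Suc m')"]) (simp add: funpow_Suc_right del: funpow.simps)
  qed
qed

text \<open>A connection of the induced map yields one of the old map, because every new left end is
  an old one or becomes one after a single old step.\<close>

lemma rv_step_keane:
  assumes k: "keane_iem s"
  shows "keane (rowt (rv_step s)) (rowb (rv_step s)) (lens (rv_step s))"
  unfolding keane_def
proof (rule notI, elim exE conjE)
  let ?s = "rv_step s"
  let ?L = "ltop s" and ?L' = "ltop ?s"
  fix a b m
  assume b: "rowt ?s b > 1" and m: "1 \<le> m" and eq: "(T_of ?s ^^ m) (?L' a) = ?L' b"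
  note pos = rv_step_lens_pos[OF k] and w = winner_loser[OF k]
  have a': "?L' a \<in> range_of ?s" for a
  proof -
    have "lens ?s a > 0" using pos by blast
    then show ?thesis
      using leftpt_nonneg[OF pos, of "rowt ?s" a] leftpt_add_le_total[OF pos, of "rowt ?s" a] by simp
  qed
  \<comment> \<open>The second alternative arises when the top interval of the loser moves. Its new
    left end is then mapped to the old one, which is the right end of the shortened range.\<close>
  have e: "?L' c = ?L c \<or> (T_of s (?L' c) = ?L c \<and> T_of s (?L' c) \<notin> range_of ?s)" for c
  proof (cases "c = loser s")
    case False
    then show ?thesis using rv_step_leftpt[OF k] by simp
  next
    case True
    have "0 \<le> lens s (winner s) - lens s (loser s)" 
      "lens s (winner s) - lens s (loser s) < lens s (winner s)"
      using w keane_iemD(3)[OF k] by auto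
    note Tw = T_of_coord[OF k this]
    show ?thesis
      using k by (cases rule: rv_step_loser_cases) (use Tw in \<open>auto simp: True rv_step_total[OF k]\<close>)
  qed
  have b1: "rowt s b > 1"
  proof (rule ccontr)
    assume "\<not> rowt s b > 1"
    then have *: "rowt s b \<le> rowt s (winner s)" "rowt s b \<le> 1"
      using is_orderD(2)[OF keane_iemD(4)[OF k], of "winner s"] by auto
    have "rowt ?s b \<le> 1"
      using k by (cases rule: rv_step_cases) (use * in \<open>auto simp: rv_perm_def\<close>)
    then show False using b by simp
  qed
  obtain m' where m': "m' \<ge> m" "(T_of s ^^ m') (?L' a) = ?L' b"
     "T_of s (?L' a) \<notin> range_of ?s \<longrightarrow> m' \<ge> 2"
    using rv_step_iterate[OF k a', of m a] unfolding eq using m by metis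
  have nk: "(T_of s ^^ j) (?L a) \<noteq> ?L b" if "j \<ge> 1" for j
    using keane_iemD(6)[OF k] b1 that unfolding keane_def by blast
  \<comment> \<open>One further old step is needed when the left end of b has changed.\<close>
  define eb where "eb = (if ?L' b = ?L b then 0 else 1::nat)"
  have "(T_of s ^^ eb) (?L' b) = ?L b" using e[of b] by (auto simp: eb_def)
  then have B: "(T_of s ^^ (eb + m')) (?L' a) = ?L b"
    using m'(2) by (simp add: funpow_add)
  show False
  proof (cases "?L' a = ?L a")
    case True
    then show False using nk[of "eb + m'"] B m' m by simp
  next
    \<comment> \<open>The orbit of the old left end starts one step later; as \<open>m'\<close> is
      at least 2, at least one step is left.\<close>
    case False
    then have A: "T_of s (?L' a) = ?L a" and "m' \<ge> 2" using e[of a] m'(3) by auto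
    then obtain j where j: "eb + m' = Suc j" "j \<ge> 1" by (cases "eb + m'") auto
    have "(T_of s ^^ j) (?L a) = ?L b"
      using B unfolding j by (simp add: funpow_Suc_right A del: funpow.simps)
    then show False using nk j by blast
  qed
qed

lemma keane_iem_rv_step:
  assumes "keane_iem s"
  shows "keane_iem (rv_step s)"
  using rv_step_keane[OF assms] rv_step_admissible[OF assms] rv_step_lens_pos[OF assms]
    keane_iemD(1)[OF assms]
  unfolding keane_iem_def by blast

lemma rv_state_0 [simp]: "rv_state s 0 = s"
  by (simp add: rv_state_def)

lemma rv_state_Suc: "rv_state s (Suc n) = rv_step (rv_state s n)"
  by (simp add: rv_state_def)

lemma keane_iem_rv_state:
  assumes "keane_iem s"
  shows "keane_iem (rv_state s n)"
  by (induction n) (auto simp: rv_state_Suc assms keane_iem_rv_step)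

section \<open>Every letter wins infinitely often\<close>

lemma lens_antimono:
  assumes k: "keane_iem s" and "m \<le> n"
  shows "lens (rv_state s n) a \<le> lens (rv_state s m) a"
  using assms(2)
proof (induction n rule: dec_induct)
  case (step n)
  note kn = keane_iem_rv_state[OF k, of n]
  have "lens (rv_state s n) (loser (rv_state s n)) > 0" using keane_iemD(3)[OF kn] by blast
  then have "lens (rv_state s (Suc n)) a \<le> lens (rv_state s n) a"
    by (simp add: rv_state_Suc winner_loser(3)[OF kn])
  then show ?case using step by simp
qed simp

text \<open>The total length decreases and is nonnegative, so its drops, which are the lengths of
  the losers, tend to 0.\<close>

lemma loser_lens_tendsto_0:
  assumes k: "keane_iem s"
  shows "(\<lambda>n. lens (rv_state s n) (loser (rv_state s n))) \<longlonglongrightarrow> 0"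
proof -
  let ?t = "\<lambda>n. total_length (lens (rv_state s n))"
  have eq: "lens (rv_state s n) (loser (rv_state s n)) = ?t n - ?t (Suc n)" for n
    by (simp add: rv_state_Suc rv_step_total[OF keane_iem_rv_state[OF k]])
  have pos: "lens (rv_state s n) a > 0" for n a
    using keane_iemD(3)[OF keane_iem_rv_state[OF k]] by blast
  have "decseq ?t"
    unfolding total_length_def by (intro decseq_SucI sum_mono lens_antimono[OF k]) simp
  moreover have "0 \<le> ?t n" for n
    unfolding total_length_def by (intro sum_nonneg less_imp_le pos)
  ultimately obtain L where L: "?t \<longlonglongrightarrow> L" using decseq_convergent[of ?t 0] by blast
  have "(\<lambda>n. ?t n - ?t (Suc n)) \<longlonglongrightarrow> L - L"
    using L LIMSEQ_Suc by (intro tendsto_diff) auto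
  then show ?thesis unfolding eq by simp
qed

lemma lastl_shift:
  fixes p :: "'a::finite \<Rightarrow> nat"
  shows "p a < CARD('a) \<Longrightarrow> p a \<le> rv_perm p w a"
    and "p a < CARD('a) \<Longrightarrow> rv_perm p w a = p a \<Longrightarrow> p a \<le> p w"
    and "p a < p b \<Longrightarrow> p a \<le> p w \<Longrightarrow> rv_perm p w a < rv_perm p w b"
  by (auto simp: rv_perm_def split: if_splits)

text \<open>The length \<open>card B\<close> of the segment does not depend on the row. If B is on
  the left of its complement in both rows, the two rows share an initial segment, which is what
  admissibility forbids.\<close>

lemma initial_segment_of_order:
  fixes p :: "'a::finite \<Rightarrow> nat"
  assumes p: "is_order p" and B: "\<And>a b. a \<in> B \<Longrightarrow> b \<notin> B \<Longrightarrow> p a < p b"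
  shows "B = {a. p a \<le> card B}"
proof -
  have cp: "card {x. p x \<le> j} = j" if "j \<le> CARD('a)" for j
  proof -
    have "p ` {x. p x \<le> j} = {1..j}"
    proof
      show "{1..j} \<subseteq> p ` {x. p x \<le> j}"
      proof
        fix i assume "i \<in> {1..j}"
        then show "i \<in> p ` {x. p x \<le> j}"
          using is_order_surj[OF p, of i] that by (metis atLeastAtMost_iff imageI le_trans mem_Collect_eq)
      qed
    qed (use is_orderD(2)[OF p] in auto)
    then show ?thesis
      using card_image[OF inj_on_subset[OF is_orderD(1)[OF p]], of "{x. p x \<le> j}"] by simp
  qed
  have "p a \<le> card B" if "a \<in> B" for a
  proof -
    have "{x. p x \<le> p a} \<subseteq> B" using B[OF that] by force
    then have "card {x. p x \<le> p a} \<le> card B" by (intro card_mono) auto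
    then show ?thesis using cp[OF is_orderD(3)[OF p]] by simp
  qed
  moreover have "\<not> p b \<le> card B" if "b \<notin> B" for b
  proof -
    have "B \<subseteq> {x. p x \<le> p b - 1}" using B that by force
    then have "card B \<le> card {x. p x \<le> p b - 1}" by (intro card_mono) auto
    also have "\<dots> = p b - 1" using cp[of "p b - 1"] is_orderD(3)[OF p, of b] by simp
    finally show ?thesis using is_orderD(2)[OF p, of b] by simp
  qed
  ultimately show ?thesis by auto
qed

lemma bounded_mono_eventually_const:
  fixes f :: "nat \<Rightarrow> nat"
  assumes mono: "\<And>n. n \<ge> N \<Longrightarrow> f n \<le> f (Suc n)" and bd: "\<And>n. f n \<le> B"
  shows "\<forall>\<^sub>F n in sequentially. f (Suc n) = f n"
proof -
  let ?g = "\<lambda>n. real (f (n + N))"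
  have "incseq ?g" by (rule incseq_SucI) (use mono in auto)
  moreover have "\<forall>i. ?g i \<le> real B" using bd by simp
  ultimately obtain L where "?g \<longlonglongrightarrow> L" using incseq_convergent by blast
  then have "(\<lambda>n. ?g (Suc n) - ?g n) \<longlonglongrightarrow> L - L"
    using LIMSEQ_Suc[of ?g] by (intro tendsto_diff)
  then have "\<forall>\<^sub>F n in sequentially. dist (?g (Suc n) - ?g n) 0 < 1"
    by (intro tendstoD) auto
  then have "\<forall>\<^sub>F n in sequentially. f (Suc (n + N)) = f (n + N)"
  proof eventually_elim
    case (elim n)
    then show ?case using mono[of "n + N"] by (simp add: dist_real_def)
  qed
  then show ?thesis
    using eventually_sequentially_seg[of "\<lambda>n. f (Suc n) = f n" N] by simp
qed

text \<open>In the row that changes, exactly the letters strictly between the winner and the end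
  shift, by one place to the right. A letter that does not shift is thus left of the winner there;
  in the other row the winner is last.\<close>

lemma rv_step_row_mono:
  fixes s :: "'a::finite iemdata"
  assumes k: "keane_iem s" and a: "a \<noteq> winner s" "a \<noteq> loser s"
  shows "rowt s a \<le> rowt (rv_step s) a" "rowb s a \<le> rowb (rv_step s) a"
    "rowt (rv_step s) a = rowt s a \<Longrightarrow> rowb (rv_step s) a = rowb s a \<Longrightarrow>
       rowt s a < rowt s (winner s) \<and> rowb s a < rowb s (winner s)"
    "rowt (rv_step s) a = rowt s a \<Longrightarrow> rowb (rv_step s) a = rowb s a \<Longrightarrow> rowt s a < rowt s b
       \<Longrightarrow> rowt (rv_step s) a < rowt (rv_step s) b"
    "rowt (rv_step s) a = rowt s a \<Longrightarrow> rowb (rv_step s) a = rowb s a \<Longrightarrow> rowb s a < rowb s b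
       \<Longrightarrow> rowb (rv_step s) a < rowb (rv_step s) b"
proof -
  note kd = keane_iemD[OF k]
  have lt: "rowt s a < CARD('a)" "rowb s a < CARD('a)"
    using a winner_loser(4)[OF k] less_lastl kd(4,5) by blast+
  have ne: "rowt s a \<noteq> rowt s (winner s)" "rowb s a \<noteq> rowb s (winner s)"
    using a is_orderD(1)[OF kd(4)] is_orderD(1)[OF kd(5)] by (auto dest: injD)
  show "rowt s a \<le> rowt (rv_step s) a" "rowb s a \<le> rowb (rv_step s) a"
    using k lt by (atomize (full), cases rule: rv_step_cases) (auto intro: lastl_shift(1))
  show "rowt s a < rowt s (winner s) \<and> rowb s a < rowb s (winner s)"
    if "rowt (rv_step s) a = rowt s a" "rowb (rv_step s) a = rowb s a"
    using k
  proof (cases rule: rv_step_cases)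
    case top
    then show ?thesis using that lt ne lastl_shift(2)[of "rowb s" a "winner s"] by simp
  next
    case bot
    then show ?thesis using that lt ne lastl_shift(2)[of "rowt s" a "winner s"] by simp
  qed
  show "rowt (rv_step s) a < rowt (rv_step s) b"
    if "rowt (rv_step s) a = rowt s a" "rowb (rv_step s) a = rowb s a" "rowt s a < rowt s b"
    using k
  proof (cases rule: rv_step_cases)
    case bot
    then show ?thesis
      using that lt lastl_shift(3)[of "rowt s" a b "winner s"] lastl_shift(2)[of "rowt s" a "winner s"]
      by simp
  qed (use that in simp)
  show "rowb (rv_step s) a < rowb (rv_step s) b"
    if "rowt (rv_step s) a = rowt s a" "rowb (rv_step s) a = rowb s a" "rowb s a < rowb s b"
    using k
  proof (cases rule: rv_step_cases)
    case top
    then show ?thesis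
      using that lt lastl_shift(3)[of "rowb s" a b "winner s"] lastl_shift(2)[of "rowb s" a "winner s"]
      by simp
  qed (use that in simp)
qed

text \<open>Letters that win finitely often are eventually neither winners nor losers; they then
  stand still and stay on the left of all others in both rows, against admissibility.\<close>
lemma winner_infinitely_often:
  fixes s :: "'a::finite iemdata"
  assumes k: "keane_iem s"
  shows "\<exists>\<^sub>F n in sequentially. winner (rv_state s n) = c"
proof -
  let ?r = "rv_state s"
  define B where "B = {a. \<not> (\<exists>\<^sub>F n in sequentially. winner (?r n) = a)}"
  note kn = keane_iem_rv_state[OF k]
  have W: "\<forall>\<^sub>F n in sequentially. winner (?r n) \<notin> B"
  proof -
    have "\<forall>\<^sub>F n in sequentially. \<forall>a\<in>B. winner (?r n) \<noteq> a"
      by (intro eventually_ball_finite) (auto simp: B_def not_frequently)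
    then show ?thesis by (rule eventually_mono) auto
  qed
  then obtain N where N: "\<And>n. n \<ge> N \<Longrightarrow> winner (?r n) \<notin> B"
    by (auto simp: eventually_sequentially)
  \<comment> \<open>Only winners lose length.\<close>
  have const: "lens (?r n) a = lens (?r N) a" if "n \<ge> N" "a \<in> B" for n a
    using that(1)
  proof (induction n rule: dec_induct)
    case (step n)
    then show ?case using N[OF step(1)] that(2) by (auto simp: rv_state_Suc winner_loser(3)[OF kn])
  qed simp
  \<comment> \<open>The lengths of the losers tend to 0, while those of letters in B are eventually
    constant and positive.\<close>
  have U: "\<forall>\<^sub>F n in sequentially. loser (?r n) \<notin> B"
  proof -
    have "\<forall>\<^sub>F n in sequentially. loser (?r n) \<noteq> a" if "a \<in> B" for a
    proof -
      have "lens (?r N) a > 0" using keane_iemD(3)[OF kn] by blast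
      then have "\<forall>\<^sub>F n in sequentially. dist (lens (?r n) (loser (?r n))) 0 < lens (?r N) a"
        by (rule tendstoD[OF loser_lens_tendsto_0[OF k]])
      then show ?thesis
        using eventually_ge_at_top[of N]
      proof eventually_elim
        case (elim n)
        then show ?case using const[OF elim(2) that] by auto
      qed
    qed
    then have "\<forall>\<^sub>F n in sequentially. \<forall>a\<in>B. loser (?r n) \<noteq> a"
      by (intro eventually_ball_finite) auto
    then show ?thesis by (rule eventually_mono) auto
  qed
  obtain N1 where N1: "\<And>n. n \<ge> N1 \<Longrightarrow> winner (?r n) \<notin> B" "\<And>n. n \<ge> N1 \<Longrightarrow> loser (?r n) \<notin> B"
    using eventually_conj[OF W U] by (auto simp: eventually_sequentially)
  have "\<forall>\<^sub>F n in sequentially. rowt (?r (Suc n)) a = rowt (?r n) a \<and> rowb (?r (Suc n)) a = rowb (?r n) a"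
    if "a \<in> B" for a
  proof (intro eventually_conj)
    have ne: "a \<noteq> winner (?r n)" "a \<noteq> loser (?r n)" if "n \<ge> N1" for n
      using N1 that \<open>a \<in> B\<close> by blast+
    show "\<forall>\<^sub>F n in sequentially. rowt (?r (Suc n)) a = rowt (?r n) a"
      using rv_step_row_mono(1)[OF kn ne] is_orderD(3)[OF keane_iemD(4)[OF kn]]
      by (intro bounded_mono_eventually_const[of N1 _ "CARD('a)"]) (auto simp: rv_state_Suc)
    show "\<forall>\<^sub>F n in sequentially. rowb (?r (Suc n)) a = rowb (?r n) a"
      using rv_step_row_mono(2)[OF kn ne] is_orderD(3)[OF keane_iemD(5)[OF kn]]
      by (intro bounded_mono_eventually_const[of N1 _ "CARD('a)"]) (auto simp: rv_state_Suc)
  qed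
  then have "\<forall>\<^sub>F n in sequentially. \<forall>a\<in>B. rowt (?r (Suc n)) a = rowt (?r n) a
      \<and> rowb (?r (Suc n)) a = rowb (?r n) a"
    by (intro eventually_ball_finite) auto
  then obtain N2 where N2: "\<And>n a. n \<ge> N2 \<Longrightarrow> a \<in> B \<Longrightarrow>
      rowt (?r (Suc n)) a = rowt (?r n) a \<and> rowb (?r (Suc n)) a = rowb (?r n) a"
    by (auto simp: eventually_sequentially)
  define M where "M = max N1 N2"
  have M: "a \<noteq> winner (?r n)" "a \<noteq> loser (?r n)"
      "rowt (rv_step (?r n)) a = rowt (?r n) a" "rowb (rv_step (?r n)) a = rowb (?r n) a"
    if "n \<ge> M" "a \<in> B" for n a
    using N1[of n] N2[of n a] that by (auto simp: M_def rv_state_Suc)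
  \<comment> \<open>At the moment b wins, a letter a that stands still is on its left in both rows,
    and this order survives all later steps.\<close>
  have stay: "rowt (?r n) a < rowt (?r n) b \<and> rowb (?r n) a < rowb (?r n) b"
    if "m \<ge> M" "n \<ge> m" "a \<in> B" "winner (?r m) = b" for m n a b
    using that(2)
  proof (induction n rule: dec_induct)
    case base
    show ?case using rv_step_row_mono(3)[OF kn M(1,2,3,4)] that(1,3,4) by auto
  next
    case (step n)
    have "n \<ge> M" using step that by simp
    then show ?case
      using rv_step_row_mono(4,5)[OF kn M(1,2,3,4), of n a b] step that(3)
      by (simp add: rv_state_Suc)
  qed
  have "\<exists>m\<ge>M. winner (?r m) = b" if "b \<notin> B" for b
    using that unfolding B_def frequently_sequentially by auto
  then obtain m where m: "\<And>b. b \<notin> B \<Longrightarrow> m b \<ge> M \<and> winner (?r (m b)) = b" by metis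
  \<comment> \<open>A time not earlier than the chosen win of any letter, so that all comparisons
    hold simultaneously.\<close>
  define n where "n = M + (\<Sum>b\<in>UNIV. m b)"
  have nb: "n \<ge> m b" for b
    unfolding n_def by (rule trans_le_add2) (simp add: member_le_sum)
  have *: "rowt (?r n) a < rowt (?r n) b \<and> rowb (?r n) a < rowb (?r n) b" if "a \<in> B" "b \<notin> B" for a b
    using stay[of "m b" n a b] m[OF that(2)] nb that(1) by blast
  note kd = keane_iemD[OF kn[of n]]
  have "{a. rowt (?r n) a \<le> card B} = {a. rowb (?r n) a \<le> card B}"
    using initial_segment_of_order[OF kd(4), of B] initial_segment_of_order[OF kd(5), of B] * by blast
  then have "card B \<notin> {1..<CARD('a)}" using kd(2) unfolding admissible_def by blast
  moreover have "card B < CARD('a)"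
  proof -
    have "winner (?r N) \<notin> B" using N by blast
    then have "B \<subset> UNIV" by blast
    then show ?thesis by (intro psubset_card_mono) auto
  qed
  ultimately have "B = {}" by (auto simp: Suc_le_eq)
  then show ?thesis unfolding B_def by blast
qed

lemma step_name_Suc: "step_name s (Suc n) = winner (rv_state s n)"
  by (simp add: step_name_def)

text \<open>Since every letter wins again, the candidates in \<open>GREATEST\<close> are bounded and
  the maximum is attained. By maximality, one step beyond the block completes the alphabet.\<close>

lemma nacc_Suc_bounds:
  fixes s :: "'a::finite iemdata"
  assumes k: "keane_iem s"
  shows "nacc s k' < nacc s (Suc k')"
    "step_name s ` {nacc s k' <.. Suc (nacc s (Suc k'))} = UNIV"
proof -
  let ?P = "\<lambda>N. nacc s k' \<le> N \<and> card (step_name s ` {nacc s k' <.. N}) \<le> CARD('a) - 1"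
  note card2 = keane_iemD(1)[OF k]
  have "\<exists>n\<ge>nacc s k'. winner (rv_state s n) = c" for c
    using winner_infinitely_often[OF k, of c] unfolding frequently_sequentially by blast
  then obtain m where m: "\<And>c. m c \<ge> nacc s k' \<and> winner (rv_state s (m c)) = c" by metis
  \<comment> \<open>Every letter is the name of a step of the current stretch of index at most B.
    The index of a step exceeds that of the state it starts from by one, whence
    \<open>Suc\<close>.\<close>
  define B where "B = (\<Sum>c\<in>UNIV. Suc (m c))"
  have mB: "Suc (m c) \<le> B" for c
    unfolding B_def using member_le_sum[of c UNIV "\<lambda>c. Suc (m c)"] by simp
  have bd: "N \<le> B" if "?P N" for N
  proof (rule ccontr)
    assume "\<not> N \<le> B"
    then have "c \<in> step_name s ` {nacc s k' <.. N}" for c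
      using m[of c] mB[of c] by (intro image_eqI[of _ _ "Suc (m c)"]) (auto simp: step_name_Suc)
    then have "step_name s ` {nacc s k' <.. N} = UNIV" by blast
    then have "card (step_name s ` {nacc s k' <.. N}) = CARD('a)" by simp
    then show False using that card2 by linarith
  qed
  have eq: "nacc s (Suc k') = Greatest ?P" by simp
  have P1: "?P (Suc (nacc s k'))"
  proof -
    have "{nacc s k' <.. Suc (nacc s k')} = {Suc (nacc s k')}" by auto
    then show ?thesis using card2 by simp
  qed
  show "nacc s k' < nacc s (Suc k')"
    using Greatest_le_nat[of ?P, OF P1 bd] eq by linarith
  then have "\<not> ?P (Suc (nacc s (Suc k')))"
    using Greatest_le_nat[of ?P "Suc (nacc s (Suc k'))" B] bd unfolding eq by fastforce
  then have "card (step_name s ` {nacc s k' <.. Suc (nacc s (Suc k'))}) \<ge> CARD('a)"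
    using \<open>nacc s k' < nacc s (Suc k')\<close> by linarith
  then show "step_name s ` {nacc s k' <.. Suc (nacc s (Suc k'))} = UNIV"
    by (intro card_seteq) auto
qed

lemma strict_mono_nacc:
  assumes "keane_iem s"
  shows "strict_mono (nacc s)"
  using nacc_Suc_bounds(1)[OF assms] by (intro strict_monoI_Suc)

text \<open>A block and one further step show all names, and that step belongs to the next block,
  which is nonempty.\<close>

lemma all_win_in_two_blocks:
  assumes k: "keane_iem s"
  shows "\<exists>n. nacc s j \<le> n \<and> n < nacc s (j + 2) \<and> winner (rv_state s n) = c"
proof -
  have "c \<in> step_name s ` {nacc s j <.. Suc (nacc s (Suc j))}"
    using nacc_Suc_bounds(2)[OF k, of j] by blast
  then obtain n where n: "n \<in> {nacc s j <.. Suc (nacc s (Suc j))}" "step_name s n = c" by blast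
  then obtain n' where "n = Suc n'" by (cases n) auto
  then show ?thesis
    using n nacc_Suc_bounds(1)[OF k, of "Suc j"] by (intro exI[of _ n']) (auto simp: step_name_Suc simp del: nacc.simps)
qed

section \<open>Products of the step matrices\<close>

lemma mprod_append: "mprod f (xs @ ys) = mprod f xs ** mprod f ys"
proof (induction ys rule: rev_induct)
  case (snoc y ys)
  have "mprod f (xs @ ys @ [y]) = mprod f (xs @ ys) ** f y"
    by (simp add: mprod_def)
  then show ?case using snoc by (simp add: mprod_def matrix_mul_assoc)
qed (simp add: mprod_def)

text \<open>Common form of \<open>Zmat\<close> and \<open>Qmat\<close> that can also be cut at steps
  inside a block.\<close>

definition rv_prod :: "'a::finite iemdata \<Rightarrow> nat \<Rightarrow> nat \<Rightarrow> real^'a^'a" where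
  "rv_prod s m n = mprod (Vmat s) [m + 1 ..< n + 1]"

lemma rv_prod_refl [simp]: "rv_prod s m m = mat 1"
  by (simp add: rv_prod_def mprod_def)

lemma rv_prod_trans:
  assumes "m \<le> n" "n \<le> r"
  shows "rv_prod s m r = rv_prod s m n ** rv_prod s n r"
proof -
  have "[m + 1 ..< r + 1] = [m + 1 ..< n + 1] @ [n + 1 ..< r + 1]"
    using assms upt_add_eq_append[of "m + 1" "n + 1" "r - n"] by simp
  then show ?thesis unfolding rv_prod_def by (simp only: mprod_append)
qed

lemma rv_prod_Suc:
  assumes "m \<le> n"
  shows "rv_prod s m (Suc n) = rv_prod s m n ** Vmat s (Suc n)"
  using rv_prod_trans[OF assms, of "Suc n" s] by (simp add: rv_prod_def[of s n] mprod_def)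

lemma Zmat_eq: "Zmat s (Suc k) = rv_prod s (nacc s k) (nacc s (Suc k))"
  by (simp add: Zmat_def rv_prod_def)

lemma Qmat_eq:
  assumes k: "keane_iem s" and "i \<le> j"
  shows "Qmat s i j = rv_prod s (nacc s i) (nacc s j)"
  using assms(2)
proof (induction j rule: dec_induct)
  case base
  show ?case by (simp add: Qmat_def mprod_def)
next
  case (step j)
  have m: "nacc s i \<le> nacc s j" "nacc s j \<le> nacc s (Suc j)"
    using strict_mono_nacc[OF k] step(1) by (auto simp: strict_mono_less_eq simp del: nacc.simps)
  have "[i + 1 ..< Suc j + 1] = [i + 1 ..< j + 1] @ [Suc j]" using step(1) by simp
  then have "Qmat s i (Suc j) = Qmat s i j ** Zmat s (Suc j)"
    unfolding Qmat_def by (simp only: mprod_append) (simp add: mprod_def)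
  then show ?case using step rv_prod_trans[OF m, of s] by (simp only: Zmat_eq)
qed

lemma Vmat_Suc_nth:
  "Vmat s (Suc n) $ i $ j = (if i = j then 1 else 0) +
     (if i = winner (rv_state s n) \<and> j = loser (rv_state s n) then 1 else 0)"
  by (simp add: Vmat_def mat_def)

text \<open>Right multiplication by a step matrix adds the winner's column to the loser's.
  Monotonicity, positivity and growth of the products all come from this recursion.\<close>

lemma rv_prod_Suc_nth:
  assumes "m \<le> n"
  shows "rv_prod s m (Suc n) $ i $ j = rv_prod s m n $ i $ j +
     (if j = loser (rv_state s n) then rv_prod s m n $ i $ winner (rv_state s n) else 0)"
proof -
  have "rv_prod s m (Suc n) $ i $ j = (\<Sum>k\<in>UNIV. rv_prod s m n $ i $ k * Vmat s (Suc n) $ k $ j)"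
    by (simp add: rv_prod_Suc[OF assms] matrix_matrix_mult_def)
  also have "\<dots> = (\<Sum>k\<in>UNIV. (if k = j then rv_prod s m n $ i $ k else 0) +
     (if k = winner (rv_state s n) then (if j = loser (rv_state s n) then rv_prod s m n $ i $ k else 0) else 0))"
    by (intro sum.cong) (auto simp: Vmat_Suc_nth algebra_simps)
  also have "\<dots> = rv_prod s m n $ i $ j +
     (if j = loser (rv_state s n) then rv_prod s m n $ i $ winner (rv_state s n) else 0)"
    by (simp add: sum.distrib)
  finally show ?thesis .
qed

lemma rv_prod_nonneg_diag:
  assumes "m \<le> n"
  shows "0 \<le> rv_prod s m n $ i $ j \<and> 1 \<le> rv_prod s m n $ i $ i"
  using assms
proof (induction n arbitrary: j rule: dec_induct)
  case base
  show ?case by (simp add: mat_def)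
next
  case (step n)
  have "0 \<le> rv_prod s m n $ i $ k" "1 \<le> rv_prod s m n $ i $ i" for k
    using step(3) by blast+
  from this(1)[of j] this(1)[of "winner (rv_state s n)"] this(2)
  show ?case by (auto simp: rv_prod_Suc_nth[OF step(1)])
qed

lemma rv_prod_nonneg: "m \<le> n \<Longrightarrow> 0 \<le> rv_prod s m n $ i $ j"
  using rv_prod_nonneg_diag by blast

lemma rv_prod_diag: "m \<le> n \<Longrightarrow> 1 \<le> rv_prod s m n $ i $ i"
  using rv_prod_nonneg_diag by blast

lemma rv_prod_mono:
  assumes "m \<le> n" "n \<le> r"
  shows "rv_prod s m n $ i $ j \<le> rv_prod s m r $ i $ j"
  using assms(2)
proof (induction r rule: dec_induct)
  case (step r)
  have "m \<le> r" using assms step by simp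
  then show ?case using step rv_prod_nonneg[OF \<open>m \<le> r\<close>, of s i] by (simp add: rv_prod_Suc_nth add_increasing2)
qed simp

lemma rv_prod_lens:
  fixes s :: "'a::finite iemdata"
  assumes k: "keane_iem s" and "m \<le> n"
  shows "lens (rv_state s m) i = (\<Sum>j\<in>UNIV. rv_prod s m n $ i $ j * lens (rv_state s n) j)"
  using assms(2)
proof (induction n rule: dec_induct)
  case base
  have "(\<Sum>j\<in>UNIV. (mat 1 :: real^'a^'a) $ i $ j * lens (rv_state s m) j)
    = (\<Sum>j\<in>UNIV. if j = i then lens (rv_state s m) j else 0)"
    by (intro sum.cong) (auto simp: mat_def)
  then show ?case by simp
next
  case (step n)
  let ?P = "rv_prod s m n" and ?w = "winner (rv_state s n)" and ?u = "loser (rv_state s n)"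
  let ?l = "lens (rv_state s n)" and ?l' = "lens (rv_state s (Suc n))"
  note w = winner_loser[OF keane_iem_rv_state[OF k, of n]]
  have l': "?l' = ?l(?w := ?l ?w - ?l ?u)" by (simp add: rv_state_Suc w(3))
  have "(\<Sum>j\<in>UNIV. rv_prod s m (Suc n) $ i $ j * ?l' j)
      = (\<Sum>j\<in>UNIV. ?P $ i $ j * ?l j + (if j = ?w then - ?P $ i $ ?w * ?l ?u else 0)
          + (if j = ?u then ?P $ i $ ?w * ?l ?u else 0))"
    using w(1) by (intro sum.cong) (auto simp: rv_prod_Suc_nth[OF step(1)] l' algebra_simps)
  also have "\<dots> = (\<Sum>j\<in>UNIV. ?P $ i $ j * ?l j)"
    by (simp add: sum.distrib)
  finally show ?case using step by simp
qed

section \<open>Determinant and positivity of the products\<close>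

lemma det_Vmat:
  fixes s :: "'a::finite iemdata"
  assumes "keane_iem s"
  shows "det (Vmat s (Suc n)) = 1"
proof -
  note w = winner_loser(1)[OF keane_iem_rv_state[OF assms, of n]]
  let ?w = "winner (rv_state s n)" and ?u = "loser (rv_state s n)"
  have "Vmat s (Suc n) = (\<chi> k. if k = ?w then row ?w (mat 1 :: real^'a^'a) + 1 *s row ?u (mat 1) else row k (mat 1))"
    using w by (auto simp: vec_eq_iff Vmat_Suc_nth row_def mat_def)
  then have "det (Vmat s (Suc n)) = det (mat 1 :: real^'a^'a)"
    using det_row_operation[OF w, of "mat 1 :: real^'a^'a" 1] by simp
  then show ?thesis by simp
qed

lemma det_rv_prod:
  assumes "keane_iem s" "m \<le> n"
  shows "det (rv_prod s m n) = 1"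
  using assms(2)
  by (induction n rule: dec_induct) (auto simp: rv_prod_Suc det_mul det_Vmat[OF assms(1)])

text \<open>The winner keeps the last place in the row that does not change, so it takes part in the
  next step.\<close>

lemma winner_Suc:
  assumes k: "keane_iem s"
  shows "winner (rv_step s) = winner s \<or> loser (rv_step s) = winner s"
proof -
  note k' = keane_iem_rv_step[OF k]
  have "winner s \<in> {lastl (rowt (rv_step s)), lastl (rowb (rv_step s))}"
    using k
  proof (cases rule: rv_step_cases)
    case top
    then show ?thesis using lastl_eq_iff[OF keane_iemD(4)[OF k], of "winner s"] by simp
  next
    case bot
    then show ?thesis using lastl_eq_iff[OF keane_iemD(5)[OF k], of "winner s"] by simp
  qed
  then have "winner s \<in> {winner (rv_step s), loser (rv_step s)}"
    using winner_loser(4)[OF k'] by simp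
  then show ?thesis by auto
qed

text \<open>Suppose the support B of row i stays the same over four blocks. Then a winner in B
  always has its loser in B. A winner outside B takes part in the next step and cannot lose there to
  a letter of B, so all later winners are outside B too. But some letter outside B wins within the
  first two blocks, and i, which is in B, wins within the next two.\<close>

lemma rv_prod_positive_grows:
  fixes s :: "'a::finite iemdata" and i :: 'a
  assumes k: "keane_iem s" and m: "m \<le> nacc s j"
  defines "A \<equiv> \<lambda>n. {b. rv_prod s m n $ i $ b \<ge> 1}"
  assumes ne: "A (nacc s j) \<noteq> UNIV"
  shows "A (nacc s j) \<subset> A (nacc s (j + 4))"
proof (rule ccontr)
  assume no: "\<not> A (nacc s j) \<subset> A (nacc s (j + 4))"
  have mono: "A n \<subseteq> A r" if "m \<le> n" "n \<le> r" for n r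
    using rv_prod_mono[OF that, of s i] by (auto simp: A_def intro: order_trans)
  have nacc_mono: "nacc s p \<le> nacc s q" if "p \<le> q" for p q
    using strict_mono_nacc[OF k] that by (simp add: strict_mono_less_eq)
  define B where "B = A (nacc s j)"
  have AB: "A n = B" if "nacc s j \<le> n" "n \<le> nacc s (j + 4)" for n
    using mono[of "nacc s j" n] mono[of n "nacc s (j + 4)"] that m no unfolding B_def by auto
  have closed: "loser (rv_state s n) \<in> B" if "nacc s j \<le> n" "n < nacc s (j + 4)" "winner (rv_state s n) \<in> B" for n
  proof -
    have "winner (rv_state s n) \<in> A n" using AB[of n] that by simp
    then have "loser (rv_state s n) \<in> A (Suc n)"
      using m that rv_prod_nonneg[of m n s i "loser (rv_state s n)"]
      by (simp add: A_def rv_prod_Suc_nth add_increasing)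
    then show ?thesis using AB[of "Suc n"] that by simp
  qed
  have out: "winner (rv_state s n) \<notin> B"
    if "nacc s j \<le> n0" "winner (rv_state s n0) \<notin> B" "n0 \<le> n" "n < nacc s (j + 4)" for n n0
    using that(3,4)
  proof (induction n rule: dec_induct)
    case base
    show ?case using that by simp
  next
    case (step n)
    have "winner (rv_state s n) \<notin> B" using step by simp
    moreover have "winner (rv_state s (Suc n)) = winner (rv_state s n)
       \<or> loser (rv_state s (Suc n)) = winner (rv_state s n)"
      using winner_Suc[OF keane_iem_rv_state[OF k]] by (simp add: rv_state_Suc)
    ultimately show ?case using closed[of "Suc n"] step that(1) by auto
  qed
  obtain c where c: "c \<notin> B" using ne unfolding B_def by blast
  obtain n0 where n0: "nacc s j \<le> n0" "n0 < nacc s (j + 2)" "winner (rv_state s n0) = c"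
    using all_win_in_two_blocks[OF k] by blast
  obtain n1 where n1: "nacc s (j + 2) \<le> n1" "n1 < nacc s (j + 2 + 2)" "winner (rv_state s n1) = i"
    using all_win_in_two_blocks[OF k] by blast
  have "i \<in> B" unfolding B_def A_def using rv_prod_diag[OF m] by simp
  moreover have "j + 2 + 2 = j + 4" by simp
  ultimately show False using out[of n0 n1] n0 n1 c by (metis le_trans less_imp_le)
qed

text \<open>Four blocks add at least one letter to the support of a row until it is full, and there
  are \<open>CARD('a)\<close> letters.\<close>

lemma rv_prod_positive:
  fixes s :: "'a::finite iemdata"
  assumes k: "keane_iem s"
  shows "1 \<le> rv_prod s (nacc s j) (nacc s (j + 4 * CARD('a))) $ a $ b"
proof -
  define A where "A = (\<lambda>n. {b. rv_prod s (nacc s j) n $ a $ b \<ge> 1})"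
  have nm: "nacc s j \<le> nacc s (j + q)" for q
    using strict_mono_nacc[OF k] by (simp add: strict_mono_less_eq)
  have "A (nacc s (j + 4 * i)) = UNIV \<or> i \<le> card (A (nacc s (j + 4 * i)))" for i
  proof (induction i)
    case (Suc i)
    show ?case
    proof (cases "A (nacc s (j + 4 * i)) = UNIV")
      case True
      have "A (nacc s (j + 4 * i)) \<subseteq> A (nacc s (j + 4 * Suc i))"
        unfolding A_def
        using rv_prod_mono[OF nm[of "4 * i"], of "nacc s (j + 4 * Suc i)" s a] strict_mono_nacc[OF k]
        by (auto simp: strict_mono_less_eq intro: order_trans)
      then show ?thesis using True by auto
    next
      case False
      have "A (nacc s (j + 4 * i)) \<subset> A (nacc s (j + 4 * i + 4))"
        using rv_prod_positive_grows[OF k nm[of "4 * i"], of a] False unfolding A_def by blast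
      moreover have "j + 4 * i + 4 = j + 4 * Suc i" by simp
      ultimately have "card (A (nacc s (j + 4 * i))) < card (A (nacc s (j + 4 * Suc i)))"
        by (metis finite psubset_card_mono)
      then show ?thesis using Suc False by simp
    qed
  qed simp
  from this[of "CARD('a)"] have "A (nacc s (j + 4 * CARD('a))) = UNIV"
    by (metis card_seteq finite subset_UNIV)
  then show ?thesis unfolding A_def by blast
qed

section \<open>Special Birkhoff sums\<close>

primrec sbs :: "'a::finite iemdata \<Rightarrow> ('a \<Rightarrow> real \<Rightarrow> real) \<Rightarrow> nat \<Rightarrow> 'a \<Rightarrow> real \<Rightarrow> real" where
  "sbs s F 0 = F"
| "sbs s F (Suc n) = up (rv_state s n) (sbs s F n)"

lemma rv_prod_Suc_col:
  assumes "m \<le> n"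
  shows "(\<Sum>i\<in>UNIV. rv_prod s m (Suc n) $ i $ a * c i) = (\<Sum>i\<in>UNIV. rv_prod s m n $ i $ a * c i) +
    (if a = loser (rv_state s n) then (\<Sum>i\<in>UNIV. rv_prod s m n $ i $ winner (rv_state s n) * c i) else 0)"
  by (simp add: rv_prod_Suc_nth[OF assms] algebra_simps sum.distrib)

lemma up_arg:
  assumes k: "keane_iem s" and x: "0 \<le> x" "x < lens (rv_step s) a"
  shows "x < lens s a"
    and "a = loser s \<Longrightarrow> 0 \<le> x + (lens s (winner s) - lens s (loser s))"
    and "a = loser s \<Longrightarrow> x + (lens s (winner s) - lens s (loser s)) < lens s (winner s)"
proof -
  have "lens s (loser s) > 0" using keane_iemD(3)[OF k] by blast
  then show "x < lens s a"
    "a = loser s \<Longrightarrow> 0 \<le> x + (lens s (winner s) - lens s (loser s))"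
    "a = loser s \<Longrightarrow> x + (lens s (winner s) - lens s (loser s)) < lens s (winner s)"
    using x winner_loser(1-3)[OF k] by (auto split: if_splits)
qed

text \<open>Column a of the product counts the visits to the intervals of level m on the way from
  interval a of level n back to the range of level n. Each visit to i contributes \<open>c i\<close>
  up to an error \<open>b i\<close>.\<close>

lemma sbs_approx:
  fixes s :: "'a::finite iemdata"
  assumes k: "keane_iem s" and "m \<le> n"
    and F: "\<And>a x. 0 \<le> x \<Longrightarrow> x < lens (rv_state s m) a \<Longrightarrow> \<bar>sbs s F m a x - c a\<bar> \<le> b a"
    and x: "0 \<le> x" "x < lens (rv_state s n) a"
  shows "\<bar>sbs s F n a x - (\<Sum>i\<in>UNIV. rv_prod s m n $ i $ a * c i)\<bar> \<le> (\<Sum>i\<in>UNIV. rv_prod s m n $ i $ a * b i)"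
  using \<open>m \<le> n\<close> x
proof (induction n arbitrary: a x rule: dec_induct)
  case base
  have "(\<Sum>i\<in>UNIV. (mat 1 :: real^'a^'a) $ i $ a * g i) = g a" for g :: "'a \<Rightarrow> real"
  proof -
    have "(\<Sum>i\<in>UNIV. (mat 1 :: real^'a^'a) $ i $ a * g i) = (\<Sum>i\<in>UNIV. if i = a then g i else 0)"
      by (intro sum.cong) (auto simp: mat_def)
    then show ?thesis by simp
  qed
  then show ?case using F[OF base] by simp
next
  case (step n)
  note kn = keane_iem_rv_state[OF k, of n]
  note arg = up_arg[OF kn, of x a, folded rv_state_Suc, OF step.prems]
  note I = step.IH[OF step.prems(1) arg(1)]
  show ?case
  proof (cases "a = loser (rv_state s n)")
    case False
    then show ?thesis using I by (simp add: up_def rv_prod_Suc_col[OF step(1)])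
  next
    case True
    show ?thesis using I step.IH[OF arg(2,3)[OF True]] True
      by (simp add: up_def rv_prod_Suc_col[OF step(1)])
  qed
qed

lemma sbs_approx_mnorm:
  assumes k: "keane_iem s" and "m \<le> n"
    and F: "\<And>a x. 0 \<le> x \<Longrightarrow> x < lens (rv_state s m) a \<Longrightarrow> \<bar>sbs s F m a x - c a\<bar> \<le> B"
    and x: "0 \<le> x" "x < lens (rv_state s n) a"
  shows "\<bar>sbs s F n a x - (\<Sum>i\<in>UNIV. rv_prod s m n $ i $ a * c i)\<bar> \<le> mnorm (rv_prod s m n) * B"
proof -
  have "0 < lens (rv_state s m) a" using keane_iemD(3)[OF keane_iem_rv_state[OF k]] by blast
  then have B: "0 \<le> B" using F[of 0 a] by simp
  have "\<bar>sbs s F n a x - (\<Sum>i\<in>UNIV. rv_prod s m n $ i $ a * c i)\<bar> \<le> (\<Sum>i\<in>UNIV. rv_prod s m n $ i $ a * B)"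
    by (rule sbs_approx[OF k \<open>m \<le> n\<close> F x])
  also have "\<dots> = (\<Sum>i\<in>UNIV. rv_prod s m n $ i $ a) * B" by (simp add: sum_distrib_right)
  also have "\<dots> \<le> mnorm (rv_prod s m n) * B"
    unfolding mnorm_def
  proof (intro mult_right_mono sum_mono B)
    fix i
    show "rv_prod s m n $ i $ a \<le> (\<Sum>j\<in>UNIV. \<bar>rv_prod s m n $ i $ j\<bar>)"
      using member_le_sum[of a UNIV "\<lambda>j. \<bar>rv_prod s m n $ i $ j\<bar>"] by simp
  qed
  finally show ?thesis .
qed

text \<open>The majorant h replaces the variation function: it transforms by the same operation as F, and
  its total increment over disjoint pieces does not grow.\<close>
definition dominates :: "('a::finite \<Rightarrow> real) \<Rightarrow> ('a \<Rightarrow> real \<Rightarrow> real) \<Rightarrow> ('a \<Rightarrow> real \<Rightarrow> real) \<Rightarrow> real \<Rightarrow> bool" where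
  "dominates l h F M \<longleftrightarrow>
     (\<forall>a x y. 0 \<le> x \<and> x \<le> y \<and> y < l a \<longrightarrow> \<bar>F a y - F a x\<bar> \<le> h a y - h a x) \<and>
     (\<forall>X Y. (\<forall>a. 0 \<le> X a \<and> X a \<le> Y a \<and> Y a < l a) \<longrightarrow> (\<Sum>a\<in>UNIV. h a (Y a) - h a (X a)) \<le> M)"

lemma dominates_up:
  assumes k: "keane_iem s" and d: "dominates (lens s) h F M"
  shows "dominates (lens (rv_step s)) (up s h) (up s F) M"
proof -
  let ?l = "lens s" and ?l' = "lens (rv_step s)" and ?w = "winner s" and ?u = "loser s"
  define e where "e = ?l ?w - ?l ?u"
  note w = winner_loser[OF k]
  note arg = up_arg[OF k, folded e_def]
  have d1: "\<bar>F a y - F a x\<bar> \<le> h a y - h a x" if "0 \<le> x" "x \<le> y" "y < ?l a" for a x y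
    using d that unfolding dominates_def by blast
  show ?thesis
    unfolding dominates_def
  proof (intro conjI allI impI)
    fix a x y assume xy: "0 \<le> x \<and> x \<le> y \<and> y < ?l' a"
    then have y: "0 \<le> y" "y < ?l' a" and x: "x < ?l' a" by auto
    show "\<bar>up s F a y - up s F a x\<bar> \<le> up s h a y - up s h a x"
    proof (cases "a = ?u")
      case True
      then show ?thesis
        using d1[of x y a] d1[of "x + e" "y + e" ?w] xy arg(1)[OF y] arg(2)[of x a] arg(3)[OF y] x
        by (simp add: up_def e_def)
    next
      case False
      then show ?thesis using d1[of x y a] xy arg(1)[OF y] by (simp add: up_def)
    qed
  next
    fix X Y assume XY: "\<forall>a. 0 \<le> X a \<and> X a \<le> Y a \<and> Y a < ?l' a"
    \<comment> \<open>In the winner's interval the piece from \<open>X ?w\<close> to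
      \<open>Y ?w\<close> lies before the one from \<open>X ?u + e\<close> to
      \<open>Y ?u + e\<close>, because \<open>Y ?w < e\<close>. Filling the gap can only increase
      the sum, as h is increasing, and leaves one piece per letter.\<close>
    define Y' where "Y' = Y(?w := Y ?u + e)"
    have e: "Y ?w < e" "0 \<le> Y ?w" "X ?w \<le> Y ?w" "0 \<le> X ?w" "0 \<le> X ?u" "X ?u \<le> Y ?u" "Y ?u < ?l ?u"
      using XY[rule_format, of ?w] XY[rule_format, of ?u] w by (auto simp: e_def)
    have ew: "e + ?l ?u = ?l ?w" by (simp add: e_def)
    have hw: "h ?w (Y ?w) \<le> h ?w (X ?u + e)" using d1[of "Y ?w" "X ?u + e" ?w] e ew by auto
    have "(\<Sum>a\<in>UNIV. up s h a (Y a) - up s h a (X a))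
        = (\<Sum>a\<in>UNIV. (h a (Y a) - h a (X a)) + (if a = ?u then h ?w (Y a + e) - h ?w (X a + e) else 0))"
      by (intro sum.cong) (auto simp: up_def e_def)
    also have "\<dots> = (\<Sum>a\<in>UNIV. h a (Y a) - h a (X a)) + (h ?w (Y ?u + e) - h ?w (X ?u + e))"
      by (simp add: sum.distrib)
    also have "\<dots> \<le> (\<Sum>a\<in>UNIV. h a (Y a) - h a (X a)) + (h ?w (Y ?u + e) - h ?w (Y ?w))"
      using hw by simp
    also have "\<dots> = (\<Sum>a\<in>UNIV. (h a (Y a) - h a (X a)) + (if a = ?w then h ?w (Y ?u + e) - h ?w (Y ?w) else 0))"
      by (simp add: sum.distrib)
    also have "\<dots> = (\<Sum>a\<in>UNIV. h a (Y' a) - h a (X a))"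
      by (intro sum.cong) (auto simp: Y'_def)
    also have "\<dots> \<le> M"
    proof -
      have "0 \<le> X a \<and> X a \<le> Y' a \<and> Y' a < ?l a" for a
        using XY[rule_format, of a] arg(1)[of "Y a" a] e ew by (cases "a = ?w") (auto simp: Y'_def)
      then show ?thesis using d unfolding dominates_def by blast
    qed
    finally show "(\<Sum>a\<in>UNIV. up s h a (Y a) - up s h a (X a)) \<le> M" .
  qed
qed

lemma dominates_sbs:
  assumes k: "keane_iem s" and d: "dominates (lens s) h F M"
  shows "dominates (lens (rv_state s n)) (sbs s h n) (sbs s F n) M"
  by (induction n) (auto simp: d rv_state_Suc intro: dominates_up keane_iem_rv_state[OF k])

lemma dominates_osc:
  fixes F :: "'a::finite \<Rightarrow> real \<Rightarrow> real"
  assumes d: "dominates l h F M" and pos: "\<forall>a. l a > 0"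
    and "0 \<le> x" "x < l a" "0 \<le> y" "y < l a"
  shows "\<bar>F a y - F a x\<bar> \<le> M"
proof -
  have main: "\<bar>F a y - F a x\<bar> \<le> M" if "0 \<le> x" "x \<le> y" "y < l a" for x y
  proof -
    define X where "X = (\<lambda>b. if b = a then x else 0)"
    define Y where "Y = (\<lambda>b. if b = a then y else 0)"
    have "\<forall>b. 0 \<le> X b \<and> X b \<le> Y b \<and> Y b < l b" using that pos by (auto simp: X_def Y_def)
    then have "(\<Sum>b\<in>UNIV. h b (Y b) - h b (X b)) \<le> M" using d unfolding dominates_def by blast
    also have "(\<Sum>b\<in>UNIV. h b (Y b) - h b (X b)) = (\<Sum>b\<in>UNIV. if b = a then h a y - h a x else 0)"
      by (intro sum.cong) (auto simp: X_def Y_def)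
    also have "\<dots> = h a y - h a x" by simp
    finally show ?thesis using d that unfolding dominates_def by (meson order_trans)
  qed
  show ?thesis using main[of x y] main[of y x] assms by (cases "x \<le> y") auto
qed

section \<open>Primitives and integrals under the induction\<close>

definition primitive_on :: "('a::finite \<Rightarrow> real) \<Rightarrow> ('a \<Rightarrow> real \<Rightarrow> real) \<Rightarrow> ('a \<Rightarrow> real \<Rightarrow> real) \<Rightarrow> bool" where
  "primitive_on l F G \<longleftrightarrow>
     (\<forall>a x y. 0 \<le> x \<and> x \<le> y \<and> y < l a \<longrightarrow> (G a has_integral F a y - F a x) {x..y})"

lemma primitive_on_up:
  assumes k: "keane_iem s" and d: "primitive_on (lens s) F G"
  shows "primitive_on (lens (rv_step s)) (up s F) (up s G)"
  unfolding primitive_on_def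
proof (intro allI impI)
  fix a x y
  assume xy: "0 \<le> x \<and> x \<le> y \<and> y < lens (rv_step s) a"
  then have y: "0 \<le> y" "y < lens (rv_step s) a" and x: "x < lens (rv_step s) a" by auto
  define e where "e = lens s (winner s) - lens s (loser s)"
  note arg = up_arg[OF k, folded e_def]
  have 1: "(G a has_integral F a y - F a x) {x..y}"
    using d xy arg(1)[OF y] unfolding primitive_on_def by blast
  show "(up s G a has_integral up s F a y - up s F a x) {x..y}"
  proof (cases "a = loser s")
    case True
    have "(G (winner s) has_integral F (winner s) (y + e) - F (winner s) (x + e)) {x + e..y + e}"
      using d xy x arg(2)[of x a] arg(3)[OF y] True unfolding primitive_on_def by auto
    from has_integral_shift_real_ivl[OF this, of e]
    have "((\<lambda>t. G (winner s) (t + e)) has_integral F (winner s) (y + e) - F (winner s) (x + e)) {x..y}"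
      by simp
    from has_integral_add[OF 1 this]
    have "((\<lambda>t. G a t + G (winner s) (t + e)) has_integral
        (F a y + F (winner s) (y + e)) - (F a x + F (winner s) (x + e))) {x..y}"
      by (simp add: algebra_simps)
    moreover have "up s H a = (\<lambda>t. H a t + H (winner s) (t + e))" for H
      using True by (simp add: up_def e_def fun_eq_iff)
    ultimately show ?thesis by (simp only:)
  qed (use 1 in \<open>simp add: up_def\<close>)
qed

lemma primitive_on_sbs:
  assumes k: "keane_iem s" and d: "primitive_on (lens s) F G"
  shows "primitive_on (lens (rv_state s n)) (sbs s F n) (sbs s G n)"
  by (induction n) (auto simp: d rv_state_Suc intro: primitive_on_up keane_iem_rv_state[OF k])

text \<open>The right part cut off from the winner's interval, shifted to start at 0, reappears as
  the second summand over the loser's interval, so nothing is gained or lost.\<close>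

lemma integral_up:
  assumes k: "keane_iem s" and G: "\<And>a. G a integrable_on {0..lens s a}"
  shows "up s G a integrable_on {0..lens (rv_step s) a}"
    and "(\<Sum>a\<in>UNIV. integral {0..lens (rv_step s) a} (up s G a)) = (\<Sum>a\<in>UNIV. integral {0..lens s a} (G a))"
proof -
  let ?l = "lens s" and ?l' = "lens (rv_step s)" and ?w = "winner s" and ?u = "loser s"
  define e where "e = ?l ?w - ?l ?u"
  note w = winner_loser[OF k]
  have pos: "?l ?u > 0" using keane_iemD(3)[OF k] by blast
  have e: "0 \<le> e" "e \<le> ?l ?w" using w pos by (auto simp: e_def)
  have int1: "G ?w integrable_on {0..e}" and int2: "G ?w integrable_on {e..?l ?w}"
    using integrable_subinterval_real[OF G[of ?w]] e by auto
  have sh: "(\<lambda>t. G ?w (t + e)) integrable_on {0..?l ?u}"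
    using integrable_shift_real_ivl[OF int2, of e] by (simp add: e_def)
  have shi: "integral {0..?l ?u} (\<lambda>t. G ?w (t + e)) = integral {e..?l ?w} (G ?w)"
    using integral_shift_real_ivl[of e e "?l ?w" "G ?w"] by (simp add: e_def)
  have upu: "up s G ?u = (\<lambda>t. G ?u t + G ?w (t + e))" by (simp add: up_def e_def fun_eq_iff)
  have upa: "up s G a = G a" if "a \<noteq> ?u" for a using that by (simp add: up_def fun_eq_iff)
  have l': "?l' ?w = e" "a \<noteq> ?w \<Longrightarrow> ?l' a = ?l a" for a by (auto simp: w(3) e_def)
  show "up s G a integrable_on {0..?l' a}"
    using G[of a] int1 integrable_add[OF G[of ?u] sh] w(1)
    by (cases "a = ?u"; cases "a = ?w") (auto simp: upu upa l')
  have "(\<Sum>a\<in>UNIV. integral {0..?l' a} (up s G a))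
     = (\<Sum>a\<in>UNIV. integral {0..?l a} (G a) + (if a = ?u then integral {e..?l ?w} (G ?w) else 0)
          + (if a = ?w then - integral {e..?l ?w} (G ?w) else 0))"
  proof (intro sum.cong refl)
    fix a
    consider "a = ?u" | "a = ?w" | "a \<noteq> ?u" "a \<noteq> ?w" by blast
    then show "integral {0..?l' a} (up s G a) = integral {0..?l a} (G a)
       + (if a = ?u then integral {e..?l ?w} (G ?w) else 0)
       + (if a = ?w then - integral {e..?l ?w} (G ?w) else 0)"
    proof cases
      case 1
      then show ?thesis using w(1) integral_add[OF G[of ?u] sh] by (simp add: upu l' shi)
    next
      case 2
      have "integral {0..e} (G ?w) + integral {e..?l ?w} (G ?w) = integral {0..?l ?w} (G ?w)"
        by (rule Henstock_Kurzweil_Integration.integral_combine[OF e G])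
      then show ?thesis using 2 w(1) by (simp add: upa l')
    next
      case 3
      then show ?thesis by (simp add: upa l')
    qed
  qed
  also have "\<dots> = (\<Sum>a\<in>UNIV. integral {0..?l a} (G a))" by (simp add: sum.distrib)
  finally show "(\<Sum>a\<in>UNIV. integral {0..?l' a} (up s G a)) = (\<Sum>a\<in>UNIV. integral {0..?l a} (G a))" .
qed

lemma integral_sbs:
  assumes k: "keane_iem s" and G: "\<And>a. G a integrable_on {0..lens s a}"
  shows "(\<forall>a. sbs s G n a integrable_on {0..lens (rv_state s n) a}) \<and>
    (\<Sum>a\<in>UNIV. integral {0..lens (rv_state s n) a} (sbs s G n a)) = (\<Sum>a\<in>UNIV. integral {0..lens s a} (G a))"
proof (induction n)
  case (Suc n)
  then show ?case
    using integral_up[OF keane_iem_rv_state[OF k, of n], of "sbs s G n"] by (simp add: rv_state_Suc)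
qed (simp add: G)

section \<open>Splitting of Birkhoff sums along the induction\<close>

definition birk :: "(real \<Rightarrow> real) \<Rightarrow> (real \<Rightarrow> real) \<Rightarrow> real \<Rightarrow> nat \<Rightarrow> real" where
  "birk T f x N = (\<Sum>i<N. f ((T ^^ i) x))"

lemma birk_0 [simp]: "birk T f x 0 = 0"
  by (simp add: birk_def)

lemma birk_Suc: "birk T f x (Suc N) = f x + birk T f (T x) N"
  unfolding birk_def by (subst sum.lessThan_Suc_shift) (simp add: funpow_Suc_right del: funpow.simps)

text \<open>Old steps are grouped into first returns of one or two steps each. At most one step is
  left over, and e tells whether there is one. As \<open>N'\<close>, y and e are chosen before F,
  the same splitting applies to all functions.\<close>

lemma rv_step_birk_inside:
  assumes k: "keane_iem s" and x: "x \<in> range_of (rv_step s)"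
  shows "\<exists>N'\<le>N. \<exists>y\<in>range_of s. \<exists>e\<in>{0,1}. \<forall>F. birk (T_of s) (glue_of s F) x N
     = birk (T_of (rv_step s)) (glue_of (rv_step s) (up s F)) x N' + e * glue_of s F y"
  using x
proof (induction N arbitrary: x rule: less_induct)
  case (less N)
  let ?s = "rv_step s"
  have xs: "x \<in> range_of s" using less.prems rv_step_range_subset[OF k] by blast
  have Tx: "T_of ?s x \<in> range_of ?s"
    using iem_in_range[OF rv_step_orders(1)[OF k] rv_step_lens_pos[OF k] less.prems] .
  consider "N = 0" | M where "N = Suc M" "T_of ?s x = T_of s x"
      "\<And>F. glue_of ?s (up s F) x = glue_of s F x"
    | "N = 1" | M where "N = Suc (Suc M)" "T_of ?s x = T_of s (T_of s x)"
      "\<And>F. glue_of ?s (up s F) x = glue_of s F x + glue_of s F (T_of s x)"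
  proof -
    have "N = 0 \<or> N = 1 \<or> (\<exists>M. N = Suc (Suc M))" by presburger
    then show ?thesis
      using rv_step_first_return[OF k less.prems] that by (metis One_nat_def)
  qed
  then show ?case
  proof cases
    case 1
    show ?thesis using xs by (intro exI[of _ 0] conjI bexI[of _ x] bexI[of _ 0]) (auto simp: 1)
  next
    case (2 M)
    have "M < N" using 2 by simp
    from less.IH[OF this Tx] obtain N' y e where IH: "N' \<le> M" "y \<in> range_of s" "e \<in> {0,1}"
      "\<And>F. birk (T_of s) (glue_of s F) (T_of ?s x) M
        = birk (T_of ?s) (glue_of ?s (up s F)) (T_of ?s x) N' + e * glue_of s F y"
      by blast
    have "birk (T_of s) (glue_of s F) x N
        = birk (T_of ?s) (glue_of ?s (up s F)) x (Suc N') + e * glue_of s F y" for F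
      using IH(4)[of F] 2 by (simp add: birk_Suc)
    moreover have "Suc N' \<le> N" using IH(1) 2(1) by simp
    ultimately show ?thesis using IH(2,3) by blast
  next
    case 3
    show ?thesis using xs by (intro exI[of _ 0] conjI bexI[of _ x] bexI[of _ 1]) (auto simp: 3 birk_Suc)
  next
    case (4 M)
    have "M < N" using 4 by simp
    from less.IH[OF this Tx] obtain N' y e where IH: "N' \<le> M" "y \<in> range_of s" "e \<in> {0,1}"
      "\<And>F. birk (T_of s) (glue_of s F) (T_of ?s x) M
        = birk (T_of ?s) (glue_of ?s (up s F)) (T_of ?s x) N' + e * glue_of s F y"
      by blast
    have "birk (T_of s) (glue_of s F) x N
        = birk (T_of ?s) (glue_of ?s (up s F)) x (Suc N') + e * glue_of s F y" for F
      using IH(4)[of F] 4 by (simp add: birk_Suc)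
    moreover have "Suc N' \<le> N" using IH(1) 4(1) by simp
    ultimately show ?thesis using IH(2,3) by blast
  qed
qed

text \<open>An orbit that starts in the cut-off part enters the smaller range after one step; this
  is the term with \<open>e'\<close>.\<close>

lemma rv_step_birk:
  assumes k: "keane_iem s" and x: "x \<in> range_of s"
  shows "\<exists>x'\<in>range_of (rv_step s). \<exists>N'. \<exists>y\<in>range_of s. \<exists>z\<in>range_of s. \<exists>e\<in>{0,1}. \<exists>e'\<in>{0,1}.
     \<forall>F. birk (T_of s) (glue_of s F) x N
     = e' * glue_of s F z + birk (T_of (rv_step s)) (glue_of (rv_step s) (up s F)) x' N' + e * glue_of s F y"
proof (cases "x \<in> range_of (rv_step s)")
  case True
  from rv_step_birk_inside[OF k True, of N] obtain N' y e where
    b: "y \<in> range_of s" "e \<in> {0,1}" "\<And>F. birk (T_of s) (glue_of s F) x N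
      = birk (T_of (rv_step s)) (glue_of (rv_step s) (up s F)) x N' + e * glue_of s F y"
    by blast
  have "birk (T_of s) (glue_of s F) x N = 0 * glue_of s F x
      + birk (T_of (rv_step s)) (glue_of (rv_step s) (up s F)) x N' + e * glue_of s F y" for F
    using b(3)[of F] by simp
  then show ?thesis using x True b(1,2) by blast
next
  case False
  note Tx = rv_step_return_outside[OF k x False]
  show ?thesis
  proof (cases N)
    case 0
    then have "birk (T_of s) (glue_of s F) x N = 0 * glue_of s F x
      + birk (T_of (rv_step s)) (glue_of (rv_step s) (up s F)) (T_of s x) 0 + 0 * glue_of s F x" for F
      by simp
    then show ?thesis using Tx x by blast
  next
    case (Suc M)
    obtain N' y e where b: "y \<in> range_of s" "e \<in> {0,1}" "\<And>F. birk (T_of s) (glue_of s F) (T_of s x) M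
      = birk (T_of (rv_step s)) (glue_of (rv_step s) (up s F)) (T_of s x) N' + e * glue_of s F y"
      using rv_step_birk_inside[OF k Tx, of M] by blast
    have "birk (T_of s) (glue_of s F) x N = 1 * glue_of s F x
      + birk (T_of (rv_step s)) (glue_of (rv_step s) (up s F)) (T_of s x) N' + e * glue_of s F y" for F
      using b(3)[of F] Suc by (simp add: birk_Suc)
    then show ?thesis using x Tx b(1,2) by blast
  qed
qed

lemma glue_bound:
  assumes k: "keane_iem s" and x: "x \<in> range_of s"
    and F: "\<And>a t. 0 \<le> t \<Longrightarrow> t < lens s a \<Longrightarrow> \<bar>F a t\<bar> \<le> B"
  shows "\<bar>glue_of s F x\<bar> \<le> B"
proof -
  obtain a t where "0 \<le> t" "t < lens s a" "x = ltop s a + t"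
    using exists_coord[OF keane_iemD(4)[OF k], of x "lens s"] x by (metis atLeastLessThan_iff)
  then show ?thesis using glue_of_coord[OF k] F by simp
qed

text \<open>Each level costs at most one term at either end of the orbit, hence
  \<open>2 * B j\<close>. The special sum of the constant 1 is the return time, so the first
  conjunct says that the \<open>N'\<close> returns fit into N old steps. It speaks of the same
  \<open>N'\<close> as the estimate for F, which makes it possible to force
  \<open>N' = 0\<close>.\<close>

lemma birk_descend:
  assumes k: "keane_iem s" and x: "x \<in> range_of s"
  shows "\<exists>x'\<in>range_of (rv_state s n). \<exists>N'.
     real N \<ge> birk (T_of (rv_state s n)) (glue_of (rv_state s n) (sbs s (\<lambda>_ _. 1) n)) x' N' \<and>
     (\<forall>F B. (\<forall>j<n. \<forall>a t. 0 \<le> t \<longrightarrow> t < lens (rv_state s j) a \<longrightarrow> \<bar>sbs s F j a t\<bar> \<le> B j) \<longrightarrow>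
       \<bar>birk (T_of s) (glue_of s F) x N - birk (T_of (rv_state s n)) (glue_of (rv_state s n) (sbs s F n)) x' N'\<bar>
         \<le> (\<Sum>j<n. 2 * B j))"
proof (induction n)
  case 0
  have "birk T (glue_of s (\<lambda>_ _. 1)) x N = N" for T
    by (simp add: birk_def glue_def)
  then show ?case using x by (intro bexI[of _ x] exI[of _ N]) auto
next
  case (Suc n)
  let ?s = "rv_state s n" and ?s' = "rv_state s (Suc n)"
  let ?one = "sbs s (\<lambda>_ _. 1)"
  note kn = keane_iem_rv_state[OF k, of n]
  obtain x1 N1 where x1: "x1 \<in> range_of ?s"
    and le: "real N \<ge> birk (T_of ?s) (glue_of ?s (?one n)) x1 N1"
    and bd: "\<And>F B. (\<And>j a t. j < n \<Longrightarrow> 0 \<le> t \<Longrightarrow> t < lens (rv_state s j) a \<Longrightarrow> \<bar>sbs s F j a t\<bar> \<le> B j) \<Longrightarrow>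
       \<bar>birk (T_of s) (glue_of s F) x N - birk (T_of ?s) (glue_of ?s (sbs s F n)) x1 N1\<bar>
         \<le> (\<Sum>j<n. 2 * B j)"
    using Suc.IH by blast
  obtain x' N' y z e e' where o: "x' \<in> range_of ?s'" "y \<in> range_of ?s" "z \<in> range_of ?s"
      "e \<in> {0,1}" "e' \<in> {0,1}"
    and eq: "\<And>F. birk (T_of ?s) (glue_of ?s F) x1 N1
     = e' * glue_of ?s F z + birk (T_of ?s') (glue_of ?s' (up ?s F)) x' N' + e * glue_of ?s F y"
    using rv_step_birk[OF kn x1, of N1, folded rv_state_Suc] by blast
  have one: "0 \<le> ?one n a t" for a t
    by (induction n arbitrary: a t) (auto simp: up_def)
  have "0 \<le> glue_of ?s (?one n) v" for v unfolding glue_def Let_def by (rule one)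
  then have "0 \<le> e' * glue_of ?s (?one n) z" "0 \<le> e * glue_of ?s (?one n) y"
    using o by auto
  then have "real N \<ge> birk (T_of ?s') (glue_of ?s' (?one (Suc n))) x' N'"
    using le eq[of "?one n"] by simp
  moreover have "\<bar>birk (T_of s) (glue_of s F) x N - birk (T_of ?s') (glue_of ?s' (sbs s F (Suc n))) x' N'\<bar>
         \<le> (\<Sum>j<Suc n. 2 * B j)"
    if B: "\<forall>j<Suc n. \<forall>a t. 0 \<le> t \<longrightarrow> t < lens (rv_state s j) a \<longrightarrow> \<bar>sbs s F j a t\<bar> \<le> B j" for F B
  proof -
    have "\<bar>glue_of ?s (sbs s F n) z\<bar> \<le> B n" "\<bar>glue_of ?s (sbs s F n) y\<bar> \<le> B n"
      using B by (auto intro!: glue_bound[OF kn] o)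
    then have "\<bar>e' * glue_of ?s (sbs s F n) z\<bar> \<le> B n" "\<bar>e * glue_of ?s (sbs s F n) y\<bar> \<le> B n"
      using o by auto
    then show ?thesis using bd[of F B] B eq[of "sbs s F n"] by simp
  qed
  ultimately show ?case using o by blast
qed

section \<open>Absolute continuity and bounded variation\<close>

text \<open>The straddle lemma: since t lies between u and v, the two one-sided errors add up to
  \<open>e * (v - u)\<close>.\<close>

lemma has_derivative_interval_error:
  fixes F :: "real \<Rightarrow> real"
  assumes "(F has_real_derivative g) (at t)" "e > 0"
  obtains d where "d > 0"
    "\<And>u v. u \<le> t \<Longrightarrow> t \<le> v \<Longrightarrow> u \<in> ball t d \<Longrightarrow> v \<in> ball t d \<Longrightarrow>
       \<bar>(v - u) * g - (F v - F u)\<bar> \<le> e * (v - u)"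
proof -
  obtain d where d: "d > 0" "\<And>s. \<bar>s - t\<bar> < d \<Longrightarrow> \<bar>F s - F t - g * (s - t)\<bar> \<le> e * \<bar>s - t\<bar>"
    using assms unfolding has_field_derivative_def has_derivative_at_alt
    by (auto simp: real_norm_def)
  show thesis
  proof (rule that[OF d(1)])
    fix u v assume h: "u \<le> t" "t \<le> v" "u \<in> ball t d" "v \<in> ball t d"
    have "\<bar>F u - F t - g * (u - t)\<bar> \<le> e * (t - u)" "\<bar>F v - F t - g * (v - t)\<bar> \<le> e * (v - t)"
      using d(2)[of u] d(2)[of v] h by (auto simp: dist_real_def)
    then show "\<bar>(v - u) * g - (F v - F u)\<bar> \<le> e * (v - u)"
      by (simp add: abs_le_iff algebra_simps)
  qed
qed

text \<open>In a tagged division an interval can carry two tags only if it is degenerate. For pieces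
  of positive length the tags can therefore be forgotten, and the lengths add up to the measure of a
  union.\<close>

lemma tagged_division_part_division:
  fixes p :: "(real \<times> real set) set"
  assumes p: "p tagged_division_of {a..b}" and q: "q \<subseteq> {(t, K) \<in> p. measure lborel K > 0}"
  shows "inj_on snd q" "snd ` q division_of \<Union>(snd ` q)"
proof -
  note td = tagged_division_ofD[OF p]
  have ne: "interior K \<noteq> {}" if "(t, K) \<in> q" for t K
  proof -
    have "(t, K) \<in> p" using q that by auto
    then obtain u v where K: "K = cbox u v" using td(4) by blast
    then have "u < v" using q that by (auto simp: content_real_eq_0 split: if_splits)
    then show ?thesis using K by (simp add: interior_cbox)
  qed
  show "inj_on snd q"
  proof (rule inj_onI)
    fix x y assume h: "x \<in> q" "y \<in> q" "snd x = snd y"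
    obtain t t' K where xy: "x = (t, K)" "y = (t', K)" using h(3) by (cases x; cases y) auto
    show "x = y"
    proof (rule ccontr)
      assume "x \<noteq> y"
      then have "interior K \<inter> interior K = {}" using td(5)[of t K t' K] h xy q by auto
      then show False using ne h xy by auto
    qed
  qed
  have "finite q" using finite_subset[OF q] finite_subset[OF _ td(1)] by (metis (no_types, lifting) case_prodD mem_Collect_eq subsetI case_prodE)
  then show "snd ` q division_of \<Union>(snd ` q)"
    unfolding division_of_def
  proof (intro conjI ballI impI)
    fix K assume "K \<in> snd ` q"
    then obtain t where t: "(t, K) \<in> q" by auto
    show "K \<noteq> {}" using ne[OF t] by auto
    show "\<exists>a b. K = cbox a b" using td(4) t q by blast
    fix K' assume K': "K' \<in> snd ` q" and "K \<noteq> K'"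
    from K' obtain t' where "(t', K') \<in> q" by auto
    then show "interior K \<inter> interior K' = {}" using td(5)[of t K t' K'] t q \<open>K \<noteq> K'\<close> by auto
  qed auto
qed

text \<open>A gauge that is a straddle at points of differentiability and confines the remaining tags to
  an open set of small measure, where absolute continuity applies.\<close>
lemma abs_continuous_on_has_integral:
  fixes F G :: "real \<Rightarrow> real"
  assumes ac: "abs_continuous_on S F" and S: "{x..y} \<subseteq> S" "x \<le> y"
    and der: "AE t in lborel. t \<in> S \<longrightarrow> (F has_real_derivative G t) (at t)"
    and bd: "\<And>t. t \<in> S \<Longrightarrow> \<bar>G t\<bar> \<le> B"
  shows "(G has_integral F y - F x) {x..y}"
  unfolding has_integral_real
proof (intro allI impI)
  fix e :: real assume e: "e > 0"
  obtain N where N: "N \<in> null_sets lborel" "{t. \<not> (t \<in> S \<longrightarrow> (F has_real_derivative G t) (at t))} \<subseteq> N"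
    using der by (auto elim!: AE_E simp: null_sets_def)
  have B0: "0 \<le> B" using bd[of x] S by force
  \<comment> \<open>The error is kept below three quarters of e: one each for the straddled
    intervals, for the increments of F over intervals tagged in N, and for the values of G at those
    tags.\<close>
  define e1 where "e1 = e / (4 * (y - x + 1))"
  have e1: "e1 > 0" "e1 * (y - x) \<le> e / 4" using e S by (auto simp: e1_def field_simps)
  obtain \<delta> where \<delta>: "\<delta> > 0" and acD: "\<And>D. finite D \<Longrightarrow> (\<forall>(a,b)\<in>D. a \<le> b \<and> {a..b} \<subseteq> S) \<Longrightarrow>
        (\<forall>p\<in>D. \<forall>q\<in>D. p \<noteq> q \<longrightarrow> {fst p<..<snd p} \<inter> {fst q<..<snd q} = {}) \<Longrightarrow>
        (\<Sum>(a,b)\<in>D. b - a) < \<delta> \<Longrightarrow> (\<Sum>(a,b)\<in>D. \<bar>F b - F a\<bar>) < e / 4"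
    using ac[unfolded abs_continuous_on_def, rule_format, of "e / 4"] e by (auto simp: split_beta)
  \<comment> \<open>Total length below \<open>\<delta>\<close> controls the increments of F by
    absolute continuity. The other bound controls the terms with G, of which only the bound B is
    known on the null set.\<close>
  define \<epsilon> where "\<epsilon> = min \<delta> (e / (4 * (B + 1)))"
  have \<epsilon>: "\<epsilon> > 0" "\<epsilon> \<le> \<delta>" "B * \<epsilon> \<le> e / 4"
  proof -
    show "\<epsilon> > 0" "\<epsilon> \<le> \<delta>" using \<delta> e B0 by (auto simp: \<epsilon>_def)
    have "B * \<epsilon> \<le> B * (e / (4 * (B + 1)))" using B0 by (intro mult_left_mono) (auto simp: \<epsilon>_def)
    also have "\<dots> \<le> e / 4" using B0 e by (simp add: field_simps)
    finally show "B * \<epsilon> \<le> e / 4" .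
  qed
  have Nb: "N \<in> sets borel" using N(1) by (auto simp: null_sets_def)
  obtain U where U: "open U" "N \<subseteq> U" "emeasure lborel (U - N) < ennreal \<epsilon>"
    using outer_regular_lborel[OF Nb \<epsilon>(1)] by blast
  have eU: "emeasure lborel U < ennreal \<epsilon>"
  proof -
    have "emeasure lborel U = emeasure lborel (U - N)"
      using emeasure_Diff_null_set[OF N(1), of U] U(1) by simp
    then show ?thesis using U(3) by simp
  qed
  have Ul: "U \<in> lmeasurable"
  proof -
    have "emeasure lborel U < \<infinity>" using less_trans[OF eU ennreal_less_top] by simp
    then show ?thesis using U(1) by (intro fmeasurableI) (auto simp: emeasure_completion)
  qed
  have mU: "measure lebesgue U < \<epsilon>"
  proof -
    have "measure lebesgue U = measure lborel U" using U(1) by (simp add: measure_completion)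
    also have "ennreal \<dots> = emeasure lborel U"
      using eU by (intro emeasure_eq_ennreal_measure[symmetric]) auto
    finally have "ennreal (measure lebesgue U) < ennreal \<epsilon>" using eU by simp
    then show ?thesis using \<epsilon>(1) by (simp add: ennreal_less_iff)
  qed
  have "\<exists>d>0. t \<in> S - N \<longrightarrow> (\<forall>u v. u \<le> t \<longrightarrow> t \<le> v \<longrightarrow> u \<in> ball t d \<longrightarrow> v \<in> ball t d \<longrightarrow>
       \<bar>(v - u) * G t - (F v - F u)\<bar> \<le> e1 * (v - u))" for t
  proof (cases "t \<in> S - N")
    case True
    then have "(F has_real_derivative G t) (at t)" using N(2) by blast
    from has_derivative_interval_error[OF this e1(1)] show ?thesis by metis
  qed (auto intro: exI[of _ 1])
  then obtain d where d: "\<And>t. d t > 0" "\<And>t u v. t \<in> S - N \<Longrightarrow> u \<le> t \<Longrightarrow> t \<le> v \<Longrightarrow> u \<in> ball t (d t) \<Longrightarrow>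
      v \<in> ball t (d t) \<Longrightarrow> \<bar>(v - u) * G t - (F v - F u)\<bar> \<le> e1 * (v - u)"
    by metis
  define \<gamma> where "\<gamma> t = (if t \<in> N then U else ball t (d t))" for t
  have "gauge \<gamma>" unfolding gauge_def \<gamma>_def using U d(1) by auto
  moreover have "norm ((\<Sum>(t, K)\<in>p. measure lborel K *\<^sub>R G t) - (F y - F x)) < e"
    if p: "p tagged_division_of {x..y}" and fine: "\<gamma> fine p" for p
  proof -
    note td = tagged_division_ofD[OF p]
    define err where "err = (\<lambda>(t, K). measure lborel K * G t - (F (Sup K) - F (Inf K)))"
    have sh: "\<exists>u v. K = {u..v} \<and> u \<le> t \<and> t \<le> v \<and> Inf K = u \<and> Sup K = v \<and> measure lborel K = v - u \<and> {u..v} \<subseteq> {x..y} \<and> t \<in> S"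
      if tK: "(t, K) \<in> p" for t K
    proof -
      obtain u v where K: "K = cbox u v" using td(4)[OF tK] by blast
      have "t \<in> K" "K \<subseteq> {x..y}" using td(2,3)[OF tK] by auto
      then show ?thesis using K S by (intro exI[of _ u] exI[of _ v]) auto
    qed
    \<comment> \<open>Degenerate intervals tagged in N contribute nothing and stay with the
      remaining ones, so that the pieces in q are determined by their intervals.\<close>
    define q where "q = {(t, K) \<in> p. t \<in> N \<and> measure lborel K > 0}"
    have qp: "q \<subseteq> p" "finite q" using td(1) by (auto simp: q_def intro: finite_subset[of _ p])
    note dq = tagged_division_part_division[OF p, of q]
    have dq: "inj_on snd q" "snd ` q division_of \<Union>(snd ` q)"
      by (rule dq, force simp: q_def)+
    have small: "(\<Sum>(t, K)\<in>q. measure lborel K) < \<epsilon>"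
    proof -
      have "(\<Sum>(t, K)\<in>q. measure lborel K) = (\<Sum>K\<in>snd ` q. measure lebesgue K)"
        unfolding sum.reindex[OF dq(1)]
      proof (intro sum.cong refl)
        fix z assume "z \<in> q"
        then obtain u v where "snd z = {u..v}" using sh[of "fst z" "snd z"] qp by auto
        then show "(case z of (t, K) \<Rightarrow> measure lborel K) = (measure lebesgue \<circ> snd) z"
          by (simp add: split_beta measure_completion)
      qed
      also have "\<dots> = measure lebesgue (\<Union>(snd ` q))" by (rule content_division[OF dq(2)])
      also have "\<dots> \<le> measure lebesgue U"
      proof (rule measure_mono_fmeasurable)
        show "\<Union>(snd ` q) \<subseteq> U"
        proof (intro UN_least)
          fix z assume "z \<in> q"
          then have "z \<in> p" "fst z \<in> N" by (auto simp: q_def)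
          then have "snd z \<subseteq> \<gamma> (fst z)" using fineD[OF fine, of "fst z" "snd z"] by simp
          then show "snd z \<subseteq> U" using \<open>fst z \<in> N\<close> by (simp add: \<gamma>_def)
        qed
        show "\<Union>(snd ` q) \<in> sets lebesgue" using lmeasurable_division[OF dq(2)] by (rule fmeasurableD)
      qed (rule Ul)
      finally show ?thesis using mU by simp
    qed
    have "(\<Sum>(t, K)\<in>q. \<bar>F (Sup K) - F (Inf K)\<bar>) < e / 4"
    proof -
      define D where "D = (\<lambda>z. (Inf (snd z), Sup (snd z))) ` q"
      have inj: "inj_on (\<lambda>z. (Inf (snd z), Sup (snd z))) q"
      proof (rule inj_onI)
        fix z z' assume h: "z \<in> q" "z' \<in> q" "(Inf (snd z), Sup (snd z)) = (Inf (snd z'), Sup (snd z'))"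
        then have "snd z = snd z'"
          using sh[of "fst z" "snd z"] sh[of "fst z'" "snd z'"] qp by auto
        then show "z = z'" using dq(1) h by (auto dest: inj_onD)
      qed
      have "(\<Sum>(a, b)\<in>D. \<bar>F b - F a\<bar>) < e / 4"
      proof (rule acD)
        show "finite D" using qp by (simp add: D_def)
        show "\<forall>(a,b)\<in>D. a \<le> b \<and> {a..b} \<subseteq> S"
        proof clarify
          fix a b assume "(a, b) \<in> D"
          then obtain z where z: "z \<in> q" "a = Inf (snd z)" "b = Sup (snd z)" by (auto simp: D_def)
          then have "(fst z, snd z) \<in> p" using qp by auto
          from sh[OF this] obtain u v where "snd z = {u..v}" "u \<le> fst z" "fst z \<le> v"
              "Inf (snd z) = u" "Sup (snd z) = v" "{u..v} \<subseteq> {x..y}"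
            by blast
          then show "a \<le> b \<and> {a..b} \<subseteq> S" using z S(1) by auto
        qed
        show "\<forall>r\<in>D. \<forall>r'\<in>D. r \<noteq> r' \<longrightarrow> {fst r<..<snd r} \<inter> {fst r'<..<snd r'} = {}"
        proof (intro ballI impI)
          fix r r' assume "r \<in> D" "r' \<in> D" "r \<noteq> r'"
          then obtain t K t' K' where h: "(t, K) \<in> q" "(t', K') \<in> q" "r = (Inf K, Sup K)" "r' = (Inf K', Sup K')" "K \<noteq> K'"
            unfolding D_def by force
          have "interior K \<inter> interior K' = {}" using td(5)[of t K t' K'] h qp by auto
          moreover obtain u v where "K = {u..v}" "Inf K = u" "Sup K = v" using sh h qp by blast
          moreover obtain u' v' where "K' = {u'..v'}" "Inf K' = u'" "Sup K' = v'" using sh h qp by blast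
          ultimately show "{fst r<..<snd r} \<inter> {fst r'<..<snd r'} = {}"
            using h by (simp add: interior_atLeastAtMost_real)
        qed
        have "(\<Sum>(a, b)\<in>D. b - a) = (\<Sum>z\<in>q. Sup (snd z) - Inf (snd z))"
          unfolding D_def sum.reindex[OF inj] by (simp add: o_def)
        also have "\<dots> = (\<Sum>(t, K)\<in>q. measure lborel K)"
        proof (intro sum.cong refl)
          fix z assume "z \<in> q"
          then show "Sup (snd z) - Inf (snd z) = (case z of (t, K) \<Rightarrow> measure lborel K)"
            using sh[of "fst z" "snd z"] qp by (auto simp: split_beta)
        qed
        finally show "(\<Sum>(a, b)\<in>D. b - a) < \<delta>" using small \<epsilon> by simp
      qed
      then show ?thesis
        unfolding D_def sum.reindex[OF inj] by (simp add: o_def split_beta)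
    qed
    moreover have "(\<Sum>(t, K)\<in>q. measure lborel K * \<bar>G t\<bar>) \<le> e / 4"
    proof -
      have "(\<Sum>(t, K)\<in>q. measure lborel K * \<bar>G t\<bar>) \<le> (\<Sum>(t, K)\<in>q. measure lborel K * B)"
      proof (rule sum_mono)
        fix z assume "z \<in> q"
        then have "fst z \<in> S" using sh[of "fst z" "snd z"] qp by auto
        then show "(case z of (t, K) \<Rightarrow> measure lborel K * \<bar>G t\<bar>) \<le> (case z of (t, K) \<Rightarrow> measure lborel K * B)"
          using bd by (auto simp: split_beta intro!: mult_left_mono)
      qed
      also have "\<dots> = B * (\<Sum>(t, K)\<in>q. measure lborel K)" by (simp add: sum_distrib_left split_beta mult.commute)
      also have "\<dots> \<le> B * \<epsilon>" using small B0 by (intro mult_left_mono) auto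
      finally show ?thesis using \<epsilon> by simp
    qed
    moreover have "(\<Sum>z\<in>q. \<bar>err z\<bar>) \<le> (\<Sum>(t, K)\<in>q. measure lborel K * \<bar>G t\<bar>) + (\<Sum>(t, K)\<in>q. \<bar>F (Sup K) - F (Inf K)\<bar>)"
      unfolding sum.distrib[symmetric]
    proof (rule sum_mono)
      fix z assume "z \<in> q"
      obtain t K where z: "z = (t, K)" by (cases z)
      have "\<bar>err z\<bar> \<le> \<bar>measure lborel K * G t\<bar> + \<bar>F (Sup K) - F (Inf K)\<bar>"
        by (simp add: z err_def)
      then show "\<bar>err z\<bar> \<le> (case z of (t, K) \<Rightarrow> measure lborel K * \<bar>G t\<bar>) + (case z of (t, K) \<Rightarrow> \<bar>F (Sup K) - F (Inf K)\<bar>)"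
        by (simp add: z abs_mult)
    qed
    ultimately have Q: "(\<Sum>z\<in>q. \<bar>err z\<bar>) < e / 2" by simp
    have R: "(\<Sum>z\<in>p - q. \<bar>err z\<bar>) \<le> e / 4"
    proof -
      have "(\<Sum>z\<in>p - q. \<bar>err z\<bar>) \<le> (\<Sum>z\<in>p - q. e1 * measure lborel (snd z))"
      proof (rule sum_mono)
        fix z assume z: "z \<in> p - q"
        obtain t K where zz: "z = (t, K)" by (cases z)
        obtain u v where K: "K = {u..v}" "u \<le> t" "t \<le> v" "Inf K = u" "Sup K = v" "measure lborel K = v - u" "t \<in> S"
          using sh[of t K] z zz by blast
        show "\<bar>err z\<bar> \<le> e1 * measure lborel (snd z)"
        proof (cases "t \<in> N")
          case True
          then have "measure lborel K = 0" "u = v" using z zz K by (auto simp: q_def)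
          then show ?thesis using K zz by (simp add: err_def)
        next
          case False
          then have "K \<subseteq> ball t (d t)" using fineD[OF fine, of t K] z zz by (simp add: \<gamma>_def)
          moreover have "u \<in> K" "v \<in> K" using K by auto
          ultimately have "\<bar>(v - u) * G t - (F v - F u)\<bar> \<le> e1 * (v - u)"
            using d(2)[of t u v] False K by blast
          then show ?thesis using K zz by (simp add: err_def)
        qed
      qed
      also have "\<dots> \<le> (\<Sum>z\<in>p. e1 * measure lborel (snd z))"
        using td(1) e1 by (intro sum_mono2) auto
      also have "\<dots> = e1 * (\<Sum>(t, K)\<in>p. measure lborel K)" by (simp add: sum_distrib_left split_beta)
      also have "(\<Sum>(t, K)\<in>p. measure lborel K) = y - x"
        using additive_content_tagged_division[of p x y] p S by (simp add: split_beta)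
      finally show ?thesis using e1(2) by simp
    qed
    have "(\<Sum>(t, K)\<in>p. measure lborel K *\<^sub>R G t) - (F y - F x) = (\<Sum>z\<in>p. err z)"
      unfolding err_def additive_tagged_division_1[OF S(2) p, of F, symmetric]
      by (simp add: sum_subtractf split_beta)
    also have "\<bar>\<dots>\<bar> \<le> (\<Sum>z\<in>p. \<bar>err z\<bar>)" by (rule sum_abs)
    also have "\<dots> = (\<Sum>z\<in>q. \<bar>err z\<bar>) + (\<Sum>z\<in>p - q. \<bar>err z\<bar>)"
      using qp td(1) by (metis add.commute sum.subset_diff)
    also have "\<dots> < e" using Q R e by simp
    finally show ?thesis by simp
  qed
  ultimately show "\<exists>\<gamma>. gauge \<gamma> \<and> (\<forall>p. p tagged_division_of {x..y} \<and> \<gamma> fine p \<longrightarrow>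
      norm ((\<Sum>(t, K)\<in>p. measure lborel K *\<^sub>R G t) - (F y - F x)) < e)"
    by (intro exI[of _ \<gamma>] conjI allI impI) simp_all
qed

text \<open>h is the variation of g up to x. Appending x and y to a list of points not beyond x adds
  the increment from x to y.\<close>

lemma bounded_variation_dominated:
  fixes g :: "real \<Rightarrow> real"
  assumes bv: "bounded_variation_on S g"
  obtains h M where "\<And>x y. x \<in> S \<Longrightarrow> y \<in> S \<Longrightarrow> x \<le> y \<Longrightarrow> \<bar>g y - g x\<bar> \<le> h y - h x"
    "\<And>x. x \<in> S \<Longrightarrow> 0 \<le> h x \<and> h x \<le> M"
proof -
  define var where "var xs = (\<Sum>i<length xs - 1. \<bar>g (xs ! Suc i) - g (xs ! i)\<bar>)" for xs
  obtain M where M: "\<And>xs. sorted xs \<Longrightarrow> set xs \<subseteq> S \<Longrightarrow> var xs \<le> M"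
    using bv unfolding bounded_variation_on_def var_def by blast
  define A where "A x = {var xs | xs. sorted xs \<and> set xs \<subseteq> S \<inter> {..x}}" for x
  define h where "h x = Sup (A x)" for x
  have ne: "0 \<in> A x" for x unfolding A_def var_def by (rule CollectI, rule exI[of _ "[]"]) simp
  have bdd: "bdd_above (A x)" for x unfolding A_def by (rule bdd_aboveI[of _ M]) (auto intro: M)
  have "0 \<le> h x \<and> h x \<le> M" for x
  proof
    show "0 \<le> h x" unfolding h_def by (rule cSup_upper[OF ne bdd])
    have "A x \<noteq> {}" using ne by blast
    then show "h x \<le> M" unfolding h_def by (rule cSup_least) (auto simp: A_def intro!: M)
  qed
  moreover have "\<bar>g y - g x\<bar> \<le> h y - h x" if "x \<in> S" "y \<in> S" "x \<le> y" for x y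
  proof -
    have "h x \<le> h y - \<bar>g y - g x\<bar>"
      unfolding h_def[of x]
    proof (rule cSup_least)
      show "A x \<noteq> {}" using ne by blast
      fix v assume "v \<in> A x"
      then obtain xs where xs: "v = var xs" "sorted xs" "set xs \<subseteq> S \<inter> {..x}" by (auto simp: A_def)
      have "var (xs @ [x, y]) \<in> A y"
        unfolding A_def using xs that by (intro CollectI exI[of _ "xs @ [x, y]"]) (auto simp: sorted_append)
      then have "var (xs @ [x, y]) \<le> h y" unfolding h_def by (rule cSup_upper[OF _ bdd])
      moreover have "var xs + \<bar>g y - g x\<bar> \<le> var (xs @ [x, y])"
      proof -
        have "var (xs @ [x, y]) = (\<Sum>i<length xs. \<bar>g ((xs @ [x, y]) ! Suc i) - g ((xs @ [x, y]) ! i)\<bar>) + \<bar>g y - g x\<bar>"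
          unfolding var_def by (simp add: nth_append)
        moreover have "var xs \<le> (\<Sum>i<length xs. \<bar>g ((xs @ [x, y]) ! Suc i) - g ((xs @ [x, y]) ! i)\<bar>)"
        proof -
          have "var xs = (\<Sum>i<length xs - 1. \<bar>g ((xs @ [x, y]) ! Suc i) - g ((xs @ [x, y]) ! i)\<bar>)"
            unfolding var_def by (intro sum.cong) (auto simp: nth_append)
          also have "\<dots> \<le> (\<Sum>i<length xs. \<bar>g ((xs @ [x, y]) ! Suc i) - g ((xs @ [x, y]) ! i)\<bar>)"
            by (intro sum_mono2) auto
          finally show ?thesis .
        qed
        ultimately show ?thesis by simp
      qed
      ultimately show "v \<le> h y - \<bar>g y - g x\<bar>" using xs by simp
    qed
    then show ?thesis by simp
  qed
  ultimately show thesis using that by blast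
qed

text \<open>g is the difference of the increasing functions \<open>g + h\<close> and h, hence Borel
  on the interval, and its distance to \<open>g a\<close> is at most M.\<close>

lemma bounded_variation_set_integrable:
  fixes g :: "real \<Rightarrow> real"
  assumes bv: "bounded_variation_on {a..<b} g"
  shows "set_integrable lborel {a..<b} g" "\<exists>B. \<forall>x\<in>{a..<b}. \<bar>g x\<bar> \<le> B"
proof -
  obtain h M where h: "\<And>x y. x \<in> {a..<b} \<Longrightarrow> y \<in> {a..<b} \<Longrightarrow> x \<le> y \<Longrightarrow> \<bar>g y - g x\<bar> \<le> h y - h x"
    "\<And>x. x \<in> {a..<b} \<Longrightarrow> 0 \<le> h x \<and> h x \<le> M"
    using bounded_variation_dominated[OF bv] by blast
  have "mono_on {a..<b} h" "mono_on {a..<b} (\<lambda>x. g x + h x)"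
    using h(1) by (auto intro!: mono_onI; force)+
  then have "h \<in> borel_measurable (restrict_space borel {a..<b})"
    "(\<lambda>x. g x + h x) \<in> borel_measurable (restrict_space borel {a..<b})"
    by (auto intro: borel_measurable_mono_on_fnc)
  then have "(\<lambda>x. (g x + h x) - h x) \<in> borel_measurable (restrict_space borel {a..<b})"
    by (rule borel_measurable_diff[rotated])
  then have m: "set_borel_measurable lborel {a..<b} g"
    unfolding set_borel_measurable_def
    by (subst (asm) borel_measurable_restrict_space_iff) (auto simp: mult.commute)
  have bd: "\<bar>g x\<bar> \<le> \<bar>g a\<bar> + M" if "x \<in> {a..<b}" for x
    using h(1)[of a x] h(2)[of a] h(2)[of x] that by auto
  then show "\<exists>B. \<forall>x\<in>{a..<b}. \<bar>g x\<bar> \<le> B" by blast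
  show "set_integrable lborel {a..<b} g"
  proof (rule set_integrable_bound)
    show "set_integrable lborel {a..<b} (\<lambda>_. \<bar>g a\<bar> + M)"
      using integrable_real_indicator[of "{a..<b}" lborel] emeasure_bounded_finite[of "{a..<b}"]
      unfolding set_integrable_def by simp
    show "set_borel_measurable lborel {a..<b} g" by (rule m)
    show "AE x in lborel. x \<in> {a..<b} \<longrightarrow> norm (g x) \<le> norm (\<bar>g a\<bar> + M)"
      using bd by (intro AE_I2) force
  qed
qed

section \<open>Growth of the cocycle\<close>

lemma mnorm_nonneg: "0 \<le> mnorm A"
  unfolding mnorm_def by (intro sum_nonneg) auto

lemma abs_nth_le_mnorm: "\<bar>A $ i $ j\<bar> \<le> mnorm A"
proof -
  have "\<bar>A $ i $ j\<bar> \<le> (\<Sum>j\<in>UNIV. \<bar>A $ i $ j\<bar>)"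
    using member_le_sum[of j UNIV "\<lambda>j. \<bar>A $ i $ j\<bar>"] by simp
  also have "\<dots> \<le> mnorm A"
    unfolding mnorm_def using member_le_sum[of i UNIV "\<lambda>i. \<Sum>j\<in>UNIV. \<bar>A $ i $ j\<bar>"] by (simp add: sum_nonneg)
  finally show ?thesis .
qed

lemma mnorm_mult_le:
  fixes A B :: "real^'n^'n"
  shows "mnorm (A ** B) \<le> mnorm A * mnorm B"
proof -
  have "mnorm (A ** B) \<le> (\<Sum>i\<in>UNIV. \<Sum>j\<in>UNIV. \<Sum>k\<in>UNIV. \<bar>A $ i $ k\<bar> * \<bar>B $ k $ j\<bar>)"
    unfolding mnorm_def matrix_matrix_mult_def
    by (intro sum_mono) (auto intro!: order_trans[OF sum_abs] simp: abs_mult)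
  also have "\<dots> = (\<Sum>i\<in>UNIV. \<Sum>k\<in>UNIV. \<bar>A $ i $ k\<bar> * (\<Sum>j\<in>UNIV. \<bar>B $ k $ j\<bar>))"
    by (subst sum.swap) (simp add: sum_distrib_left)
  also have "\<dots> \<le> (\<Sum>i\<in>UNIV. \<Sum>k\<in>UNIV. \<bar>A $ i $ k\<bar> * mnorm B)"
  proof (intro sum_mono mult_left_mono)
    fix k
    show "(\<Sum>j\<in>UNIV. \<bar>B $ k $ j\<bar>) \<le> mnorm B"
      unfolding mnorm_def using member_le_sum[of k UNIV "\<lambda>i. \<Sum>j\<in>UNIV. \<bar>B $ i $ j\<bar>"] by (simp add: sum_nonneg)
  qed auto
  also have "\<dots> = mnorm A * mnorm B" by (simp add: mnorm_def sum_distrib_right)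
  finally show ?thesis .
qed

lemma transpose_mult_nth:
  fixes A :: "real^'n^'n"
  shows "(transpose A *v v) $ b = (\<Sum>a\<in>UNIV. A $ a $ b * v $ a)"
  by (simp add: matrix_vector_mult_def transpose_def)

lemma norm_transpose_mult_le:
  fixes A :: "real^'n^'n"
  shows "norm (transpose A *v v) \<le> mnorm A * norm v"
proof -
  have "norm (transpose A *v v) \<le> (\<Sum>b\<in>UNIV. \<bar>(transpose A *v v) $ b\<bar>)"
    by (rule norm_le_l1_cart)
  also have "\<dots> \<le> (\<Sum>b\<in>UNIV. \<Sum>a\<in>UNIV. \<bar>A $ a $ b\<bar> * norm v)"
    unfolding transpose_mult_nth
    by (intro sum_mono order_trans[OF sum_abs])
       (auto simp: abs_mult intro!: mult_left_mono component_le_norm_cart)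
  also have "\<dots> = (\<Sum>a\<in>UNIV. \<Sum>b\<in>UNIV. \<bar>A $ a $ b\<bar> * norm v)" by (rule sum.swap)
  also have "\<dots> = mnorm A * norm v" by (simp add: mnorm_def sum_distrib_right)
  finally show ?thesis .
qed

lemma abs_det_le:
  fixes A :: "real^'n^'n"
  assumes "\<And>i j. \<bar>A $ i $ j\<bar> \<le> c"
  shows "\<bar>det A\<bar> \<le> fact CARD('n) * c ^ CARD('n)"
proof -
  have "\<bar>det A\<bar> \<le> (\<Sum>p\<in>{p. p permutes (UNIV::'n set)}. \<bar>of_int (sign p) * (\<Prod>i\<in>UNIV. A $ i $ p i)\<bar>)"
    unfolding det_def by (rule sum_abs)
  also have "\<dots> \<le> (\<Sum>p\<in>{p. p permutes (UNIV::'n set)}. c ^ CARD('n))"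
  proof (rule sum_mono)
    fix p :: "'n \<Rightarrow> 'n" 
    have "\<bar>of_int (sign p) * (\<Prod>i\<in>UNIV. A $ i $ p i)\<bar> = (\<Prod>i\<in>UNIV. \<bar>A $ i $ p i\<bar>)"
      by (simp add: abs_mult abs_prod sign_def)
    also have "\<dots> \<le> (\<Prod>i\<in>(UNIV::'n set). c)" using assms by (intro prod_mono) auto
    finally show "\<bar>of_int (sign p) * (\<Prod>i\<in>UNIV. A $ i $ p i)\<bar> \<le> c ^ CARD('n)" by simp
  qed
  also have "\<dots> = fact CARD('n) * c ^ CARD('n)"
    using card_permutations[of "UNIV::'n set" "CARD('n)"] by simp
  finally show ?thesis .
qed

text \<open>Cramer's rule bounds the inverse of a matrix of determinant 1 by a power of its norm.
  The power is crude, but it will enter only with a small interpolation weight.\<close>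

lemma norm_le_of_det_1:
  fixes A :: "real^'n^'n"
  assumes det: "det A = 1" and m: "1 \<le> mnorm A"
  shows "norm v \<le> CARD('n) * fact CARD('n) * mnorm A ^ CARD('n) * norm (transpose A *v v)"
proof (cases "transpose A *v v = 0")
  case True
  have "det (transpose A) = 1" using det by (simp add: det_transpose)
  then have "invertible (transpose A)" by (simp add: invertible_det_nz)
  then have "v = 0" using True by (metis matrix_left_invertible_ker invertible_def)
  then show ?thesis by simp
next
  case False
  define n where "n = norm (transpose A *v v)"
  have n: "n > 0" using False by (simp add: n_def)
  \<comment> \<open>Normalised, so that the column inserted in Cramer's rule has entries at most 1
    and hence at most \<open>mnorm A\<close>.\<close>
  define b where "b = (1 / n) *\<^sub>R (transpose A *v v)"
  define x where "x = (1 / n) *\<^sub>R v"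
  have xb: "transpose A *v x = b"
    by (simp add: x_def b_def matrix_vector_mult_scaleR)
  have nb: "norm b = 1" using n by (simp add: b_def n_def)
  have d: "det (transpose A) = 1" using det by (simp add: det_transpose)
  have "\<bar>x $ k\<bar> \<le> fact CARD('n) * mnorm A ^ CARD('n)" for k
  proof -
    let ?M = "\<chi> i j. if j = k then b $ i else transpose A $ i $ j"
    have "x = (\<chi> k. det (\<chi> i j. if j = k then b $ i else transpose A $ i $ j) / det (transpose A))"
      using cramer[of "transpose A" x b] d xb by simp
    then have "x $ k = det ?M" using d by (simp add: vec_eq_iff)
    moreover have "\<bar>?M $ i $ j\<bar> \<le> mnorm A" for i j
      using abs_nth_le_mnorm[of A j i] component_le_norm_cart[of b i] nb m by (auto simp: transpose_def)
    ultimately show ?thesis using abs_det_le[of ?M "mnorm A"] by simp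
  qed
  then have "(\<Sum>k\<in>UNIV. \<bar>x $ k\<bar>) \<le> (\<Sum>k\<in>(UNIV::'n set). fact CARD('n) * mnorm A ^ CARD('n))"
    by (intro sum_mono) auto
  then have "norm x \<le> CARD('n) * fact CARD('n) * mnorm A ^ CARD('n)"
    using norm_le_l1_cart[of x] by simp
  then have "norm x * n \<le> CARD('n) * fact CARD('n) * mnorm A ^ CARD('n) * n"
    using n by (intro mult_right_mono) auto
  moreover have "norm v = norm x * n" using n by (simp add: x_def)
  ultimately show ?thesis unfolding n_def[symmetric] by (simp only:)
qed

text \<open>Write a as \<open>a powr (1 - t) * a powr t\<close> and bound the two factors
  separately; \<open>C1 + C2\<close> serves as constant in both bounds.\<close>

lemma interpolate_powr:
  fixes a C1 C2 Q R :: real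
  assumes "0 \<le> a" "0 \<le> C1" "0 \<le> C2" "1 \<le> Q" "1 \<le> R" "0 < t" "t < 1"
    and 1: "a \<le> C1 * Q powr \<alpha>1 * R powr \<beta>1" and 2: "a \<le> C2 * Q powr \<alpha>2 * R powr \<beta>2"
  shows "a \<le> (C1 + C2) * Q powr ((1 - t) * \<alpha>1 + t * \<alpha>2) * R powr ((1 - t) * \<beta>1 + t * \<beta>2)"
proof (cases "a = 0")
  case True
  then show ?thesis using assms by simp
next
  case False
  define C X Y where "C = C1 + C2" and "X = C * Q powr \<alpha>1 * R powr \<beta>1" and "Y = C * Q powr \<alpha>2 * R powr \<beta>2"
  have C: "C1 \<le> C" "C2 \<le> C" "0 \<le> C" using assms by (auto simp: C_def)
  have "C1 * Q powr \<alpha>1 * R powr \<beta>1 \<le> X" "C2 * Q powr \<alpha>2 * R powr \<beta>2 \<le> Y"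
    unfolding X_def Y_def by (intro mult_right_mono C; simp)+
  then have "a \<le> X" "a \<le> Y" using 1 2 by linarith+
  moreover have a: "a > 0" using False assms by simp
  ultimately have "a powr (1 - t) * a powr t \<le> X powr (1 - t) * Y powr t"
    using assms by (intro mult_mono powr_mono2) auto
  moreover have "a powr (1 - t) * a powr t = a" using a by (simp add: powr_add[symmetric])
  moreover have "X powr (1 - t) * Y powr t
      = C * Q powr ((1 - t) * \<alpha>1 + t * \<alpha>2) * R powr ((1 - t) * \<beta>1 + t * \<beta>2)"
  proof -
    have "C > 0" using \<open>a \<le> X\<close> a C by (auto simp: X_def le_less)
    moreover have "C powr (1 - t) * C powr t = C" using \<open>C > 0\<close> by (simp add: powr_add[symmetric])
    ultimately show ?thesis
      by (simp add: X_def Y_def powr_mult powr_powr powr_add mult_ac)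
  qed
  ultimately show ?thesis by (simp add: C_def)
qed

section \<open>Growth and balance of the accelerated cocycle\<close>

locale keane_data =
  fixes s :: "'a::finite iemdata"
  assumes keane: "keane_iem s"
begin

definition q :: "nat \<Rightarrow> real" where "q k = mnorm (Qmat s 0 k)"

abbreviation S :: "nat \<Rightarrow> nat \<Rightarrow> real^'a \<Rightarrow> real^'a" where "S \<equiv> Smap s"

abbreviation len :: "nat \<Rightarrow> 'a \<Rightarrow> real" where "len k \<equiv> lens (rv_state s (nacc s k))"

text \<open>The return time to the range of level k on the interval b of that level, counted in
  steps of the original map.\<close>

definition colsum :: "nat \<Rightarrow> 'a \<Rightarrow> real" where "colsum k b = (\<Sum>a\<in>UNIV. Qmat s 0 k $ a $ b)"

lemma nacc_mono: "i \<le> j \<Longrightarrow> nacc s i \<le> nacc s j"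
  using strict_mono_nacc[OF keane] by (simp add: strict_mono_less_eq)

lemma Qmat_refl: "Qmat s k k = mat 1"
  using Qmat_eq[OF keane, of k k] by simp

lemma Qmat_trans: "i \<le> j \<Longrightarrow> j \<le> k \<Longrightarrow> Qmat s i k = Qmat s i j ** Qmat s j k"
  using rv_prod_trans[OF nacc_mono nacc_mono, of i j k] Qmat_eq[OF keane] by simp

lemma Qmat_Suc: "Qmat s k (Suc k) = Zmat s (Suc k)"
  using Qmat_eq[OF keane, of k "Suc k"] Zmat_eq[of s k] by simp

lemma Qmat_nonneg: "i \<le> j \<Longrightarrow> 0 \<le> Qmat s i j $ a $ b"
  using rv_prod_nonneg[OF nacc_mono] Qmat_eq[OF keane] by simp

lemma Qmat_diag: "i \<le> j \<Longrightarrow> 1 \<le> Qmat s i j $ a $ a"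
  using rv_prod_diag[OF nacc_mono] Qmat_eq[OF keane] by simp

lemma Qmat_det: "i \<le> j \<Longrightarrow> det (Qmat s i j) = 1"
  using det_rv_prod[OF keane nacc_mono] Qmat_eq[OF keane] by simp

lemma Qmat_positive: "1 \<le> Qmat s k (k + 4 * CARD('a)) $ a $ b"
  using rv_prod_positive[OF keane] Qmat_eq[OF keane] by simp

lemma Qmat_len: "i \<le> j \<Longrightarrow> len i a = (\<Sum>b\<in>UNIV. Qmat s i j $ a $ b * len j b)"
  using rv_prod_lens[OF keane nacc_mono] Qmat_eq[OF keane] by simp

lemma mnorm_Qmat: "i \<le> j \<Longrightarrow> mnorm (Qmat s i j) = (\<Sum>a\<in>UNIV. \<Sum>b\<in>UNIV. Qmat s i j $ a $ b)"
  unfolding mnorm_def by (intro sum.cong refl) (simp add: Qmat_nonneg)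

lemma card_ge_2: "2 \<le> real CARD('a)"
  using keane_iemD(1)[OF keane] by simp

lemma mnorm_Qmat_ge_1: "i \<le> j \<Longrightarrow> 1 \<le> mnorm (Qmat s i j)"
  by (meson Qmat_diag abs_ge_self abs_nth_le_mnorm order_trans)

lemma q_ge_1: "1 \<le> q k"
  unfolding q_def by (rule mnorm_Qmat_ge_1) simp

lemma q_pos: "0 < q k" using q_ge_1[of k] by simp

lemma q_0: "q 0 = CARD('a)"
proof -
  have "q 0 = mnorm (mat 1 :: real^'a^'a)" by (simp add: q_def Qmat_refl)
  also have "\<dots> = (\<Sum>a\<in>(UNIV::'a set). \<Sum>b\<in>(UNIV::'a set). if a = b then 1 else 0)"
    unfolding mnorm_def by (intro sum.cong refl) (simp add: mat_def)
  finally show ?thesis by simp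
qed

lemma q_eq_colsum: "q k = (\<Sum>b\<in>UNIV. colsum k b)"
  unfolding q_def colsum_def by (simp add: mnorm_Qmat) (rule sum.swap)

lemma colsum_trans:
  assumes "j \<le> k"
  shows "colsum k b = (\<Sum>c\<in>UNIV. colsum j c * Qmat s j k $ c $ b)"
proof -
  have "colsum k b = (\<Sum>a\<in>UNIV. \<Sum>c\<in>UNIV. Qmat s 0 j $ a $ c * Qmat s j k $ c $ b)"
    unfolding colsum_def using Qmat_trans[of 0 j k] assms by (simp add: matrix_matrix_mult_def)
  also have "\<dots> = (\<Sum>c\<in>UNIV. \<Sum>a\<in>UNIV. Qmat s 0 j $ a $ c * Qmat s j k $ c $ b)" by (rule sum.swap)
  finally show ?thesis by (simp add: colsum_def sum_distrib_right)
qed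

lemma colsum_ge_1: "1 \<le> colsum k b"
  unfolding colsum_def
  using member_le_sum[of b UNIV "\<lambda>a. Qmat s 0 k $ a $ b"] Qmat_nonneg[of 0 k] Qmat_diag[of 0 k b]
  by simp

lemma colsum_mono: "j \<le> k \<Longrightarrow> colsum j b \<le> colsum k b"
  unfolding colsum_def Qmat_eq[OF keane le0] by (intro sum_mono rv_prod_mono nacc_mono le0)

lemma q_mono: "j \<le> k \<Longrightarrow> q j \<le> q k"
  unfolding q_eq_colsum by (intro sum_mono colsum_mono)

text \<open>All entries of the matrix over these blocks are at least 1, so every later column sum
  dominates the sum of all earlier ones.\<close>

lemma colsum_ge_q: "q k \<le> colsum (k + (4 * CARD('a))) b"
proof -
  have "q k \<le> (\<Sum>c\<in>UNIV. colsum k c * Qmat s k (k + (4 * CARD('a))) $ c $ b)"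
    unfolding q_eq_colsum
  proof (rule sum_mono)
    fix c
    show "colsum k c \<le> colsum k c * Qmat s k (k + 4 * CARD('a)) $ c $ b"
      using mult_left_mono[OF Qmat_positive[of k c b], of "colsum k c"] colsum_ge_1[of k c] by simp
  qed
  then show ?thesis by (simp add: colsum_trans[of k "k + (4 * CARD('a))" b])
qed

text \<open>For small k truncated subtraction leads to level 0, where \<open>q 0 = CARD('a)\<close>
  turns the bound into 1.\<close>

lemma colsum_ge: "q (k - (4 * CARD('a))) / CARD('a) \<le> colsum k b"
proof (cases "(4 * CARD('a)) \<le> k")
  case True
  have "q (k - (4 * CARD('a))) / CARD('a) \<le> q (k - (4 * CARD('a)))"
    using card_ge_2 q_pos[of "k - (4 * CARD('a))"] by (simp add: divide_le_eq)
  then show ?thesis using colsum_ge_q[of "k - (4 * CARD('a))" b] True by simp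
next
  case False
  then show ?thesis using q_0 colsum_ge_1 card_ge_2 by simp
qed

lemma q_doubles: "2 * q k \<le> q (k + (4 * CARD('a)))"
proof -
  have "2 * q k \<le> CARD('a) * q k" using card_ge_2 q_pos[of k] by (intro mult_right_mono) auto
  also have "\<dots> = (\<Sum>b\<in>(UNIV::'a set). q k)" by simp
  also have "\<dots> \<le> q (k + (4 * CARD('a)))" unfolding q_eq_colsum[of "k + (4 * CARD('a))"] by (intro sum_mono colsum_ge_q)
  finally show ?thesis .
qed

lemma q_ge_power: "2 ^ (k div (4 * CARD('a))) \<le> q k"
proof -
  have "2 ^ n \<le> q (n * (4 * CARD('a)))" for n
  proof (induction n)
    case (Suc n)
    then show ?case using q_doubles[of "n * (4 * CARD('a))"] by (simp add: add.commute)
  qed (use q_ge_1 in simp)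
  then show ?thesis using q_mono[of "k div (4 * CARD('a)) * (4 * CARD('a))" k] by (meson order_trans div_times_less_eq_dividend)
qed

lemma q_unbounded: "\<exists>k. B < q k"
proof -
  obtain n where "B < 2 ^ n" using real_arch_pow[of 2 B] by auto
  also have "2 ^ n \<le> q (n * (4 * CARD('a)))" using q_ge_power[of "n * (4 * CARD('a))"] by simp
  finally show ?thesis by blast
qed

lemma summable_q_powr:
  assumes e: "e > 0"
  shows "summable (\<lambda>k. q k powr (- e))"
proof (rule summable_comparison_test')
  \<comment> \<open>As q doubles every \<open>4 * CARD('a)\<close> blocks, z is the resulting ratio
    per block; the factor \<open>2 powr e\<close> makes up for the rounding in
    \<open>div\<close>.\<close>
  define z where "z = 2 powr (- e / (4 * CARD('a)))"
  have r: "real (4 * CARD('a)) > 0" using card_ge_2 by simp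
  have "z < 2 powr 0" unfolding z_def using e r by (intro powr_less_mono divide_neg_pos) auto
  then have z: "0 < z" "z < 1" by (auto simp: z_def)
  show "summable (\<lambda>k. 2 powr e * z ^ k)"
    using z by (intro summable_mult summable_geometric) auto
  fix k :: nat
  have rp: "(4 * CARD('a)) > 0" using keane_iemD(1)[OF keane] by simp
  have "k \<le> (k div (4 * CARD('a)) + 1) * (4 * CARD('a))"
    using dividend_less_div_times[OF rp, of k] by (simp add: add.commute)
  then have "real k \<le> real ((k div (4 * CARD('a)) + 1) * (4 * CARD('a)))" by (simp only: of_nat_le_iff)
  then have "real k / real (4 * CARD('a)) \<le> real (k div (4 * CARD('a))) + 1"
    using r by (simp only: of_nat_mult of_nat_add of_nat_1 pos_divide_le_eq)
  then have "2 powr (real k / (4 * CARD('a)) - 1) \<le> 2 powr (real (k div (4 * CARD('a))))" by (intro powr_mono) auto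
  also have "\<dots> \<le> q k" using q_ge_power[of k] by (simp add: powr_realpow)
  finally have "q k powr (- e) \<le> (2 powr (real k / (4 * CARD('a)) - 1)) powr (- e)"
    using e by (intro powr_mono2') auto
  also have "\<dots> = 2 powr e * z ^ k"
    by (simp add: z_def powr_powr powr_add[symmetric] powr_realpow[symmetric] algebra_simps)
  finally show "norm (q k powr (- e)) \<le> 2 powr e * z ^ k" by simp
qed

lemma S_trans:
  assumes "i \<le> j" "j \<le> k"
  shows "S i k v = S j k (S i j v)"
  unfolding Smap_def
  by (simp only: Qmat_trans[OF assms] matrix_transpose_mul matrix_vector_mul_assoc)

lemma S_refl [simp]: "S k k v = v"
  unfolding Smap_def by (simp add: Qmat_refl transpose_mat)

lemma S_nth: "S j k v $ b = (\<Sum>a\<in>UNIV. Qmat s j k $ a $ b * v $ a)"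
  unfolding Smap_def by (rule transpose_mult_nth)

lemma S_linear: "linear (S j k)"
  unfolding Smap_def by (rule matrix_vector_mul_linear)

lemma S_add: "S j k (v + w) = S j k v + S j k w"
  by (rule linear_add[OF S_linear])

lemma S_diff: "S j k (v - w) = S j k v - S j k w"
  by (rule linear_diff[OF S_linear])

lemma S_sum: "S j k (sum f A) = (\<Sum>x\<in>A. S j k (f x))"
  by (rule linear_sum[OF S_linear])

lemma norm_S_le: "norm (S j k v) \<le> mnorm (Qmat s j k) * norm v"
  unfolding Smap_def by (rule norm_transpose_mult_le)

lemma S_surj:
  assumes "j \<le> k"
  obtains v where "S j k v = w"
proof -
  have "invertible (transpose (Qmat s j k))"
    by (simp add: invertible_det_nz det_transpose Qmat_det[OF assms])
  then have "surj (S j k)" unfolding Smap_def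
    by (metis invertible_def matrix_right_invertible_surjective)
  then show thesis using that by (metis surjD)
qed

definition Kd :: real where "Kd = CARD('a) * fact CARD('a)"

lemma Kd_pos: "0 < Kd" unfolding Kd_def using card_ge_2 by simp

lemma norm_le_S: "norm v \<le> Kd * q j ^ CARD('a) * norm (S 0 j v)"
  unfolding Kd_def q_def Smap_def
  by (rule norm_le_of_det_1) (use Qmat_det[of 0 j] mnorm_Qmat_ge_1[of 0 j] in auto)

text \<open>Vectors are transported by the transpose of the matrix that relates the lengths, so the
  pairing is invariant. In particular zero mean is preserved.\<close>

lemma S_len: "i \<le> j \<Longrightarrow> (\<Sum>b\<in>UNIV. len j b * S i j v $ b) = (\<Sum>a\<in>UNIV. len i a * v $ a)"
proof -
  assume ij: "i \<le> j"
  have "(\<Sum>b\<in>UNIV. len j b * S i j v $ b) = (\<Sum>b\<in>UNIV. \<Sum>a\<in>UNIV. v $ a * (Qmat s i j $ a $ b * len j b))"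
    by (simp add: S_nth sum_distrib_left mult_ac)
  also have "\<dots> = (\<Sum>a\<in>UNIV. \<Sum>b\<in>UNIV. v $ a * (Qmat s i j $ a $ b * len j b))" by (rule sum.swap)
  also have "\<dots> = (\<Sum>a\<in>UNIV. len i a * v $ a)"
    by (simp add: sum_distrib_left[symmetric] Qmat_len[OF ij, symmetric] mult.commute)
  finally show ?thesis .
qed

text \<open>\<open>q k\<close> is the sum of the entries of \<open>Qmat s j k\<close> weighted by
  the return times of level j. A lower bound m on these divides out the growth up to level
  j.\<close>

lemma mnorm_Qmat_le:
  assumes "j \<le> k" and m: "0 < m" "\<And>b. m \<le> colsum j b"
  shows "mnorm (Qmat s j k) \<le> q k / m"
proof -
  have "m * mnorm (Qmat s j k) = (\<Sum>b\<in>UNIV. \<Sum>c\<in>UNIV. m * Qmat s j k $ c $ b)"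
    unfolding mnorm_Qmat[OF assms(1)] sum_distrib_left by (rule sum.swap)
  also have "\<dots> \<le> (\<Sum>b\<in>UNIV. \<Sum>c\<in>UNIV. colsum j c * Qmat s j k $ c $ b)"
    using m Qmat_nonneg[OF assms(1)] by (intro sum_mono mult_right_mono) auto
  also have "\<dots> = q k" unfolding q_eq_colsum[of k] by (simp add: colsum_trans[OF assms(1)])
  finally show ?thesis using m by (simp add: pos_le_divide_eq mult.commute)
qed

text \<open>The orbits of the intervals of level k up to their return fill I, so the total length is
  the sum of return times multiplied by lengths.\<close>

lemma len_le: "len k b \<le> total_length (lens s) / colsum k b"
proof -
  have pos: "0 < len j c" for j c
    using keane_iemD(3)[OF keane_iem_rv_state[OF keane]] by blast
  have "colsum k b * len k b \<le> (\<Sum>c\<in>UNIV. colsum k c * len k c)"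
    using member_le_sum[of b UNIV "\<lambda>c. colsum k c * len k c"] pos colsum_ge_1
    by (simp add: less_imp_le order_trans[OF zero_le_one colsum_ge_1])
  also have "\<dots> = (\<Sum>c\<in>UNIV. \<Sum>a\<in>UNIV. Qmat s 0 k $ a $ c * len k c)"
    by (simp add: colsum_def sum_distrib_right)
  also have "\<dots> = (\<Sum>a\<in>UNIV. \<Sum>c\<in>UNIV. Qmat s 0 k $ a $ c * len k c)" by (rule sum.swap)
  also have "\<dots> = total_length (lens s)"
    using Qmat_len[of 0 k] by (simp add: total_length_def)
  finally show ?thesis using colsum_ge_1[of k b] by (simp add: pos_le_divide_eq mult.commute)
qed

text \<open>Variation of constants: the error made at level j is carried to level k by the
  cocycle.\<close>

lemma S_recurrence:
  assumes "x 0 = \<nu> 0" "\<And>k. x (Suc k) = S k (Suc k) (x k) + \<nu> (Suc k)"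
  shows "x k = (\<Sum>j\<le>k. S j k (\<nu> j))"
proof (induction k)
  case (Suc k)
  have "x (Suc k) = (\<Sum>j\<le>k. S k (Suc k) (S j k (\<nu> j))) + \<nu> (Suc k)"
    by (simp add: assms(2) Suc S_sum)
  also have "(\<Sum>j\<le>k. S k (Suc k) (S j k (\<nu> j))) = (\<Sum>j\<le>k. S j (Suc k) (\<nu> j))"
    by (intro sum.cong refl) (simp add: S_trans[of _ k "Suc k", symmetric])
  finally show ?case by simp
qed (simp add: assms)

end

section \<open>Consequences of the Roth conditions\<close>

locale roth_data = keane_data +
  assumes rothA: "\<forall>e>0. \<exists>C>0. \<forall>k. mnorm (Zmat s (k + 1)) \<le> C * mnorm (Qmat s 0 k) powr e"
    and rothB: "\<exists>\<theta>>0. \<exists>C>0. \<forall>k. \<forall>v::real^'a. (\<Sum>a\<in>UNIV. lens s a * v $ a) = 0 \<longrightarrow>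
            norm (Smap s 0 k v) \<le> C * mnorm (Qmat s 0 k) powr (1 - \<theta>) * norm v"
    and rothC: "\<forall>e>0. \<exists>C>0. \<forall>k m. k \<le> m \<longrightarrow>
            (\<forall>v. infdist v (Gamma_s s k)
                   \<le> C * mnorm (Qmat s 0 m) powr e * infdist (Smap s k m v) (Gamma_s s m)) \<and>
            (\<forall>v\<in>Gamma_s s k. norm (Smap s k m v) \<le> C * mnorm (Qmat s 0 m) powr e * norm v)"
begin

abbreviation \<Gamma> :: "nat \<Rightarrow> (real^'a) set" where "\<Gamma> \<equiv> Gamma_s s"

lemma q_powr_mono: "a \<le> b \<Longrightarrow> q k powr a \<le> q k powr b"
  by (rule powr_mono) (auto simp: q_ge_1)

lemma q_powr_mono_index: "j \<le> k \<Longrightarrow> 0 \<le> a \<Longrightarrow> q j powr a \<le> q k powr a"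
  by (rule powr_mono2) (auto simp: q_mono less_imp_le q_pos)

lemma q_powr_antimono_index: "j \<le> k \<Longrightarrow> 0 \<le> a \<Longrightarrow> q k powr (- a) \<le> q j powr (- a)"
  by (rule powr_mono2') (auto simp: q_mono q_pos)

lemma q_powr_ge_1: "0 \<le> a \<Longrightarrow> 1 \<le> q k powr a"
  by (simp add: ge_one_powr_ge_zero q_ge_1)

lemma sum_q_powr_le:
  assumes "\<beta> > 0"
  obtains C where "C > 0" "\<And>A. finite A \<Longrightarrow> (\<Sum>j\<in>A. q j powr (- \<beta>)) \<le> C"
proof (rule that)
  let ?C = "(\<Sum>j. q j powr (- \<beta>)) + 1"
  show "(\<Sum>j\<in>A. q j powr (- \<beta>)) \<le> ?C" if "finite A" for A
    using sum_le_suminf[OF summable_q_powr[OF assms] that] by simp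
  from this[of "{}"] show "?C > 0"
    using suminf_nonneg[OF summable_q_powr[OF assms]] by (simp add: add_nonneg_pos)
qed

lemma block_le:
  assumes "e > 0"
  obtains C where "C > 0" "\<And>k. mnorm (Qmat s k (Suc k)) \<le> C * q k powr e"
  using rothA assms unfolding q_def Qmat_Suc by (metis Suc_eq_plus1)

lemma q_Suc_le: "q (Suc k) \<le> q k * mnorm (Qmat s k (Suc k))"
  unfolding q_def using mnorm_mult_le[of "Qmat s 0 k" "Qmat s k (Suc k)"] Qmat_trans[of 0 k "Suc k"] by simp

lemma q_shift_le:
  assumes "e > 0"
  shows "\<exists>C>0. \<forall>k. q (k + n) \<le> C * q k powr (1 + e)"
  using assms
proof (induction n arbitrary: e)
  case 0
  have "q k powr 1 \<le> q k powr (1 + e)" for k using 0 by (intro q_powr_mono) simp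
  then show ?case using q_pos by (intro exI[of _ 1]) (auto simp: powr_one less_imp_le)
next
  case (Suc n)
  \<comment> \<open>Since t is at most 1, \<open>(1 + t) * (1 + t)\<close> is at most
    \<open>1 + 3 * t\<close>.\<close>
  define t where "t = min (e / 3) 1"
  have t: "t > 0" "(1 + t) * (1 + t) \<le> 1 + e"
  proof -
    show "t > 0" using Suc by (simp add: t_def)
    have "t * t \<le> t * 1" using \<open>t > 0\<close> by (intro mult_left_mono) (auto simp: t_def)
    moreover have "3 * t \<le> e" by (simp add: t_def)
    ultimately show "(1 + t) * (1 + t) \<le> 1 + e" by (simp add: algebra_simps)
  qed
  obtain C where C: "C > 0" "\<And>k. q (k + n) \<le> C * q k powr (1 + t)" using Suc.IH[OF t(1)] by blast
  obtain B where B: "B > 0" "\<And>k. mnorm (Qmat s k (Suc k)) \<le> B * q k powr t"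
    using block_le[OF t(1)] by blast
  show ?case
  proof (intro exI[of _ "B * C powr (1 + t)"] conjI allI)
    show "0 < B * C powr (1 + t)" using B C by simp
    fix k
    have "q (k + Suc n) \<le> q (k + n) * mnorm (Qmat s (k + n) (Suc (k + n)))" using q_Suc_le[of "k + n"] by simp
    also have "\<dots> \<le> q (k + n) * (B * q (k + n) powr t)"
      using B(2) q_pos[of "k + n"] by (intro mult_left_mono) auto
    also have "\<dots> = B * q (k + n) powr (1 + t)" using q_pos[of "k + n"] by (simp add: powr_add)
    also have "\<dots> \<le> B * (C * q k powr (1 + t)) powr (1 + t)"
      using B(1) C(2)[of k] q_pos[of "k + n"] t by (intro mult_left_mono powr_mono2) auto
    also have "\<dots> = B * C powr (1 + t) * q k powr ((1 + t) * (1 + t))"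
      using C(1) by (simp add: powr_mult powr_powr)
    also have "\<dots> \<le> B * C powr (1 + t) * q k powr (1 + e)"
      using B(1) t by (intro mult_left_mono q_powr_mono) auto
    finally show "q (k + Suc n) \<le> B * C powr (1 + t) * q k powr (1 + e)" .
  qed
qed

text \<open>Every return time is at least \<open>1 / CARD('a)\<close> times the value of q some
  \<open>4 * CARD('a)\<close> blocks earlier, and by (a) this shift costs only a small
  power.\<close>

lemma colsum_ge_powr:
  assumes e: "e > 0"
  obtains c where "c > 0" "\<And>k b. c * q k powr (1 - e) \<le> colsum k b"
proof -
  obtain C where C: "C > 0" "\<And>k. q (k + 4 * CARD('a)) \<le> C * q k powr (1 + e)"
    using q_shift_le[OF e] by blast
  define D where "D = CARD('a) * C powr (1 / (1 + e))"
  have D: "D > 0" using C(1) card_ge_2 by (simp add: D_def)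
  have "q k powr (1 - e) \<le> D * colsum k b" for k b
  proof -
    let ?k = "k - 4 * CARD('a)"
    have "1 - e \<le> 1 / (1 + e)" using e by (subst pos_le_divide_eq) (auto simp: algebra_simps)
    then have "q k powr (1 - e) \<le> q k powr (1 / (1 + e))" by (rule q_powr_mono)
    also have "\<dots> \<le> (C * q ?k powr (1 + e)) powr (1 / (1 + e))"
      using order_trans[OF q_mono[of k "?k + 4 * CARD('a)"] C(2)[of ?k]] e q_pos[of k]
      by (intro powr_mono2) auto
    also have "\<dots> = C powr (1 / (1 + e)) * q ?k"
      using C(1) e q_pos[of ?k] by (simp add: powr_mult powr_powr)
    also have "\<dots> = D * (q ?k / CARD('a))" using card_ge_2 by (simp add: D_def)
    also have "\<dots> \<le> D * colsum k b" using D by (intro mult_left_mono colsum_ge) auto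
    finally show ?thesis .
  qed
  then show thesis using that[of "1 / D"] D by (simp add: field_simps)
qed

lemma mnorm_Qmat_powr:
  assumes e: "e > 0"
  obtains C where "C > 0" "\<And>j k. j \<le> k \<Longrightarrow> mnorm (Qmat s j k) \<le> C * q k * q j powr (e - 1)"
proof -
  obtain c where c: "c > 0" "\<And>k b. c * q k powr (1 - e) \<le> colsum k b" using colsum_ge_powr[OF e] by blast
  have "mnorm (Qmat s j k) \<le> (1 / c) * q k * q j powr (e - 1)" if "j \<le> k" for j k
  proof -
    have "mnorm (Qmat s j k) \<le> q k / (c * q j powr (1 - e))"
      using c q_pos[of j] by (intro mnorm_Qmat_le[OF that]) auto
    also have "\<dots> = (1 / c) * q k * q j powr (e - 1)"
      using powr_minus_divide[of "q j" "1 - e"] by simp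
    finally show ?thesis .
  qed
  then show thesis using that[of "1 / c"] c by simp
qed

lemma len_powr:
  assumes e: "e > 0"
  obtains C where "C > 0" "\<And>k b. len k b \<le> C * q k powr (e - 1)"
proof -
  obtain c where c: "c > 0" "\<And>k b. c * q k powr (1 - e) \<le> colsum k b" using colsum_ge_powr[OF e] by blast
  let ?t = "total_length (lens s)"
  have t: "?t > 0"
    unfolding total_length_def using keane_iemD(3)[OF keane] by (intro sum_pos) auto
  have "len k b \<le> (?t / c) * q k powr (e - 1)" for k b
  proof -
    have "len k b \<le> ?t / (c * q k powr (1 - e))"
    proof (rule order_trans[OF len_le])
      have "0 < colsum k b" using colsum_ge_1[of k b] by simp
      then show "?t / colsum k b \<le> ?t / (c * q k powr (1 - e))"
        using c q_pos[of k] t by (intro divide_left_mono) auto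
    qed
    also have "\<dots> = (?t / c) * q k powr (e - 1)"
      using powr_minus_divide[of "q k" "1 - e"] by simp
    finally show ?thesis .
  qed
  then show thesis using that[of "?t / c"] c t by simp
qed

text \<open>Replacing \<open>q k\<close> by \<open>q (Suc k)\<close> halves the exponent, since (a)
  bounds \<open>q (Suc k)\<close> by a multiple of \<open>q k powr 2\<close>.\<close>

lemma q_shift_decay:
  fixes f :: "nat \<Rightarrow> real"
  assumes \<delta>: "\<delta> > 0" and f: "\<And>k. f (Suc k) \<le> C0 * q k powr (- \<delta>)"
  obtains C where "C > 0" "\<And>k. f k \<le> C * q k powr (- (\<delta> / 2))"
proof -
  obtain B where B: "B > 0" "\<And>k. q (Suc k) \<le> B * q k powr 2" using q_shift_le[of 1 1] by auto
  define C where "C = max (\<bar>C0\<bar> * B powr (\<delta> / 2) + 1) (\<bar>f 0\<bar> * q 0 powr (\<delta> / 2))"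
  have "f k \<le> C * q k powr (- (\<delta> / 2))" for k
  proof (cases k)
    case 0
    have "f 0 \<le> \<bar>f 0\<bar> * q 0 powr (\<delta> / 2) * q 0 powr (- (\<delta> / 2))"
      using q_pos[of 0] by (simp add: powr_add[symmetric] mult.assoc)
    also have "\<dots> \<le> C * q 0 powr (- (\<delta> / 2))" by (intro mult_right_mono) (auto simp: C_def)
    finally show ?thesis using 0 by simp
  next
    case (Suc j)
    have "(B * q j powr 2) powr (- (\<delta> / 2)) \<le> q (Suc j) powr (- (\<delta> / 2))"
      using B q_pos[of "Suc j"] \<delta> by (intro powr_mono2') auto
    then have "q j powr (- \<delta>) * B powr (- (\<delta> / 2)) \<le> q (Suc j) powr (- (\<delta> / 2))"
      using B by (simp add: powr_mult powr_powr mult.commute)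
    then have "q j powr (- \<delta>) * (B powr (- (\<delta> / 2)) * B powr (\<delta> / 2)) \<le> q (Suc j) powr (- (\<delta> / 2)) * B powr (\<delta> / 2)"
      unfolding mult.assoc[symmetric] by (intro mult_right_mono) auto
    then have *: "q j powr (- \<delta>) \<le> B powr (\<delta> / 2) * q (Suc j) powr (- (\<delta> / 2))"
      using B by (simp add: powr_add[symmetric] mult.commute)
    have "f k \<le> \<bar>C0\<bar> * q j powr (- \<delta>)"
      using f[of j] Suc by (simp add: order_trans[OF _ mult_right_mono])
    also have "\<dots> \<le> \<bar>C0\<bar> * (B powr (\<delta> / 2) * q (Suc j) powr (- (\<delta> / 2)))"
      using * by (intro mult_left_mono) auto
    also have "\<dots> \<le> C * q k powr (- (\<delta> / 2))"
      unfolding Suc mult.assoc[symmetric] by (intro mult_right_mono) (auto simp: C_def)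
    finally show ?thesis .
  qed
  moreover have "C > 0" unfolding C_def by (simp add: add_nonneg_pos less_max_iff_disj)
  ultimately show thesis using that by blast
qed

text \<open>In the applications the first bound decays in \<open>q j\<close>, while the second is
  better in \<open>q k\<close> but large in \<open>q j\<close>. The weight t keeps the exponent of
  \<open>q j\<close> at most \<open>- \<beta>\<close>, so the sum over j stays bounded.\<close>

lemma interpolated_sum_le:
  fixes x :: "nat \<Rightarrow> nat \<Rightarrow> real^'a"
  assumes t: "0 < t" "t < 1" and C: "0 \<le> C1" "0 \<le> C2" and \<beta>: "\<beta> > 0"
    and 1: "\<And>j k. j \<le> k \<Longrightarrow> norm (x j k) \<le> C1 * q k powr \<alpha>1 * q j powr \<beta>1"
    and 2: "\<And>j k. j \<le> k \<Longrightarrow> norm (x j k) \<le> C2 * q k powr \<alpha>2 * q j powr \<beta>2"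
    and \<alpha>: "(1 - t) * \<alpha>1 + t * \<alpha>2 \<le> \<alpha>" and \<beta>': "(1 - t) * \<beta>1 + t * \<beta>2 \<le> - \<beta>"
  shows "\<exists>C>0. \<forall>k. norm (\<Sum>j\<le>k. x j k) \<le> C * q k powr \<alpha>"
proof -
  let ?C = "C1 + C2"
  obtain D where D: "D > 0" "\<And>A. finite A \<Longrightarrow> (\<Sum>j\<in>A. q j powr (- \<beta>)) \<le> D"
    using sum_q_powr_le[OF \<beta>] by blast
  have each: "norm (x j k) \<le> ?C * q k powr \<alpha> * q j powr (- \<beta>)" if jk: "j \<le> k" for j k
  proof -
    have "norm (x j k) \<le> ?C * q k powr ((1 - t) * \<alpha>1 + t * \<alpha>2) * q j powr ((1 - t) * \<beta>1 + t * \<beta>2)"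
      by (rule interpolate_powr[OF norm_ge_zero C q_ge_1 q_ge_1 t 1[OF jk] 2[OF jk]])
    also have "\<dots> \<le> ?C * q k powr \<alpha> * q j powr (- \<beta>)"
      using C \<alpha> \<beta>' by (intro mult_mono q_powr_mono order_refl) auto
    finally show ?thesis .
  qed
  have "norm (\<Sum>j\<le>k. x j k) \<le> (?C * D + 1) * q k powr \<alpha>" for k
  proof -
    have "norm (\<Sum>j\<le>k. x j k) \<le> (\<Sum>j\<le>k. ?C * q k powr \<alpha> * q j powr (- \<beta>))"
      using each by (auto intro!: order_trans[OF norm_sum] sum_mono)
    also have "\<dots> = ?C * q k powr \<alpha> * (\<Sum>j\<le>k. q j powr (- \<beta>))"
      by (simp add: sum_distrib_left)
    also have "\<dots> \<le> ?C * q k powr \<alpha> * D" using C by (intro mult_left_mono D) auto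
    also have "\<dots> = ?C * D * q k powr \<alpha>" by simp
    also have "\<dots> \<le> (?C * D + 1) * q k powr \<alpha>" by (intro mult_right_mono) auto
    finally show ?thesis .
  qed
  moreover have "?C * D + 1 > 0" using C D(1) by (simp add: add_nonneg_pos)
  ultimately show ?thesis by blast
qed

lemma zero_mean_growth:
  fixes \<xi> :: "nat \<Rightarrow> real^'a"
  assumes zm: "\<And>k. (\<Sum>a\<in>UNIV. len k a * \<xi> k $ a) = 0"
    and rec: "\<And>k. norm (\<xi> (Suc k) - S k (Suc k) (\<xi> k)) \<le> C0 * mnorm (Qmat s k (Suc k))"
  shows "\<exists>\<delta>>0. \<exists>C>0. \<forall>k. norm (\<xi> k) \<le> C * q k powr (1 - \<delta>)"
proof -
  let ?D = "real CARD('a)"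
  define \<nu> where "\<nu> k = (case k of 0 \<Rightarrow> \<xi> 0 | Suc i \<Rightarrow> \<xi> (Suc i) - S i (Suc i) (\<xi> i))" for k
  obtain B where B: "B > 0" "\<And>k. mnorm (Qmat s k (Suc k)) \<le> B * q k powr (1/4)"
    using block_le[of "1/4"] by auto
  define C1 where "C1 = \<bar>C0\<bar> * B + norm (\<xi> 0)"
  have C1: "0 \<le> C1" using B by (simp add: C1_def)
  have \<nu>: "norm (\<nu> j) \<le> C1 * q j powr (1/4)" for j
  proof (cases j)
    case 0
    have "norm (\<xi> 0) * 1 \<le> C1 * q 0 powr (1/4)"
      using B C1 q_powr_ge_1[of "1/4" 0] by (intro mult_mono) (auto simp: C1_def)
    then show ?thesis using 0 by (simp add: \<nu>_def)
  next
    case (Suc i)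
    have "norm (\<nu> j) \<le> \<bar>C0\<bar> * mnorm (Qmat s i (Suc i))"
      using rec[of i] Suc mult_right_mono[OF abs_ge_self[of C0] mnorm_nonneg[of "Qmat s i (Suc i)"]]
      by (simp add: \<nu>_def)
    also have "\<dots> \<le> \<bar>C0\<bar> * (B * q i powr (1/4))" by (intro mult_left_mono B) auto
    also have "\<dots> \<le> \<bar>C0\<bar> * (B * q j powr (1/4))"
      using B Suc by (intro mult_left_mono q_powr_mono_index) auto
    also have "\<dots> \<le> C1 * q j powr (1/4)"
      unfolding mult.assoc[symmetric] by (intro mult_right_mono) (auto simp: C1_def)
    finally show ?thesis .
  qed
  have zmv: "(\<Sum>a\<in>UNIV. len j a * \<nu> j $ a) = 0" for j
  proof (cases j)
    case (Suc i)
    then show ?thesis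
      using zm[of j] zm[of i] S_len[of i j "\<xi> i"]
      by (simp add: \<nu>_def right_diff_distrib sum_subtractf del: nacc.simps)
  qed (use zm[of 0] in \<open>simp add: \<nu>_def\<close>)
  obtain \<theta> Cb where \<theta>: "\<theta> > 0" "Cb > 0" and Cb: "\<And>k v. (\<Sum>a\<in>UNIV. lens s a * v $ a) = 0 \<Longrightarrow>
            norm (S 0 k v) \<le> Cb * q k powr (1 - \<theta>) * norm v"
    using rothB unfolding q_def by blast
  obtain Ca where Ca: "Ca > 0" "\<And>j k. j \<le> k \<Longrightarrow> mnorm (Qmat s j k) \<le> Ca * q k * q j powr (1/4 - 1)"
    using mnorm_Qmat_powr[of "1/4"] by auto
  \<comment> \<open>Chosen so that the exponent \<open>- 1/2\<close> of \<open>q j\<close> from the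
    first bound rises to at most \<open>- 1/4\<close> when mixed with the exponent
    \<open>CARD('a) + 1/4\<close> of the second.\<close>
  define t where "t = 1 / (4 * (?D + 1))"
  have t: "0 < t" "t < 1" "t * (?D + 3/4) \<le> 1/4"
  proof -
    have D: "?D \<ge> 2" by (rule card_ge_2)
    show "0 < t" using D by (simp add: t_def)
    show "t < 1" using D by (simp add: t_def)
    have "t * (?D + 3/4) \<le> t * (?D + 1)" using \<open>0 < t\<close> by (intro mult_left_mono) auto
    also have "\<dots> = 1/4" using D by (simp add: t_def)
    finally show "t * (?D + 3/4) \<le> 1/4" .
  qed
  have 1: "norm (S j k (\<nu> j)) \<le> Ca * C1 * q k powr 1 * q j powr (- (1/2))" if jk: "j \<le> k" for j k
  proof -
    have "norm (S j k (\<nu> j)) \<le> mnorm (Qmat s j k) * norm (\<nu> j)" by (rule norm_S_le)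
    also have "\<dots> \<le> (Ca * q k * q j powr (1/4 - 1)) * (C1 * q j powr (1/4))"
      using Ca q_pos[of k] by (intro mult_mono Ca(2)[OF jk] \<nu>) auto
    also have "\<dots> = Ca * C1 * q k * (q j powr (1/4 - 1) * q j powr (1/4))" by (simp add: mult_ac)
    also have "q j powr (1/4 - 1) * q j powr (1/4) = q j powr (- (1/2))" by (simp add: powr_add[symmetric])
    finally show ?thesis using q_pos[of k] by simp
  qed
  \<comment> \<open>Condition (b) starts at level 0. The error is pulled back there, where it still
    has zero mean, and the bound on the inverse costs the power \<open>CARD('a)\<close> of
    \<open>q j\<close>.\<close>
  have 2: "norm (S j k (\<nu> j)) \<le> Cb * Kd * C1 * q k powr (1 - \<theta>) * q j powr (?D + 1/4)" if jk: "j \<le> k" for j k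
  proof -
    obtain u where u: "S 0 j u = \<nu> j" using S_surj[of 0 j] by auto
    have "(\<Sum>a\<in>UNIV. lens s a * u $ a) = 0" using S_len[of 0 j u] zmv[of j] u by simp
    then have "norm (S 0 k u) \<le> Cb * q k powr (1 - \<theta>) * norm u" by (rule Cb)
    also have "norm u \<le> Kd * q j ^ CARD('a) * norm (\<nu> j)" using norm_le_S[of u j] u by simp
    also have "\<dots> \<le> Kd * q j ^ CARD('a) * (C1 * q j powr (1/4))"
      using Kd_pos q_pos[of j] by (intro mult_left_mono \<nu>) auto
    also have "\<dots> = Kd * C1 * q j powr (?D + 1/4)"
      using q_pos[of j] by (simp add: powr_add powr_realpow)
    finally have "norm (S 0 k u) \<le> Cb * q k powr (1 - \<theta>) * (Kd * C1 * q j powr (?D + 1/4))"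
      using \<theta> by (simp add: mult_left_mono)
    then show ?thesis using S_trans[OF _ jk, of 0 u] u by (simp add: mult_ac)
  qed
  have exps: "(1 - t) * 1 + t * (1 - \<theta>) \<le> 1 - t * \<theta>" "(1 - t) * (- (1/2)) + t * (?D + 1/4) \<le> - (1/4)"
    using t(3) by (simp_all add: algebra_simps)
  have nonneg: "0 \<le> Ca * C1" "0 \<le> Cb * Kd * C1" using Ca C1 \<theta> Kd_pos by simp_all
  have "\<xi> k = (\<Sum>j\<le>k. S j k (\<nu> j))" for k
    by (rule S_recurrence) (auto simp: \<nu>_def)
  moreover have "t * \<theta> > 0" using t \<theta> by simp
  ultimately show ?thesis
    using interpolated_sum_le[where x = "\<lambda>j k. S j k (\<nu> j)", OF t(1,2) nonneg _ 1 2 exps] by auto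
qed

end

section \<open>Stable spaces\<close>

context roth_data
begin

definition K1 :: real where "K1 = CARD('a) * norm (\<chi> a. 1 :: real^'a)"

lemma K1_pos: "0 < K1"
proof -
  have "(\<chi> a. 1 :: real^'a) \<noteq> 0" by (simp add: vec_eq_iff)
  then show ?thesis using card_ge_2 unfolding K1_def by simp
qed

lemma onorm_S_le: "onorm (S j k) \<le> mnorm (Qmat s j k)"
  by (rule onorm_le) (rule norm_S_le)

text \<open>The entries are nonnegative, so the components of the image of the all-ones vector add
  up to \<open>mnorm\<close> exactly.\<close>

lemma mnorm_le_onorm:
  assumes "j \<le> k"
  shows "mnorm (Qmat s j k) \<le> K1 * onorm (S j k)"
proof -
  let ?o = "\<chi> a. 1 :: real^'a"
  have "mnorm (Qmat s j k) = (\<Sum>b\<in>UNIV. S j k ?o $ b)"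
    unfolding mnorm_Qmat[OF assms] S_nth by (simp) (rule sum.swap)
  also have "\<dots> \<le> (\<Sum>b\<in>(UNIV::'a set). norm (S j k ?o))"
    by (intro sum_mono) (meson abs_ge_self component_le_norm_cart order_trans)
  also have "\<dots> = CARD('a) * norm (S j k ?o)" by simp
  also have "\<dots> \<le> CARD('a) * (onorm (S j k) * norm ?o)"
    by (intro mult_left_mono onorm) (auto simp: linear_conv_bounded_linear[symmetric] S_linear)
  finally show ?thesis by (simp add: K1_def mult_ac)
qed

text \<open>Decay can be measured by q because, for fixed k, it is comparable to the operator norms of
  the cocycle started at k.\<close>
lemma Gamma_iff:
  "v \<in> \<Gamma> k \<longleftrightarrow> (\<exists>\<sigma>>0. \<exists>C. \<forall>l\<ge>k. norm (S k l v) \<le> C * q l powr (- \<sigma>))"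
proof
  assume "v \<in> \<Gamma> k"
  then obtain \<sigma> C where \<sigma>: "\<sigma> > 0" "C > 0"
    and C: "\<And>l. l \<ge> k \<Longrightarrow> norm (S k l v) \<le> C * onorm (S k l) powr (- \<sigma>) * norm v"
    unfolding Gamma_s_def by blast
  have "norm (S k l v) \<le> (C * (q k * K1) powr \<sigma> * norm v) * q l powr (- \<sigma>)" if l: "l \<ge> k" for l
  proof -
    have "q l \<le> q k * mnorm (Qmat s k l)"
      unfolding q_def using mnorm_mult_le[of "Qmat s 0 k" "Qmat s k l"] Qmat_trans[of 0 k l] l by simp
    also have "\<dots> \<le> q k * (K1 * onorm (S k l))"
      using q_pos[of k] mnorm_le_onorm[OF l] by (intro mult_left_mono) auto
    finally have *: "q l / (q k * K1) \<le> onorm (S k l)"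
      using q_pos[of k] K1_pos by (simp add: divide_le_eq mult_ac)
    have "norm (S k l v) \<le> C * onorm (S k l) powr (- \<sigma>) * norm v" by (rule C[OF l])
    also have "\<dots> \<le> C * (q l / (q k * K1)) powr (- \<sigma>) * norm v"
      using \<sigma> * q_pos[of k] q_pos[of l] K1_pos
      by (intro mult_left_mono mult_right_mono powr_mono2') auto
    also have "(q l / (q k * K1)) powr (- \<sigma>) = q l powr (- \<sigma>) * (q k * K1) powr \<sigma>"
      using q_pos[of k] q_pos[of l] K1_pos by (simp add: powr_divide powr_minus_divide)
    finally show ?thesis by (simp add: mult_ac)
  qed
  then show "\<exists>\<sigma>>0. \<exists>C. \<forall>l\<ge>k. norm (S k l v) \<le> C * q l powr (- \<sigma>)" using \<sigma> by blast
next
  assume "\<exists>\<sigma>>0. \<exists>C. \<forall>l\<ge>k. norm (S k l v) \<le> C * q l powr (- \<sigma>)"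
  then obtain \<sigma> C where \<sigma>: "\<sigma> > 0"
    and C: "\<And>l. l \<ge> k \<Longrightarrow> norm (S k l v) \<le> C * q l powr (- \<sigma>)" by blast
  show "v \<in> \<Gamma> k"
  proof (cases "v = 0")
    case True
    then have "norm (S k l v) = 0" for l using linear_0[OF S_linear] by simp
    then show ?thesis using True unfolding Gamma_s_def by (intro CollectI exI[of _ "1::real"] conjI) auto
  next
    case False
    define C' where "C' = (\<bar>C\<bar> + 1) / norm v"
    have C': "C' > 0" using False by (simp add: C'_def add_nonneg_pos)
    have "norm (S k l v) \<le> C' * onorm (S k l) powr (- \<sigma>) * norm v" if l: "l \<ge> k" for l
    proof -
      have "0 < mnorm (Qmat s k l)" using mnorm_Qmat_ge_1[OF l] by simp
      then have pos: "0 < onorm (S k l)"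
        using less_le_trans[OF _ mnorm_le_onorm[OF l]] zero_less_mult_pos[OF _ K1_pos] by blast
      have "mnorm (Qmat s k l) \<le> q l"
        using mnorm_Qmat_le[OF l, of 1] colsum_ge_1 by simp
      then have "onorm (S k l) \<le> q l" using onorm_S_le[of k l] by simp
      then have *: "q l powr (- \<sigma>) \<le> onorm (S k l) powr (- \<sigma>)"
        using pos \<sigma> by (intro powr_mono2') auto
      have "norm (S k l v) \<le> (\<bar>C\<bar> + 1) * q l powr (- \<sigma>)"
        by (rule order_trans[OF C[OF l]]) (intro mult_right_mono, auto)
      also have "\<dots> \<le> (\<bar>C\<bar> + 1) * onorm (S k l) powr (- \<sigma>)"
        using * by (intro mult_left_mono) auto
      also have "\<dots> = C' * onorm (S k l) powr (- \<sigma>) * norm v" using False by (simp add: C'_def)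
      finally show ?thesis .
    qed
    then show ?thesis using \<sigma> C' unfolding Gamma_s_def by blast
  qed
qed

lemma subspace_Gamma: "subspace (\<Gamma> k)"
proof -
  have "norm (S k l 0) \<le> 0 * q l powr (- 1)" for l using linear_0[OF S_linear] by simp
  then have "0 \<in> \<Gamma> k" unfolding Gamma_iff using zero_less_one by blast
  moreover have "c *\<^sub>R v \<in> \<Gamma> k" if v: "v \<in> \<Gamma> k" for v c
  proof -
    from v obtain \<sigma> C where \<sigma>: "\<sigma> > 0" and C: "\<And>l. l \<ge> k \<Longrightarrow> norm (S k l v) \<le> C * q l powr (- \<sigma>)"
      unfolding Gamma_iff by blast
    have "norm (S k l (c *\<^sub>R v)) \<le> (\<bar>c\<bar> * C) * q l powr (- \<sigma>)" if "l \<ge> k" for l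
      using mult_left_mono[OF C[OF that], of "\<bar>c\<bar>"] by (simp add: linear_cmul[OF S_linear] mult.assoc)
    then show ?thesis unfolding Gamma_iff using \<sigma> by blast
  qed
  moreover have "v + w \<in> \<Gamma> k" if v: "v \<in> \<Gamma> k" and w: "w \<in> \<Gamma> k" for v w
  proof -
    from v obtain \<sigma> C where \<sigma>: "\<sigma> > 0" and C: "\<And>l. l \<ge> k \<Longrightarrow> norm (S k l v) \<le> C * q l powr (- \<sigma>)"
      unfolding Gamma_iff by blast
    from w obtain \<tau> B where \<tau>: "\<tau> > 0" and B: "\<And>l. l \<ge> k \<Longrightarrow> norm (S k l w) \<le> B * q l powr (- \<tau>)"
      unfolding Gamma_iff by blast
    have "norm (S k l (v + w)) \<le> (\<bar>C\<bar> + \<bar>B\<bar>) * q l powr (- min \<sigma> \<tau>)" if l: "l \<ge> k" for l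
    proof -
      have "norm (S k l v) \<le> \<bar>C\<bar> * q l powr (- min \<sigma> \<tau>)"
        by (rule order_trans[OF C[OF l]]) (intro mult_mono q_powr_mono, auto)
      moreover have "norm (S k l w) \<le> \<bar>B\<bar> * q l powr (- min \<sigma> \<tau>)"
        by (rule order_trans[OF B[OF l]]) (intro mult_mono q_powr_mono, auto)
      ultimately show ?thesis
        unfolding S_add by (intro order_trans[OF norm_triangle_ineq]) (simp add: distrib_right)
    qed
    moreover have "min \<sigma> \<tau> > 0" using \<sigma> \<tau> by simp
    ultimately show ?thesis unfolding Gamma_iff by blast
  qed
  ultimately show ?thesis unfolding subspace_def by blast
qed

lemma Gamma_nonempty: "\<Gamma> k \<noteq> {}"
  using subspace_0[OF subspace_Gamma] by blast

lemma Gamma_closed: "closed (\<Gamma> k)"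
  by (rule closed_subspace[OF subspace_Gamma])

lemma S_Gamma_iff:
  assumes jk: "j \<le> k"
  shows "S j k v \<in> \<Gamma> k \<longleftrightarrow> v \<in> \<Gamma> j"
proof
  assume "v \<in> \<Gamma> j"
  then obtain \<sigma> C where \<sigma>: "\<sigma> > 0" and C: "\<And>l. l \<ge> j \<Longrightarrow> norm (S j l v) \<le> C * q l powr (- \<sigma>)"
    unfolding Gamma_iff by blast
  have "norm (S k l (S j k v)) \<le> C * q l powr (- \<sigma>)" if "l \<ge> k" for l
    using C[of l] that jk by (simp add: S_trans[OF jk, symmetric])
  then show "S j k v \<in> \<Gamma> k" unfolding Gamma_iff using \<sigma> by blast
next
  assume "S j k v \<in> \<Gamma> k"
  then obtain \<sigma> C where \<sigma>: "\<sigma> > 0"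
    and C: "\<And>l. l \<ge> k \<Longrightarrow> norm (S k l (S j k v)) \<le> C * q l powr (- \<sigma>)"
    unfolding Gamma_iff by blast
  \<comment> \<open>The second summand covers the finitely many levels from j up to k, where the
    image has norm at most \<open>q k * norm v\<close> and \<open>q l powr (- \<sigma>)\<close> is
    at least \<open>q k powr (- \<sigma>)\<close>.\<close>
  define C' where "C' = \<bar>C\<bar> + q k * norm v * q k powr \<sigma>"
  have "norm (S j l v) \<le> C' * q l powr (- \<sigma>)" if l: "l \<ge> j" for l
  proof (cases "l \<ge> k")
    case True
    have "norm (S j l v) \<le> C * q l powr (- \<sigma>)" using C[OF True] by (simp add: S_trans[OF jk True])
    also have "\<dots> \<le> C' * q l powr (- \<sigma>)"
      using q_pos[of k] by (intro mult_right_mono) (auto simp: C'_def intro: add_increasing2)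
    finally show ?thesis .
  next
    case False
    have "norm (S j l v) \<le> mnorm (Qmat s j l) * norm v" by (rule norm_S_le)
    also have "mnorm (Qmat s j l) \<le> q l" using mnorm_Qmat_le[OF l, of 1] colsum_ge_1 by simp
    also have "q l \<le> q k" using False by (intro q_mono) simp
    finally have "norm (S j l v) \<le> q k * norm v * (q k powr \<sigma> * q k powr (- \<sigma>))"
      using q_pos[of k] by (simp add: mult_right_mono powr_add[symmetric])
    also have "\<dots> = (q k * norm v * q k powr \<sigma>) * q k powr (- \<sigma>)" by simp
    also have "\<dots> \<le> C' * q l powr (- \<sigma>)"
      using False \<sigma> q_pos[of k] by (intro mult_mono q_powr_antimono_index) (auto simp: C'_def)
    finally show ?thesis .
  qed
  then show "v \<in> \<Gamma> j" unfolding Gamma_iff using \<sigma> by blast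
qed

text \<open>By definition the rate and the constant depend on the vector. Finite dimension makes
  them uniform: take the smallest rate over an orthonormal basis.\<close>

lemma Gamma_uniform:
  "\<exists>\<sigma>>0. \<exists>C>0. \<forall>u\<in>\<Gamma> 0. \<forall>l. norm (S 0 l u) \<le> C * q l powr (- \<sigma>) * norm u"
proof -
  obtain B where B: "B \<subseteq> \<Gamma> 0" "pairwise orthogonal B" "\<And>x. x \<in> B \<Longrightarrow> norm x = 1" "independent B"
      "card B = dim (\<Gamma> 0)" "span B = \<Gamma> 0"
    by (rule orthonormal_basis_subspace[OF subspace_Gamma[of 0]])
      (rule that, assumption, assumption, blast, assumption+)
  have fin: "finite B" using B(4) by (rule independent_imp_finite)
  have "\<exists>\<sigma> C. b \<in> B \<longrightarrow> \<sigma> > 0 \<and> (\<forall>l. norm (S 0 l b) \<le> C * q l powr (- \<sigma>))" for b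
  proof (cases "b \<in> B")
    case True
    then have "b \<in> \<Gamma> 0" using B(1) by blast
    then obtain \<sigma> C where "\<sigma> > 0" "\<And>l. norm (S 0 l b) \<le> C * q l powr (- \<sigma>)"
      unfolding Gamma_iff by auto
    then show ?thesis by blast
  qed simp
  then obtain \<sigma> C where C: "\<And>b. b \<in> B \<Longrightarrow> \<sigma> b > 0"
      "\<And>b l. b \<in> B \<Longrightarrow> norm (S 0 l b) \<le> C b * q l powr (- \<sigma> b)"
    by (metis (no_types, lifting))
  \<comment> \<open>The inserted 1 keeps \<open>Min\<close> defined when the stable space is
    trivial.\<close>
  define \<tau> where "\<tau> = Min (insert 1 (\<sigma> ` B))"
  have \<tau>: "\<tau> > 0" "\<And>b. b \<in> B \<Longrightarrow> \<tau> \<le> \<sigma> b" using C(1) fin by (auto simp: \<tau>_def)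
  define D where "D = (\<Sum>b\<in>B. \<bar>C b\<bar>) + 1"
  have "norm (S 0 l u) \<le> D * q l powr (- \<tau>) * norm u" if u: "u \<in> \<Gamma> 0" for u l
  proof -
    have "u = (\<Sum>b\<in>B. (u \<bullet> b) *\<^sub>R b)"
      using orthonormal_basis_expand[OF B(2) B(3) _ fin, of u] u B(6) by simp
    then have "S 0 l u = (\<Sum>b\<in>B. (u \<bullet> b) *\<^sub>R S 0 l b)"
      by (metis (no_types, lifting) S_sum linear_cmul[OF S_linear] sum.cong)
    also have "norm \<dots> \<le> (\<Sum>b\<in>B. norm u * (\<bar>C b\<bar> * q l powr (- \<tau>)))"
    proof (intro order_trans[OF norm_sum] sum_mono)
      fix b assume b: "b \<in> B"
      have "\<bar>u \<bullet> b\<bar> \<le> norm u" using Cauchy_Schwarz_ineq2[of u b] B(3)[OF b] by simp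
      moreover have "norm (S 0 l b) \<le> \<bar>C b\<bar> * q l powr (- \<tau>)"
        by (rule order_trans[OF C(2)[OF b]]) (intro mult_mono q_powr_mono, auto simp: \<tau> b)
      ultimately show "norm ((u \<bullet> b) *\<^sub>R S 0 l b) \<le> norm u * (\<bar>C b\<bar> * q l powr (- \<tau>))"
        by (simp add: mult_mono)
    qed
    also have "\<dots> = (\<Sum>b\<in>B. \<bar>C b\<bar>) * q l powr (- \<tau>) * norm u"
      by (simp add: sum_distrib_left sum_distrib_right mult_ac)
    also have "\<dots> \<le> D * q l powr (- \<tau>) * norm u"
      by (intro mult_right_mono) (auto simp: D_def)
    finally show ?thesis .
  qed
  moreover have "D > 0" unfolding D_def by (simp add: add_nonneg_pos sum_nonneg)
  ultimately show ?thesis using \<tau> by blast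
qed

text \<open>The nearest point, chosen so that the distance moved is the quotient norm that occurs in
  (c).\<close>

definition proj :: "nat \<Rightarrow> real^'a \<Rightarrow> real^'a" where "proj k = closest_point (\<Gamma> k)"

lemma proj_in: "proj k v \<in> \<Gamma> k"
  unfolding proj_def by (rule closest_point_in_set[OF Gamma_closed Gamma_nonempty])

lemma norm_minus_proj: "norm (v - proj k v) = infdist v (\<Gamma> k)"
proof (rule antisym)
  show "norm (v - proj k v) \<le> infdist v (\<Gamma> k)"
    unfolding infdist_notempty[OF Gamma_nonempty] proj_def dist_norm[symmetric]
    using closest_point_le[OF Gamma_closed] Gamma_nonempty by (intro cINF_greatest) auto
  show "infdist v (\<Gamma> k) \<le> norm (v - proj k v)"
    using infdist_le[OF proj_in] by (simp add: dist_norm)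
qed

lemma infdist_Gamma_le_norm: "infdist v (\<Gamma> k) \<le> norm v"
  using infdist_le[OF subspace_0[OF subspace_Gamma], of v k] by simp

text \<open>The direct bound from (c) keeps the decay in \<open>q j\<close> and loses little in
  \<open>q k\<close>. The bound through level 0 decays in \<open>q k\<close> at the cost of a power
  of \<open>q j\<close>. Interpolation combines both gains.\<close>

lemma Gamma_growth:
  assumes \<eta>: "\<And>j. \<eta> j \<in> \<Gamma> j" and bd: "\<And>j. norm (\<eta> j) \<le> C0 * q j powr (- \<delta>)" and \<delta>: "\<delta> > 0"
  shows "\<exists>\<tau>>0. \<exists>C. \<forall>k. norm (\<Sum>j\<le>k. S j k (\<eta> j)) \<le> C * q k powr (- \<tau>)"
proof -
  let ?D = "real CARD('a)"
  have C0: "0 \<le> C0" using order_trans[OF norm_ge_zero bd[of 0]] q_pos[of 0] by (simp add: zero_le_mult_iff)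
  obtain \<sigma> B where \<sigma>: "\<sigma> > 0" "B > 0" and B: "\<And>u l. u \<in> \<Gamma> 0 \<Longrightarrow> norm (S 0 l u) \<le> B * q l powr (- \<sigma>) * norm u"
    using Gamma_uniform by blast
  \<comment> \<open>The weight for which the exponent of \<open>q j\<close> becomes exactly
    \<open>- \<delta> / 2\<close>.\<close>
  define t where "t = \<delta> / (2 * (?D + \<delta>))"
  have t: "0 < t" "t < 1" "(1 - t) * (- \<delta>) + t * ?D = - (\<delta> / 2)"
  proof -
    show "0 < t" "t < 1" using \<delta> card_ge_2 by (auto simp: t_def)
    have "?D + \<delta> \<noteq> 0" using \<delta> card_ge_2 by simp
    then have "t * (?D + \<delta>) = \<delta> / 2" unfolding t_def times_divide_eq_left
      by (metis mult_divide_mult_cancel_right)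
    then show "(1 - t) * (- \<delta>) + t * ?D = - (\<delta> / 2)" by (simp add: algebra_simps)
  qed
  \<comment> \<open>Half of the gain \<open>t * \<sigma>\<close> in \<open>q k\<close>: (c) may use
    up that much, and the other half remains as the rate.\<close>
  define e where "e = t * \<sigma> / 2"
  have e: "e > 0" using t \<sigma> by (simp add: e_def)
  obtain A where A: "A > 0" "\<And>j k v. j \<le> k \<Longrightarrow> v \<in> \<Gamma> j \<Longrightarrow> norm (S j k v) \<le> A * q k powr e * norm v"
    using rothC e unfolding q_def by metis
  have 1: "norm (S j k (\<eta> j)) \<le> A * C0 * q k powr e * q j powr (- \<delta>)" if jk: "j \<le> k" for j k
  proof -
    have "norm (S j k (\<eta> j)) \<le> A * q k powr e * norm (\<eta> j)" by (rule A(2)[OF jk \<eta>])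
    also have "\<dots> \<le> A * q k powr e * (C0 * q j powr (- \<delta>))" using A by (intro mult_left_mono bd) auto
    finally show ?thesis by (simp add: mult_ac)
  qed
  have 2: "norm (S j k (\<eta> j)) \<le> B * Kd * C0 * q k powr (- \<sigma>) * q j powr ?D" if jk: "j \<le> k" for j k
  proof -
    obtain u where u: "S 0 j u = \<eta> j" using S_surj[of 0 j] by auto
    then have "u \<in> \<Gamma> 0" using S_Gamma_iff[of 0 j u] \<eta>[of j] by simp
    then have "norm (S 0 k u) \<le> B * q k powr (- \<sigma>) * norm u" by (rule B)
    also have "norm u \<le> Kd * q j ^ CARD('a) * norm (\<eta> j)" using norm_le_S[of u j] u by simp
    also have "\<dots> \<le> Kd * q j ^ CARD('a) * (C0 * 1)"
    proof (intro mult_left_mono)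
      have "C0 * q j powr (- \<delta>) \<le> C0 * q j powr 0" using C0 \<delta> by (intro mult_left_mono q_powr_mono) auto
      then show "norm (\<eta> j) \<le> C0 * 1" using bd[of j] q_pos[of j] by simp
    qed (use Kd_pos q_pos[of j] in auto)
    also have "\<dots> = Kd * C0 * q j powr ?D"
      using q_pos[of j] by (simp add: powr_realpow)
    finally have "norm (S 0 k u) \<le> B * q k powr (- \<sigma>) * (Kd * C0 * q j powr ?D)"
      using \<sigma> by (simp add: mult_left_mono)
    then show ?thesis using S_trans[OF _ jk, of 0 u] u by (simp add: mult_ac)
  qed
  have "(1 - t) * e \<le> 1 * e" using t e by (intro mult_right_mono) auto
  then have exps: "(1 - t) * e + t * (- \<sigma>) \<le> - e" "(1 - t) * (- \<delta>) + t * ?D \<le> - (\<delta> / 2)"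
    using t(3) by (simp_all add: e_def)
  have nonneg: "0 \<le> A * C0" "0 \<le> B * Kd * C0" "0 < \<delta> / 2" using A C0 \<sigma> Kd_pos \<delta> by simp_all
  show ?thesis
    using interpolated_sum_le[where x = "\<lambda>j k. S j k (\<eta> j)", OF t(1,2) nonneg 1 2 exps] e by blast
qed

text \<open>Let \<open>a j\<close> be the pull-back to level 0 of the error at level j. Its part b
  transverse to \<open>\<Gamma> 0\<close> is small, and v is the sum of these parts. The remainder
  \<open>E k\<close> is then close to \<open>\<Gamma> k\<close>; its projection again follows the
  cocycle up to small errors, now in the stable spaces, where sums of transported errors
  decay.\<close>

lemma exists_correction:
  fixes \<xi> :: "nat \<Rightarrow> real^'a"
  assumes \<delta>: "\<delta> > 0"
    and rec: "\<And>k. norm (\<xi> (Suc k) - S k (Suc k) (\<xi> k)) \<le> C0 * q k powr (- \<delta>)"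
  shows "\<exists>v. \<exists>\<tau>>0. \<exists>C. \<forall>k. norm (\<xi> k - S 0 k v) \<le> C * q k powr (- \<tau>)"
proof -
  define \<nu> where "\<nu> k = (case k of 0 \<Rightarrow> \<xi> 0 | Suc i \<Rightarrow> \<xi> (Suc i) - S i (Suc i) (\<xi> i))" for k
  have \<xi>: "\<xi> k = (\<Sum>j\<le>k. S j k (\<nu> j))" for k
    by (rule S_recurrence) (auto simp: \<nu>_def)
  define \<delta>1 where "\<delta>1 = \<delta> / 2"
  have \<delta>1: "\<delta>1 > 0" using \<delta> by (simp add: \<delta>1_def)
  have "norm (\<nu> (Suc j)) \<le> C0 * q j powr (- \<delta>)" for j
    using rec[of j] by (simp add: \<nu>_def)
  from q_shift_decay[of \<delta> "\<lambda>j. norm (\<nu> j)" C0, OF \<delta> this]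
  obtain C1 where "C1 > 0" "\<And>j. norm (\<nu> j) \<le> C1 * q j powr (- (\<delta> / 2))" by blast
  then have C1: "C1 > 0" "\<And>j. norm (\<nu> j) \<le> C1 * q j powr (- \<delta>1)" by (auto simp: \<delta>1_def)
  have "\<exists>v. S 0 j v = \<nu> j" for j using S_surj[of 0 j "\<nu> j"] by blast
  then have "\<exists>a. \<forall>j. S 0 j (a j) = \<nu> j" by (intro choice) blast
  then obtain a where a: "\<And>j. S 0 j (a j) = \<nu> j" by blast
  have e: "\<delta>1 / 2 > 0" using \<delta>1 by simp
  obtain A where A: "A > 0" "\<And>j k v. j \<le> k \<Longrightarrow> infdist v (\<Gamma> j) \<le> A * q k powr (\<delta>1 / 2) * infdist (S j k v) (\<Gamma> k)"
    using rothC e unfolding q_def by metis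
  define C2 where "C2 = A * C1"
  have C2: "C2 > 0" using A C1 by (simp add: C2_def)
  \<comment> \<open>The bound on the inverse in (c), applied between level k and level j, where the
    image of \<open>a j\<close> is \<open>\<nu> j\<close>.\<close>
  have near: "norm (S 0 k (a j) - proj k (S 0 k (a j))) \<le> C2 * q j powr (- (\<delta>1 / 2))" if kj: "k \<le> j" for j k
  proof -
    have "norm (S 0 k (a j) - proj k (S 0 k (a j))) \<le> A * q j powr (\<delta>1 / 2) * infdist (\<nu> j) (\<Gamma> j)"
      unfolding norm_minus_proj using A(2)[OF kj, of "S 0 k (a j)"] S_trans[OF _ kj, of 0 "a j"] a[of j] by simp
    also have "\<dots> \<le> A * q j powr (\<delta>1 / 2) * (C1 * q j powr (- \<delta>1))"
      using A by (intro mult_left_mono order_trans[OF infdist_Gamma_le_norm C1(2)]) auto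
    also have "\<dots> = C2 * (q j powr (\<delta>1 / 2) * q j powr (- \<delta>1))" by (simp add: C2_def mult_ac)
    also have "q j powr (\<delta>1 / 2) * q j powr (- \<delta>1) = q j powr (- (\<delta>1 / 2))" by (simp add: powr_add[symmetric])
    finally show ?thesis .
  qed
  define b where "b j = a j - proj 0 (a j)" for j
  have "norm (b j) \<le> C2 * q j powr (- (\<delta>1 / 2))" for j
    using near[of 0 j] by (simp add: b_def)
  then have "summable b"
    by (intro summable_comparison_test'[OF summable_mult[OF summable_q_powr[OF e]]]) auto
  define v where "v = suminf b"
  \<comment> \<open>A quarter, so that the rate \<open>\<delta>1 / 2\<close> splits into one share
    for decay in k and one for summation over j.\<close>
  define \<delta>2 where "\<delta>2 = \<delta>1 / 4"
  have \<delta>2: "\<delta>2 > 0" using \<delta>1 by (simp add: \<delta>2_def)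
  obtain C3 where C3: "C3 > 0" "\<And>A. finite A \<Longrightarrow> (\<Sum>j\<in>A. q j powr (- \<delta>2)) \<le> C3"
    using sum_q_powr_le[OF \<delta>2] by auto
  define E where "E k = \<xi> k - S 0 k v" for k
  have E_near: "norm (E k - proj k (E k)) \<le> C2 * C3 * q k powr (- \<delta>2)" for k
  proof -
    \<comment> \<open>Finite sums of b in place of v: the distance to \<open>\<Gamma> k\<close> is
      bounded uniformly in m and the bound passes to the limit.\<close>
    define E' where "E' m = \<xi> k - S 0 k (\<Sum>j<m. b j)" for m
    have "(\<lambda>m. \<Sum>j<m. b j) \<longlonglongrightarrow> v"
      unfolding v_def by (rule summable_LIMSEQ[OF \<open>summable b\<close>])
    then have "(\<lambda>m. S 0 k (\<Sum>j<m. b j)) \<longlonglongrightarrow> S 0 k v"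
      by (rule bounded_linear.tendsto[OF linear_conv_bounded_linear[THEN iffD1, OF S_linear]])
    then have "E' \<longlonglongrightarrow> E k" unfolding E'_def E_def by (intro tendsto_diff) auto
    then have "(\<lambda>m. infdist (E' m) (\<Gamma> k)) \<longlonglongrightarrow> infdist (E k) (\<Gamma> k)"
      by (intro tendsto_infdist)
    moreover have "infdist (E' m) (\<Gamma> k) \<le> C2 * C3 * q k powr (- \<delta>2)" if m: "m \<ge> Suc k" for m
    proof -
      let ?J = "{..<m} - {..k}"
      have split: "sum f {..<m} = sum f {..k} + sum f ?J" for f :: "nat \<Rightarrow> real^'a"
      proof -
        have "{..k} \<subseteq> {..<m}" using m by auto
        then show ?thesis by (subst sum.subset_diff) (simp_all add: add.commute)
      qed
      have "\<xi> k = (\<Sum>j\<le>k. S 0 k (a j))"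
        unfolding \<xi> by (intro sum.cong refl) (simp add: a[symmetric] S_trans[of 0 _ k, symmetric])
      \<comment> \<open>Up to stable vectors, the terms with \<open>j \<le> k\<close> cancel against
        \<open>\<xi> k\<close>, and those with \<open>k < j\<close> remain.\<close>
      then have E': "E' m = (\<Sum>j<m. S 0 k (proj 0 (a j))) - (\<Sum>j\<in>?J. S 0 k (a j))"
        unfolding E'_def b_def S_sum S_diff sum_subtractf using split[of "\<lambda>j. S 0 k (a j)"] by simp
      define g where "g = (\<Sum>j<m. S 0 k (proj 0 (a j))) - (\<Sum>j\<in>?J. proj k (S 0 k (a j)))"
      have "g \<in> \<Gamma> k"
        unfolding g_def by (intro subspace_diff[OF subspace_Gamma] subspace_sum[OF subspace_Gamma] proj_in)
          (simp add: S_Gamma_iff proj_in)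
      then have "infdist (E' m) (\<Gamma> k) \<le> norm (E' m - g)"
        using infdist_le[of g "\<Gamma> k" "E' m"] by (simp add: dist_norm)
      also have "E' m - g = - (\<Sum>j\<in>?J. S 0 k (a j) - proj k (S 0 k (a j)))"
        unfolding E' g_def by (simp add: sum_subtractf)
      also have "norm \<dots> \<le> (\<Sum>j\<in>?J. C2 * (q k powr (- \<delta>2) * q j powr (- \<delta>2)))"
        unfolding norm_minus_cancel
      proof (intro order_trans[OF norm_sum] sum_mono)
        fix j assume j: "j \<in> ?J"
        have "norm (S 0 k (a j) - proj k (S 0 k (a j))) \<le> C2 * q j powr (- (\<delta>1 / 2))"
          using j by (intro near) auto
        also have "q j powr (- (\<delta>1 / 2)) = q j powr (- \<delta>2) * q j powr (- \<delta>2)"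
          by (simp add: powr_add[symmetric] \<delta>2_def)
        also have "C2 * (q j powr (- \<delta>2) * q j powr (- \<delta>2)) \<le> C2 * (q k powr (- \<delta>2) * q j powr (- \<delta>2))"
          using C2 j \<delta>2 by (intro mult_left_mono mult_right_mono q_powr_antimono_index) auto
        finally show "norm (S 0 k (a j) - proj k (S 0 k (a j))) \<le> C2 * (q k powr (- \<delta>2) * q j powr (- \<delta>2))" .
      qed
      also have "\<dots> = C2 * q k powr (- \<delta>2) * (\<Sum>j\<in>?J. q j powr (- \<delta>2))"
        by (simp add: sum_distrib_left mult_ac)
      also have "\<dots> \<le> C2 * q k powr (- \<delta>2) * C3" using C2 by (intro mult_left_mono C3) auto
      finally show ?thesis by (simp add: mult_ac)
    qed
    ultimately show ?thesis
      unfolding norm_minus_proj by (intro LIMSEQ_le_const2) auto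
  qed
  define g w where "g k = proj k (E k)" and "w k = E k - g k" for k
  define C4 where "C4 = C2 * C3"
  have C4: "C4 > 0" using C2 C3 by (simp add: C4_def)
  have w: "norm (w k) \<le> C4 * q k powr (- \<delta>2)" for k
    using E_near[of k] by (simp add: w_def g_def C4_def)
  define \<eta> where "\<eta> k = (case k of 0 \<Rightarrow> g 0 | Suc i \<Rightarrow> g (Suc i) - S i (Suc i) (g i))" for k
  have g: "g k = (\<Sum>j\<le>k. S j k (\<eta> j))" for k
    by (rule S_recurrence) (auto simp: \<eta>_def)
  have \<eta>_in: "\<eta> j \<in> \<Gamma> j" for j
    by (cases j) (auto simp: \<eta>_def g_def proj_in S_Gamma_iff intro!: subspace_diff[OF subspace_Gamma])
  have e2: "\<delta>2 / 2 > 0" using \<delta>2 by simp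
  obtain B where B: "B > 0" "\<And>k. mnorm (Qmat s k (Suc k)) \<le> B * q k powr (\<delta>2 / 2)"
    using block_le[OF e2] by blast
  have "norm (\<eta> (Suc k)) \<le> (\<bar>C0\<bar> + C4 + B * C4) * q k powr (- (\<delta>2 / 2))" for k
  proof -
    \<comment> \<open>Subtracting an exact orbit of the cocycle does not change the errors of the
      recursion.\<close>
    have "E (Suc k) - S k (Suc k) (E k) = \<xi> (Suc k) - S k (Suc k) (\<xi> k)"
      by (simp add: E_def S_diff S_trans[of 0 k "Suc k", symmetric])
    then have "\<eta> (Suc k) = (\<xi> (Suc k) - S k (Suc k) (\<xi> k)) - w (Suc k) + S k (Suc k) (w k)"
      by (simp add: \<eta>_def w_def S_diff algebra_simps)
    then have "norm (\<eta> (Suc k)) \<le> norm (\<xi> (Suc k) - S k (Suc k) (\<xi> k)) + norm (w (Suc k)) + norm (S k (Suc k) (w k))"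
      by (metis (no_types, lifting) add_right_mono norm_triangle_ineq norm_triangle_ineq4 order_trans)
    moreover have "norm (\<xi> (Suc k) - S k (Suc k) (\<xi> k)) \<le> \<bar>C0\<bar> * q k powr (- (\<delta>2 / 2))"
      by (rule order_trans[OF rec]) (intro mult_mono q_powr_mono, auto simp: \<delta>2_def \<delta>1_def \<delta> less_imp_le)
    moreover have "norm (w (Suc k)) \<le> C4 * q k powr (- (\<delta>2 / 2))"
    proof -
      have "norm (w (Suc k)) \<le> C4 * q k powr (- \<delta>2)"
        by (rule order_trans[OF w]) (use C4 \<delta>2 in \<open>intro mult_left_mono q_powr_antimono_index, auto\<close>)
      also have "\<dots> \<le> C4 * q k powr (- (\<delta>2 / 2))" using C4 \<delta>2 by (intro mult_left_mono q_powr_mono) auto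
      finally show ?thesis .
    qed
    moreover have "norm (S k (Suc k) (w k)) \<le> B * C4 * q k powr (- (\<delta>2 / 2))"
    proof -
      have "norm (S k (Suc k) (w k)) \<le> mnorm (Qmat s k (Suc k)) * norm (w k)" by (rule norm_S_le)
      also have "\<dots> \<le> (B * q k powr (\<delta>2 / 2)) * (C4 * q k powr (- \<delta>2))"
        using B by (intro mult_mono B w) auto
      also have "\<dots> = B * C4 * (q k powr (\<delta>2 / 2) * q k powr (- \<delta>2))" by (simp add: mult_ac)
      also have "q k powr (\<delta>2 / 2) * q k powr (- \<delta>2) = q k powr (- (\<delta>2 / 2))"
        by (simp add: powr_add[symmetric])
      finally show ?thesis .
    qed
    ultimately show ?thesis by (simp add: distrib_right)
  qed
  then obtain C5 where "C5 > 0" "\<And>k. norm (\<eta> k) \<le> C5 * q k powr (- (\<delta>2 / 2 / 2))"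
    using q_shift_decay[OF e2, of "\<lambda>j. norm (\<eta> j)"] by blast
  then obtain \<tau> C6 where C6: "\<tau> > 0" "\<And>k. norm (g k) \<le> C6 * q k powr (- \<tau>)"
    unfolding g using Gamma_growth[OF \<eta>_in, of C5 "\<delta>2 / 2 / 2"] \<delta>2 by auto
  have "norm (\<xi> k - S 0 k v) \<le> (\<bar>C6\<bar> + C4) * q k powr (- min \<tau> \<delta>2)" for k
  proof -
    have "\<xi> k - S 0 k v = g k + w k" by (simp add: w_def E_def)
    moreover have "norm (g k) \<le> \<bar>C6\<bar> * q k powr (- min \<tau> \<delta>2)"
      by (rule order_trans[OF C6(2)]) (intro mult_mono q_powr_mono, auto)
    moreover have "norm (w k) \<le> C4 * q k powr (- min \<tau> \<delta>2)"
      by (rule order_trans[OF w]) (use C4 in \<open>intro mult_left_mono q_powr_mono, auto\<close>)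
    ultimately show ?thesis
      using norm_triangle_ineq[of "g k" "w k"] by (simp add: distrib_right)
  qed
  then show ?thesis using C6(1) \<delta>2 by (metis min_less_iff_conj)
qed

end

section \<open>Bounded Birkhoff sums\<close>

text \<open>Each step adds the winner's column, whose diagonal entry is at least 1, to another
  column. Hence a block has no more steps than the norm of its matrix, which (a) bounds by a small
  power of q.\<close>

lemma rv_prod_steps_le:
  assumes "m \<le> n"
  shows "real (n - m) \<le> mnorm (rv_prod s m n)"
  using assms
proof (induction n rule: dec_induct)
  case base
  show ?case using mnorm_nonneg by simp
next
  case (step n)
  let ?P = "rv_prod s m n" and ?w = "winner (rv_state s n)" and ?u = "loser (rv_state s n)"
  have nn: "0 \<le> ?P $ i $ j" for i j by (rule rv_prod_nonneg[OF step(1)])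
  have "1 \<le> (\<Sum>i\<in>UNIV. ?P $ i $ ?w)"
    using member_le_sum[of ?w UNIV "\<lambda>i. ?P $ i $ ?w"] nn rv_prod_diag[OF step(1), of s ?w] by simp
  moreover have "mnorm (rv_prod s m (Suc n)) = (\<Sum>i\<in>UNIV. \<Sum>j\<in>UNIV. ?P $ i $ j + (if j = ?u then ?P $ i $ ?w else 0))"
    unfolding mnorm_def using nn
    by (intro sum.cong refl) (simp add: rv_prod_Suc_nth[OF step(1)])
  moreover have "mnorm ?P = (\<Sum>i\<in>UNIV. \<Sum>j\<in>UNIV. ?P $ i $ j)"
    unfolding mnorm_def using nn by (intro sum.cong refl) simp
  ultimately have "mnorm ?P + 1 \<le> mnorm (rv_prod s m (Suc n))"
    by (simp add: sum.distrib)
  then show ?case using step by (simp add: Suc_diff_le)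
qed

lemma sbs_diff: "sbs s (\<lambda>a x. F a x - H a x) n a x = sbs s F n a x - sbs s H n a x"
  by (induction n arbitrary: a x) (auto simp: up_def)

lemma sbs_const:
  assumes k: "keane_iem s" and x: "0 \<le> x" "x < lens (rv_state s n) a"
  shows "sbs s (\<lambda>a _. c a) n a x = (\<Sum>i\<in>UNIV. rv_prod s 0 n $ i $ a * c i)"
  using sbs_approx[where c = c and b = "\<lambda>_. 0" and m = 0 and F = "\<lambda>a _. c a", OF k _ _ x] by simp

lemma norm_le_card_component:
  fixes v :: "real^'n" and B :: real
  assumes "\<And>i. \<bar>v $ i\<bar> \<le> B"
  shows "norm v \<le> CARD('n) * B"
proof -
  have "norm v \<le> (\<Sum>i\<in>UNIV. \<bar>v $ i\<bar>)" by (rule norm_le_l1_cart)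
  also have "\<dots> \<le> (\<Sum>i\<in>(UNIV::'n set). B)" by (intro sum_mono assms)
  finally show ?thesis by simp
qed

context keane_data
begin

lemma len_pos: "0 < len k a"
  using keane_iemD(3)[OF keane_iem_rv_state[OF keane]] by blast

lemma sbs_block_approx:
  assumes F: "\<And>a x. 0 \<le> x \<Longrightarrow> x < len k a \<Longrightarrow> \<bar>sbs s F (nacc s k) a x - \<xi> $ a\<bar> \<le> B"
    and x: "0 \<le> x" "x < len (Suc k) a"
  shows "\<bar>sbs s F (nacc s (Suc k)) a x - S k (Suc k) \<xi> $ a\<bar> \<le> mnorm (Qmat s k (Suc k)) * B"
  unfolding S_nth Qmat_eq[OF keane le_SucI[OF order_refl]]
  by (rule sbs_approx_mnorm[OF keane nacc_mono[OF le_SucI[OF order_refl]] F x])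

end

context roth_data
begin

lemma mean_growth:
  assumes dom: "dominates (lens s) h G M"
    and int: "\<And>a. G a integrable_on {0..lens s a}"
    and zero: "(\<Sum>a\<in>UNIV. integral {0..lens s a} (G a)) = 0"
  shows "\<exists>\<delta>>0. \<exists>C>0. \<forall>k a x. 0 \<le> x \<longrightarrow> x < len k a \<longrightarrow> \<bar>sbs s G (nacc s k) a x\<bar> \<le> C * q k powr (1 - \<delta>)"
proof -
  let ?G = "\<lambda>k. sbs s G (nacc s k)"
  have osc: "\<bar>?G k a y - ?G k a x\<bar> \<le> M" if "0 \<le> x" "x < len k a" "0 \<le> y" "y < len k a" for k a x y
    using dominates_osc[OF dominates_sbs[OF keane dom] _ that] len_pos by blast
  have M: "0 \<le> M" using osc[of 0 0 _ 0] len_pos by (metis abs_ge_zero order_refl order_trans)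
  have Gint: "?G k a integrable_on {0..len k a}" for k a
    using integral_sbs[of s G, OF keane int] by blast
  have Gzero: "(\<Sum>a\<in>UNIV. integral {0..len k a} (?G k a)) = 0" for k
    using integral_sbs[of s G, OF keane int] zero by simp
  define \<xi> :: "nat \<Rightarrow> real^'a" where "\<xi> k = vec_lambda (\<lambda>a. integral {0..len k a} (?G k a) / len k a)" for k
  have near: "\<bar>?G k a x - \<xi> k $ a\<bar> \<le> M" if x: "0 \<le> x" "x < len k a" for k a x
  proof -
    let ?l = "len k a"
    have "((\<lambda>t. ?G k a t - ?G k a x) has_integral integral {0..?l} (?G k a) - ?G k a x * ?l) {0..?l}"
      using has_integral_diff[OF integrable_integral[OF Gint[of k a]] has_integral_const_real[of "?G k a x" 0 ?l]]
        len_pos[of k a] by (simp add: mult.commute)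
    from has_integral_bound_real[OF M _ this, of "{?l}"]
    have "\<bar>integral {0..?l} (?G k a) - ?G k a x * ?l\<bar> \<le> M * ?l"
      using osc[OF x] len_pos[of k a] by auto
    moreover have "integral {0..?l} (?G k a) = \<xi> k $ a * ?l" using len_pos[of k a] by (simp add: \<xi>_def)
    ultimately have "\<bar>(\<xi> k $ a - ?G k a x) * ?l\<bar> \<le> M * ?l"
      by (simp only: left_diff_distrib)
    then have "\<bar>\<xi> k $ a - ?G k a x\<bar> * ?l \<le> M * ?l"
      using len_pos[of k a] by (simp only: abs_mult abs_of_pos)
    then show ?thesis
      using len_pos[of k a] by (simp only: mult_le_cancel_right_pos abs_minus_commute)
  qed
  have zm: "(\<Sum>a\<in>UNIV. len k a * \<xi> k $ a) = 0" for k
  proof -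
    have "len k a * \<xi> k $ a = integral {0..len k a} (?G k a)" for a
      using len_pos[of k a] by (simp add: \<xi>_def)
    then show ?thesis using Gzero by simp
  qed
  have rec: "norm (\<xi> (Suc k) - S k (Suc k) (\<xi> k)) \<le> (2 * CARD('a) * M) * mnorm (Qmat s k (Suc k))" for k
  proof -
    let ?m = "mnorm (Qmat s k (Suc k))"
    have m: "1 \<le> ?m" by (rule mnorm_Qmat_ge_1) simp
    have "\<bar>(\<xi> (Suc k) - S k (Suc k) (\<xi> k)) $ a\<bar> \<le> 2 * (?m * M)" for a
    proof -
      have "\<bar>?G (Suc k) a 0 - S k (Suc k) (\<xi> k) $ a\<bar> \<le> ?m * M"
        by (rule sbs_block_approx[OF near]) (auto simp: len_pos simp del: nacc.simps)
      moreover have "\<bar>?G (Suc k) a 0 - \<xi> (Suc k) $ a\<bar> \<le> M" by (rule near) (auto simp: len_pos simp del: nacc.simps)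
      moreover have "M \<le> ?m * M" using mult_right_mono[OF m M] by simp
      ultimately show ?thesis unfolding vector_minus_component by linarith
    qed
    from norm_le_card_component[OF this] show ?thesis by (simp add: mult_ac)
  qed
  obtain \<delta> C where \<delta>: "\<delta> > 0" "C > 0" and C: "\<And>k. norm (\<xi> k) \<le> C * q k powr (1 - \<delta>)"
    using zero_mean_growth[OF zm rec] by blast
  \<comment> \<open>The minimum keeps the exponent nonnegative, so that the constant M can be
    absorbed.\<close>
  have "\<bar>?G k a x\<bar> \<le> (M + C) * q k powr (1 - min \<delta> 1)" if x: "0 \<le> x" "x < len k a" for k a x
  proof -
    have "\<bar>\<xi> k $ a\<bar> \<le> C * q k powr (1 - \<delta>)" using component_le_norm_cart[of "\<xi> k" a] C[of k] by simp
    also have "\<dots> \<le> C * q k powr (1 - min \<delta> 1)" using \<delta> by (intro mult_left_mono q_powr_mono) auto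
    finally have "\<bar>\<xi> k $ a\<bar> \<le> C * q k powr (1 - min \<delta> 1)" .
    moreover have "M * 1 \<le> M * q k powr (1 - min \<delta> 1)" using M by (intro mult_left_mono q_powr_ge_1) auto
    ultimately show ?thesis using near[OF x] by (simp add: distrib_right)
  qed
  moreover have "min \<delta> 1 > 0" "M + C > 0" using \<delta> M by auto
  ultimately show ?thesis by blast
qed

lemma primitive_correction:
  assumes prim: "primitive_on (lens s) F G"
    and dom: "dominates (lens s) h G M"
    and int: "\<And>a. G a integrable_on {0..lens s a}"
    and zero: "(\<Sum>a\<in>UNIV. integral {0..lens s a} (G a)) = 0"
  shows "\<exists>v::real^'a. \<exists>\<mu>>0. \<exists>C>0. \<forall>k a x. 0 \<le> x \<longrightarrow> x < len k a \<longrightarrow>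
     \<bar>sbs s (\<lambda>a t. F a t - v $ a) (nacc s k) a x\<bar> \<le> C * q k powr (- \<mu>)"
proof -
  let ?F = "\<lambda>k. sbs s F (nacc s k)"
  obtain \<delta> C where \<delta>: "\<delta> > 0" "C > 0"
    and C: "\<And>k a x. 0 \<le> x \<Longrightarrow> x < len k a \<Longrightarrow> \<bar>sbs s G (nacc s k) a x\<bar> \<le> C * q k powr (1 - \<delta>)"
    using mean_growth[OF dom int zero] by blast
  \<comment> \<open>Half of the gain in the derivative pays for the small power lost in the lengths
    of the intervals; the other half survives.\<close>
  define \<delta>2 where "\<delta>2 = \<delta> / 2"
  have \<delta>2: "\<delta>2 > 0" using \<delta> by (simp add: \<delta>2_def)
  obtain L where L: "L > 0" "\<And>k b. len k b \<le> L * q k powr (\<delta>2 - 1)" using len_powr[OF \<delta>2] by blast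
  define \<xi> :: "nat \<Rightarrow> real^'a" where "\<xi> k = vec_lambda (\<lambda>a. ?F k a 0)" for k
  have CL: "C * L > 0" using \<delta> L by simp
  have near: "\<bar>?F k a x - \<xi> k $ a\<bar> \<le> C * L * q k powr (- \<delta>2)" if x: "0 \<le> x" "x < len k a" for k a x
  proof -
    have "(sbs s G (nacc s k) a has_integral ?F k a x - ?F k a 0) {0..x}"
      using primitive_on_sbs[OF keane prim, of "nacc s k"] x unfolding primitive_on_def by blast
    from has_integral_bound_real[OF _ _ this, of "C * q k powr (1 - \<delta>)" "{}"]
    have "\<bar>?F k a x - ?F k a 0\<bar> \<le> C * q k powr (1 - \<delta>) * x"
      using C x \<delta> by auto
    also have "\<dots> \<le> C * q k powr (1 - \<delta>) * (L * q k powr (\<delta>2 - 1))"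
      using x \<delta> L(2)[of k a] by (intro mult_left_mono) auto
    also have "\<dots> = C * L * (q k powr (1 - \<delta>) * q k powr (\<delta>2 - 1))" by (simp add: mult_ac)
    also have "q k powr (1 - \<delta>) * q k powr (\<delta>2 - 1) = q k powr (- \<delta>2)"
      by (simp add: powr_add[symmetric] \<delta>2_def)
    finally show ?thesis by (simp add: \<xi>_def)
  qed
  have e: "\<delta>2 / 2 > 0" using \<delta>2 by simp
  obtain B where B: "B > 0" "\<And>k. mnorm (Qmat s k (Suc k)) \<le> B * q k powr (\<delta>2 / 2)"
    using block_le[OF e] by blast
  \<comment> \<open>The norm of one block is allowed to consume half of the rate
    \<open>\<delta>2\<close>.\<close>
  have rec: "norm (\<xi> (Suc k) - S k (Suc k) (\<xi> k)) \<le> (CARD('a) * (B * (C * L))) * q k powr (- (\<delta>2 / 2))" for k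
  proof -
    have "\<bar>(\<xi> (Suc k) - S k (Suc k) (\<xi> k)) $ a\<bar> \<le> B * (C * L) * q k powr (- (\<delta>2 / 2))" for a
    proof -
      have "\<bar>?F (Suc k) a 0 - S k (Suc k) (\<xi> k) $ a\<bar> \<le> mnorm (Qmat s k (Suc k)) * (C * L * q k powr (- \<delta>2))"
        by (rule sbs_block_approx[OF near]) (auto simp: len_pos simp del: nacc.simps)
      also have "\<dots> \<le> (B * q k powr (\<delta>2 / 2)) * (C * L * q k powr (- \<delta>2))"
        using CL by (intro mult_right_mono B) auto
      also have "\<dots> = B * (C * L) * (q k powr (\<delta>2 / 2) * q k powr (- \<delta>2))" by (simp add: mult_ac)
      also have "q k powr (\<delta>2 / 2) * q k powr (- \<delta>2) = q k powr (- (\<delta>2 / 2))" by (simp add: powr_add[symmetric])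
      finally show ?thesis by (simp add: \<xi>_def)
    qed
    from norm_le_card_component[OF this] show ?thesis by (simp add: mult_ac)
  qed
  obtain v \<tau> D where \<tau>: "\<tau> > 0" and D: "\<And>k. norm (\<xi> k - S 0 k v) \<le> D * q k powr (- \<tau>)"
    using exists_correction[OF e rec] by blast
  define \<mu> where "\<mu> = min \<delta>2 \<tau>"
  have "\<bar>sbs s (\<lambda>a t. F a t - v $ a) (nacc s k) a x\<bar> \<le> (C * L + \<bar>D\<bar>) * q k powr (- \<mu>)"
    if x: "0 \<le> x" "x < len k a" for k a x
  proof -
    have "sbs s (\<lambda>a t. F a t - v $ a) (nacc s k) a x = ?F k a x - S 0 k v $ a"
      using sbs_const[OF keane x, of "\<lambda>a. v $ a"] Qmat_eq[OF keane, of 0 k]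
      by (simp add: sbs_diff S_nth)
    also have "\<dots> = (?F k a x - \<xi> k $ a) + (\<xi> k - S 0 k v) $ a" by simp
    finally have "\<bar>sbs s (\<lambda>a t. F a t - v $ a) (nacc s k) a x\<bar>
        \<le> \<bar>?F k a x - \<xi> k $ a\<bar> + \<bar>(\<xi> k - S 0 k v) $ a\<bar>" by linarith
    moreover have "\<bar>?F k a x - \<xi> k $ a\<bar> \<le> C * L * q k powr (- \<mu>)"
      by (rule order_trans[OF near[OF x]]) (use CL in \<open>intro mult_left_mono q_powr_mono, auto simp: \<mu>_def\<close>)
    moreover have "\<bar>(\<xi> k - S 0 k v) $ a\<bar> \<le> \<bar>D\<bar> * q k powr (- \<mu>)"
      by (rule order_trans[OF component_le_norm_cart], rule order_trans[OF D])
         (intro mult_mono q_powr_mono, auto simp: \<mu>_def)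
    ultimately show ?thesis by (simp add: distrib_right)
  qed
  moreover have "\<mu> > 0" "C * L + \<bar>D\<bar> > 0" using \<tau> \<delta>2 CL by (auto simp: \<mu>_def)
  ultimately show ?thesis by blast
qed

lemma bounded_birkhoff:
  assumes \<mu>: "\<mu> > 0" and C: "C > 0"
    and f: "\<And>k a x. 0 \<le> x \<Longrightarrow> x < len k a \<Longrightarrow> \<bar>sbs s f (nacc s k) a x\<bar> \<le> C * q k powr (- \<mu>)"
  shows "\<exists>B. \<forall>x\<in>range_of s. \<forall>N. \<bar>birk (T_of s) (glue_of s f) x N\<bar> \<le> B"
proof -
  \<comment> \<open>Bounds the special sums at every step inside block k and not only at its ends,
    because the descent of a Birkhoff sum passes through each of them.\<close>
  define Bk where "Bk k = mnorm (Qmat s k (Suc k)) * (C * q k powr (- \<mu>))" for k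
  define blk where "blk j = (LEAST k. j < nacc s (Suc k))" for j
  have blk_eq: "blk j = k" if "nacc s k \<le> j" "j < nacc s (Suc k)" for j k
    unfolding blk_def
  proof (rule Least_equality)
    show "j < nacc s (Suc k)" by (rule that(2))
    fix k' assume "j < nacc s (Suc k')"
    then have "nacc s k < nacc s (Suc k')" using that by simp
    then show "k \<le> k'" using strict_mono_nacc[OF keane] by (simp add: strict_mono_less del: nacc.simps)
  qed
  have ex_blk: "\<exists>k. nacc s k \<le> j \<and> j < nacc s (Suc k)" for j
  proof (induction j)
    case 0
    show ?case using nacc_Suc_bounds(1)[OF keane, of 0] by (intro exI[of _ 0]) auto
  next
    case (Suc j)
    then obtain k where k: "nacc s k \<le> j" "j < nacc s (Suc k)" by blast
    show ?case
    proof (cases "Suc j < nacc s (Suc k)")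
      case True
      then show ?thesis using k by (intro exI[of _ k]) auto
    next
      case False
      then have "Suc j = nacc s (Suc k)" using k by simp
      then show ?thesis using nacc_Suc_bounds(1)[OF keane, of "Suc k"]
        by (intro exI[of _ "Suc k"]) (simp del: nacc.simps)
    qed
  qed
  have sup: "\<bar>sbs s f j a t\<bar> \<le> Bk (blk j)" if t: "0 \<le> t" "t < lens (rv_state s j) a" for j a t
  proof -
    obtain k where k: "nacc s k \<le> j" "j < nacc s (Suc k)" using ex_blk by blast
    have "\<bar>sbs s f j a t\<bar> \<le> mnorm (rv_prod s (nacc s k) j) * (C * q k powr (- \<mu>))"
      using sbs_approx_mnorm[where c = "\<lambda>_. 0", OF keane k(1) _ t] f by simp
    also have "\<dots> \<le> mnorm (Qmat s k (Suc k)) * (C * q k powr (- \<mu>))"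
    proof (intro mult_right_mono)
      have "\<bar>rv_prod s (nacc s k) j $ i $ b\<bar> \<le> \<bar>rv_prod s (nacc s k) (nacc s (Suc k)) $ i $ b\<bar>" for i b
        using rv_prod_mono[OF k(1), of "nacc s (Suc k)" s i b] rv_prod_nonneg[OF k(1), of s i b] k by linarith
      then show "mnorm (rv_prod s (nacc s k) j) \<le> mnorm (Qmat s k (Suc k))"
        unfolding mnorm_def Qmat_eq[OF keane le_SucI[OF order_refl]] by (intro sum_mono)
    qed (use C in auto)
    also have "\<dots> = Bk (blk j)" by (simp only: Bk_def blk_eq[OF k])
    finally show ?thesis .
  qed
  have e: "\<mu> / 4 > 0" using \<mu> by simp
  obtain A where A: "A > 0" "\<And>k. mnorm (Qmat s k (Suc k)) \<le> A * q k powr (\<mu> / 4)"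
    using block_le[OF e] by blast
  have e2: "\<mu> / 2 > 0" using \<mu> by simp
  obtain D where D: "D > 0" "\<And>I. finite I \<Longrightarrow> (\<Sum>k\<in>I. q k powr (- (\<mu> / 2))) \<le> D"
    using sum_q_powr_le[OF e2] by blast
  \<comment> \<open>The norm of a block enters twice, through \<open>Bk\<close> and through the
    number of its steps. With exponent \<open>\<mu> / 4\<close> in (a) this costs half of the
    rate.\<close>
  have sum_le: "(\<Sum>j<nacc s K. 2 * Bk (blk j)) \<le> 2 * A^2 * C * (\<Sum>k<K. q k powr (- (\<mu> / 2)))" for K
  proof (induction K)
    case (Suc K)
    let ?m = "mnorm (Qmat s K (Suc K))"
    have m: "0 \<le> ?m" by (rule mnorm_nonneg)
    have le: "nacc s K \<le> nacc s (Suc K)" by (rule nacc_mono) simp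
    have "(\<Sum>j<nacc s (Suc K). 2 * Bk (blk j))
       = (\<Sum>j<nacc s K. 2 * Bk (blk j)) + (\<Sum>j\<in>{nacc s K..<nacc s (Suc K)}. 2 * Bk (blk j))"
      unfolding lessThan_atLeast0 by (rule sum.atLeastLessThan_concat[symmetric]) (use le in auto)
    also have "(\<Sum>j\<in>{nacc s K..<nacc s (Suc K)}. 2 * Bk (blk j)) = (\<Sum>j\<in>{nacc s K..<nacc s (Suc K)}. 2 * Bk K)"
    proof (intro sum.cong refl)
      fix j assume "j \<in> {nacc s K..<nacc s (Suc K)}"
      then have "blk j = K" by (intro blk_eq) (auto simp del: nacc.simps)
      then show "2 * Bk (blk j) = 2 * Bk K" by simp
    qed
    also have "\<dots> = real (nacc s (Suc K) - nacc s K) * (2 * Bk K)" by (simp del: nacc.simps)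
    also have "\<dots> \<le> ?m * (2 * Bk K)"
      using rv_prod_steps_le[OF le, of s] m C unfolding Qmat_eq[OF keane le_SucI[OF order_refl], symmetric]
      by (intro mult_right_mono) (auto simp: Bk_def)
    also have "\<dots> = 2 * C * (?m * ?m) * q K powr (- \<mu>)" by (simp add: Bk_def mult_ac)
    also have "\<dots> \<le> 2 * C * ((A * q K powr (\<mu> / 4)) * (A * q K powr (\<mu> / 4))) * q K powr (- \<mu>)"
      using A m C by (intro mult_right_mono mult_left_mono mult_mono) auto
    also have "\<dots> = 2 * A^2 * C * (q K powr (\<mu> / 4) * q K powr (\<mu> / 4) * q K powr (- \<mu>))"
      by (simp add: power2_eq_square mult_ac)
    also have "q K powr (\<mu> / 4) * q K powr (\<mu> / 4) * q K powr (- \<mu>) = q K powr (- (\<mu> / 2))"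
      by (simp add: powr_add[symmetric])
    finally show ?case using Suc by (simp add: distrib_left del: nacc.simps)
  qed simp
  have "\<bar>birk (T_of s) (glue_of s f) x N\<bar> \<le> 2 * A^2 * C * D" if x: "x \<in> range_of s" for x N
  proof -
    obtain k where k: "real N < q k" using q_unbounded by blast
    \<comment> \<open>At this level every return time exceeds N, so no complete return fits into N
      steps.\<close>
    define K where "K = k + 4 * CARD('a)"
    let ?s = "rv_state s (nacc s K)" and ?one = "sbs s (\<lambda>_ _. 1) (nacc s K)"
    note kK = keane_iem_rv_state[OF keane, of "nacc s K"]
    obtain x' N' where x': "x' \<in> range_of ?s"
      and le: "birk (T_of ?s) (glue_of ?s ?one) x' N' \<le> real N"
      and bd: "\<And>F B. (\<forall>j<nacc s K. \<forall>a t. 0 \<le> t \<longrightarrow> t < lens (rv_state s j) a \<longrightarrow> \<bar>sbs s F j a t\<bar> \<le> B j) \<longrightarrow>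
         \<bar>birk (T_of s) (glue_of s F) x N - birk (T_of ?s) (glue_of ?s (sbs s F (nacc s K))) x' N'\<bar>
         \<le> (\<Sum>j<nacc s K. 2 * B j)"
      using birk_descend[OF keane x, of "nacc s K" N] by blast
    have one: "real N < glue_of ?s ?one y" if y: "y \<in> range_of ?s" for y
    proof -
      obtain a t where t: "0 \<le> t" "t < lens ?s a" "y = ltop ?s a + t"
        using exists_coord[OF keane_iemD(4)[OF kK], of y "lens ?s"] y by (metis atLeastLessThan_iff)
      have "glue_of ?s ?one y = colsum K a"
        using glue_of_coord[OF kK t(1,2)] sbs_const[OF keane t(1,2), of "\<lambda>_. 1"] Qmat_eq[OF keane, of 0 K]
        by (simp add: t(3) colsum_def)
      then show ?thesis using k colsum_ge_q[of k a] by (simp add: K_def)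
    qed
    have "N' = 0"
    proof (rule ccontr)
      assume "N' \<noteq> 0"
      then obtain N'' where N'': "N' = Suc N''" by (cases N') auto
      have "(T_of ?s ^^ i) x' \<in> range_of ?s" for i
        by (induction i) (use x' T_of_in_range[OF kK] in auto)
      then have "0 \<le> glue_of ?s ?one ((T_of ?s ^^ i) x')" for i
        using one[of "(T_of ?s ^^ i) x'"] by (smt (verit) of_nat_0_le_iff)
      then have "glue_of ?s ?one ((T_of ?s ^^ 0) x') \<le> birk (T_of ?s) (glue_of ?s ?one) x' N'"
        unfolding birk_def by (intro member_le_sum) (auto simp: N'')
      then show False using one[OF x'] le by simp
    qed
    then have "\<bar>birk (T_of s) (glue_of s f) x N\<bar> \<le> (\<Sum>j<nacc s K. 2 * Bk (blk j))"
      using bd[of f "\<lambda>j. Bk (blk j)"] sup by simp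
    also have "\<dots> \<le> 2 * A^2 * C * (\<Sum>k<K. q k powr (- (\<mu> / 2)))" by (rule sum_le)
    also have "\<dots> \<le> 2 * A^2 * C * D" using C by (intro mult_left_mono D) auto
    finally show ?thesis .
  qed
  then show ?thesis by blast
qed

end

section \<open>Conclusion\<close>

lemma integrable_on_Ico_iff:
  fixes f :: "real \<Rightarrow> real"
  shows "f integrable_on {a..<b} \<longleftrightarrow> f integrable_on {a..b}"
    and "integral {a..<b} f = integral {a..b} f"
proof -
  have "{a..<b} - {a..b} \<union> ({a..b} - {a..<b}) \<subseteq> {b}" by auto
  then have n: "negligible ({a..<b} - {a..b} \<union> ({a..b} - {a..<b}))"
    by (rule negligible_subset[OF negligible_sing])
  show "f integrable_on {a..<b} \<longleftrightarrow> f integrable_on {a..b}"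
    by (rule integrable_spike_set_eq[OF n])
  show "integral {a..<b} f = integral {a..b} f"
    by (rule integral_subset_negligible) (auto intro: negligible_subset[OF negligible_sing[of b]])
qed

text \<open>A sum of length \<open>N + 1\<close> at x is \<open>f x\<close> plus one of length N at
  \<open>T x\<close>, and the upper limit does not see the shift. It is taken in the extended reals,
  where it always exists, and the bound B makes it finite.\<close>

lemma bounded_partial_sums_coboundary:
  fixes T :: "'b \<Rightarrow> 'b" and f :: "'b \<Rightarrow> real"
  assumes T: "\<And>x. x \<in> X \<Longrightarrow> T x \<in> X"
    and bd: "\<And>x N. x \<in> X \<Longrightarrow> \<bar>\<Sum>i<N. f ((T ^^ i) x)\<bar> \<le> B"
  shows "\<exists>\<Psi>. (\<forall>x\<in>X. \<bar>\<Psi> x\<bar> \<le> B \<and> \<Psi> x - \<Psi> (T x) = f x)"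
proof -
  define u where "u x N = ereal (\<Sum>i<N. f ((T ^^ i) x))" for x N
  define L where "L x = limsup (u x)" for x
  have u: "ereal (- B) \<le> u x N" "u x N \<le> ereal B" if "x \<in> X" for x N
    using bd[OF that, of N] by (auto simp: u_def abs_le_iff)
  have L: "ereal (- B) \<le> L x" "L x \<le> ereal B" if "x \<in> X" for x
  proof -
    show "L x \<le> ereal B" unfolding L_def by (rule Limsup_bounded) (simp add: u that)
    have "ereal (- B) \<le> liminf (u x)" by (rule Liminf_bounded) (simp only: u that eventually_True)
    also have "\<dots> \<le> L x" unfolding L_def by (rule Liminf_le_Limsup) simp
    finally show "ereal (- B) \<le> L x" .
  qed
  have Lr: "L x = ereal (real_of_ereal (L x))" if "x \<in> X" for x
    using L[OF that] by (cases "L x") auto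
  have step: "L x = ereal (f x) + L (T x)" if "x \<in> X" for x
  proof -
    have "u x (N + 1) = ereal (f x) + u (T x) N" for N
      unfolding u_def Suc_eq_plus1[symmetric]
      by (subst sum.lessThan_Suc_shift) (simp add: funpow_Suc_right del: funpow.simps)
    then have "L x = limsup (\<lambda>N. ereal (f x) + u (T x) N)"
      unfolding L_def using limsup_shift[of "u x"] by simp
    also have "\<dots> = ereal (f x) + L (T x)"
      unfolding L_def by (rule Limsup_add_ereal_left) auto
    finally show ?thesis .
  qed
  show ?thesis
  proof (intro exI[of _ "\<lambda>x. real_of_ereal (L x)"] ballI conjI)
    fix x assume x: "x \<in> X"
    have "- B \<le> real_of_ereal (L x)" "real_of_ereal (L x) \<le> B"
      using L[OF x] by (subst (asm) (1 2) Lr[OF x]; simp)+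
    then show "\<bar>real_of_ereal (L x)\<bar> \<le> B" by linarith
    have "ereal (real_of_ereal (L x)) = ereal (f x + real_of_ereal (L (T x)))"
      using step[OF x] Lr[OF x] Lr[OF T[OF x]] by (metis plus_ereal.simps(1))
    then show "real_of_ereal (L x) - real_of_ereal (L (T x)) = f x" by simp
  qed
qed

lemma roth_data_of_roth_type:
  fixes p0 :: "'a::finite \<Rightarrow> nat"
  assumes "CARD('a) \<ge> 2" "admissible p0 p1" "\<forall>a. l a > 0" "roth_type p0 p1 l"
  shows "roth_data (p0, p1, l)"
proof
  show "keane_iem (p0, p1, l)"
    using assms by (simp add: keane_iem_def roth_type_def Let_def)
qed (insert assms(4), unfold roth_type_def Let_def snd_conv, (elim conjE, assumption)+)

text \<open>The derivative is given as a function \<open>\<Phi>'\<close> that agrees with it almost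
  everywhere, since an absolutely continuous function need not be differentiable at every
  point.\<close>

theorem theoremA:
  fixes p0 p1 :: "'a::finite \<Rightarrow> nat" and l :: "'a \<Rightarrow> real"
    and \<Phi> \<Phi>' :: "real \<Rightarrow> real"
  assumes "CARD('a) \<ge> 2"
    and "admissible p0 p1"
    and "\<forall>a. l a > 0"
    and "roth_type p0 p1 l"
    and "\<forall>a. abs_continuous_on (subint p0 l a) \<Phi>"
    and "\<forall>a. AE x in lborel. x \<in> subint p0 l a \<longrightarrow> (\<Phi> has_real_derivative \<Phi>' x) (at x)"
    and "\<forall>a. bounded_variation_on (subint p0 l a) \<Phi>'"
    and "(LINT x:{0..<total_length l}|lborel. \<Phi>' x) = 0"
  shows "\<exists>(chi::real \<Rightarrow> real) (\<Psi>::real \<Rightarrow> real).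
           (\<forall>a. \<exists>c. \<forall>x\<in>subint p0 l a. chi x = c) \<and>
           bounded (\<Psi> ` {0..<total_length l}) \<and>
           (\<forall>x\<in>{0..<total_length l}. \<Psi> x - \<Psi> (iem p0 p1 l x) = \<Phi> x - chi x)"
proof -
  define s where "s = (p0, p1, l)"
  interpret roth_data s unfolding s_def by (rule roth_data_of_roth_type[OF assms(1-4)])
  have s: "rowt s = p0" "rowb s = p1" "lens s = l" by (auto simp: s_def)
  have p0: "is_order p0" using assms(2) by (simp add: admissible_def)
  define L where "L = leftpt p0 l"
  define F where "F a t = \<Phi> (t + L a)" for a t
  define G where "G a t = \<Phi>' (t + L a)" for a t
  have sub: "subint p0 l a = {L a..<L a + l a}" for a by (simp add: subint_def L_def)
  have bv: "bounded_variation_on {L a..<L a + l a} \<Phi>'" for a using assms(7) sub by simp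
  \<comment> \<open>Integrability ensures that the vanishing integral is a genuine condition and not
    a default value.\<close>
  note si = bounded_variation_set_integrable[OF bv]
  have "primitive_on (lens s) F G"
    unfolding primitive_on_def s
  proof (intro allI impI)
    fix a x y assume xy: "0 \<le> x \<and> x \<le> y \<and> y < l a"
    obtain B where B: "\<And>t. t \<in> subint p0 l a \<Longrightarrow> \<bar>\<Phi>' t\<bar> \<le> B" using si(2)[of a] sub by blast
    have "(\<Phi>' has_integral \<Phi> (y + L a) - \<Phi> (x + L a)) {x + L a..y + L a}"
      by (rule abs_continuous_on_has_integral[OF assms(5)[rule_format, of a] _ _ assms(6)[rule_format] B])
        (use xy sub in auto)
    from has_integral_shift_real_ivl[OF this, of "L a"]
    show "(G a has_integral F a y - F a x) {x..y}" unfolding G_def F_def by simp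
  qed
  moreover
  have "\<exists>h M. (\<forall>x y. x \<in> subint p0 l a \<and> y \<in> subint p0 l a \<and> x \<le> y \<longrightarrow> \<bar>\<Phi>' y - \<Phi>' x\<bar> \<le> h y - h x) \<and>
      (\<forall>x\<in>subint p0 l a. 0 \<le> h x \<and> h x \<le> (M::real))" for a
    using bounded_variation_dominated[OF bv[of a]] unfolding sub by metis
  then obtain h M where h: "\<And>a x y. x \<in> subint p0 l a \<Longrightarrow> y \<in> subint p0 l a \<Longrightarrow> x \<le> y \<Longrightarrow> \<bar>\<Phi>' y - \<Phi>' x\<bar> \<le> h a y - h a x"
    "\<And>a x. x \<in> subint p0 l a \<Longrightarrow> 0 \<le> h a x \<and> h a x \<le> (M a::real)" by metis
  have "dominates (lens s) (\<lambda>a t. h a (t + L a)) G (\<Sum>a\<in>UNIV. M a)"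
    unfolding dominates_def s
  proof (intro conjI allI impI)
    fix a x y assume "0 \<le> x \<and> x \<le> y \<and> y < l a"
    then show "\<bar>G a y - G a x\<bar> \<le> h a (y + L a) - h a (x + L a)"
      unfolding G_def by (intro h(1)) (auto simp: sub)
  next
    fix X Y assume XY: "\<forall>a. 0 \<le> X a \<and> X a \<le> Y a \<and> Y a < l a"
    have "h a (Y a + L a) - h a (X a + L a) \<le> M a" for a
    proof -
      have "Y a + L a \<in> subint p0 l a" "X a + L a \<in> subint p0 l a"
        using XY[rule_format, of a] by (auto simp: sub)
      from h(2)[OF this(1)] h(2)[OF this(2)] show ?thesis by linarith
    qed
    then show "(\<Sum>a\<in>UNIV. h a (Y a + L a) - h a (X a + L a)) \<le> (\<Sum>a\<in>UNIV. M a)" by (intro sum_mono)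
  qed
  moreover
  have int: "\<Phi>' integrable_on {L a..L a + l a}" for a
    using set_borel_integral_eq_integral(1)[OF si(1)[of a]] by (simp add: integrable_on_Ico_iff)
  have "G a integrable_on {0..lens s a}" for a
    using integrable_shift_real_ivl[OF int[of a], of "L a"] unfolding G_def s by simp
  moreover
  have "(\<Sum>a\<in>UNIV. integral {0..lens s a} (G a)) = 0"
  proof -
    have Ga: "G a = (\<lambda>t. \<Phi>' (t + L a))" for a by (simp add: G_def fun_eq_iff)
    have "integral {0..l a} (G a) = (LINT x:subint p0 l a|lborel. \<Phi>' x)" for a
      using integral_shift_real_ivl[of "L a" "L a" "L a + l a" \<Phi>']
        set_borel_integral_eq_integral(2)[OF si(1)[of a]]
      by (simp add: Ga sub integrable_on_Ico_iff)
    then have "(\<Sum>a\<in>UNIV. integral {0..l a} (G a)) = (LINT x:(\<Union>a\<in>UNIV. subint p0 l a)|lborel. \<Phi>' x)"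
    proof (subst set_integral_finite_Union)
      show "disjoint_family_on (subint p0 l) UNIV"
        unfolding disjoint_family_on_def
      proof (intro ballI impI equals0I)
        fix a b x assume "a \<noteq> b" "x \<in> subint p0 l a \<inter> subint p0 l b"
        then show False
          using subint_unique[OF p0 assms(3), of "x - L a" a b] by (auto simp: sub L_def)
      qed
    qed (use si(1) sub in auto)
    also have "(\<Union>a\<in>UNIV. subint p0 l a) = {0..<total_length l}"
    proof
      show "(\<Union>a\<in>UNIV. subint p0 l a) \<subseteq> {0..<total_length l}"
      proof
        fix x assume "x \<in> (\<Union>a\<in>UNIV. subint p0 l a)"
        then obtain a where "leftpt p0 l a \<le> x" "x < leftpt p0 l a + l a" by (auto simp: subint_def)
        then show "x \<in> {0..<total_length l}"
          using leftpt_nonneg[OF assms(3), of p0 a] leftpt_add_le_total[OF assms(3), of p0 a] by simp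
      qed
      show "{0..<total_length l} \<subseteq> (\<Union>a\<in>UNIV. subint p0 l a)"
      proof
        fix x assume "x \<in> {0..<total_length l}"
        then obtain a t where "0 \<le> t" "t < l a" "x = leftpt p0 l a + t"
          using exists_coord[OF p0, of x l] by (metis atLeastLessThan_iff)
        then have "x \<in> subint p0 l a" by (simp add: subint_def)
        then show "x \<in> (\<Union>a\<in>UNIV. subint p0 l a)" by blast
      qed
    qed
    finally show ?thesis using assms(8) by (simp add: s)
  qed
  ultimately obtain v :: "real^'a" and \<mu> C where vC: "\<mu> > 0" "C > 0"
    "\<And>k a x. 0 \<le> x \<Longrightarrow> x < len k a \<Longrightarrow> \<bar>sbs s (\<lambda>a t. F a t - v $ a) (nacc s k) a x\<bar> \<le> C * q k powr (- \<mu>)"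
    using primitive_correction[of F G] by blast
  define f where "f = glue_of s (\<lambda>a t. F a t - v $ a)"
  obtain B where B: "\<And>x N. x \<in> range_of s \<Longrightarrow> \<bar>birk (T_of s) f x N\<bar> \<le> B"
    using bounded_birkhoff[OF vC] unfolding f_def by blast
  have "\<exists>\<Psi>. \<forall>x\<in>{0..<total_length l}. \<bar>\<Psi> x\<bar> \<le> B \<and> \<Psi> x - \<Psi> (iem p0 p1 l x) = f x"
  proof (rule bounded_partial_sums_coboundary)
    show "iem p0 p1 l x \<in> {0..<total_length l}" if "x \<in> {0..<total_length l}" for x
      by (rule iem_in_range[OF p0 assms(3) that])
    show "\<bar>\<Sum>i<N. f ((iem p0 p1 l ^^ i) x)\<bar> \<le> B" if "x \<in> {0..<total_length l}" for x N
      using B[of x N] that by (simp add: birk_def s)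
  qed
  then obtain \<Psi> where \<Psi>: "\<forall>x\<in>{0..<total_length l}. \<bar>\<Psi> x\<bar> \<le> B \<and> \<Psi> x - \<Psi> (iem p0 p1 l x) = f x"
    by blast
  \<comment> \<open>Recovered from f; on the interval of a it is the constant
    \<open>v $ a\<close>.\<close>
  define chi where "chi x = \<Phi> x - f x" for x
  have "chi x = v $ a" if "x \<in> subint p0 l a" for x a
  proof -
    have "f (L a + (x - L a)) = F a (x - L a) - v $ a"
      unfolding f_def s L_def by (rule glue_coord[OF p0 assms(3)]) (use that in \<open>auto simp: sub L_def\<close>)
    then show ?thesis by (simp add: chi_def F_def)
  qed
  moreover have "bounded (\<Psi> ` {0..<total_length l})"
    using \<Psi> by (intro boundedI[of _ B]) auto
  moreover have "\<Psi> x - \<Psi> (iem p0 p1 l x) = \<Phi> x - chi x" if "x \<in> {0..<total_length l}" for x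
    using \<Psi> that by (simp add: chi_def)
  ultimately show ?thesis by blast
qed

end
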